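(* Let $D_{27}$ be the exceptional bounded symmetric domain of dimension $27$, i.e. the open unit ball of $H_3(\mathbb{O})$ in its spectral norm. Then its squeezing constant is $\hat\sigma_{D_{27}}=1/\sqrt3$.
   Context: $\mathbb{O}$ is the complex Cayley algebra (complexified octonions, $\dim_{\mathbb{C}}\mathbb{O}=8$). $H_3(\mathbb{O})$ is the $27$-dimensional complex space of $3\times3$ matrices over $\mathbb{O}$ that are hermitian with respect to the canonical ($\mathbb{C}$-linear) involution of $\mathbb{O}$. It is a Jordan algebra with product $x\cdot y=\frac12(xy+yx)$ and a JB*-triple with triple product $\{x,y,z\}=(x\cdot y^* )\cdot z+x\cdot(y^*\cdot z)-y^*\cdot(x\cdot z)$, where $y\mapsto y^*$ is the conjugation of $H_3(\mathbb{O})$ given by complex conjugation of the entries. A tripotent is an element $e$ with $\{e,e,e\}=e$; a nonzero tripotent is minimal if $\{e,H_3(\mathbb{O}),e\}=\mathbb{C}e$. Elements $a,b$ are (triple) orthogonal if $\{a,b,x\}=0$ for all $x$. Every $z\in H_3(\mathbb{O})$ has a spectral decomposition $z=\alpha_1e_1+\alpha_2e_2+\alpha_3e_3$ with mutually orthogonal minimal tripotents $e_j$ and $\alpha_1\ge\alpha_2\ge\alpha_3\ge0$; the spectral norm is $\|z\|=\alpha_1$ (the JB*-triple norm). $D_{27}=\{z\in H_3(\mathbb{O}):\|z\|<1\}$. **Squeezing constant.** For a Hilbert space $H$, $B_H$ is its open unit ball and $rB_H=\{x\in H:\|x\|<r\}$. For a bounded domain $D$ in a complex Banach space $V$ linearly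 homeomorphic to $H$, $H(D,B_H)$ denotes the set of holomorphic embeddings of $D$ into $B_H$ (maps biholomorphic onto a domain in $B_H$); put $$\sigma_D(p)=\sup\{r>0:rB_H\subset f(D)\text{ for some }f\in H(D,B_H)\text{ with }f(p)=0\}$$ (independent of the choice of $H$) and $\hat\sigma_D=\inf_{p\in D}\sigma_D(p)$. *)

theory Defs
  imports "HOL-Analysis.Analysis"
begin

class complex_normed_vector = real_normed_vector +
  fixes scaleC :: "complex \<Rightarrow> 'a \<Rightarrow> 'a"  (infixr \<open>*\<^sub>C\<close> 75)
  assumes scaleC_add_right: "c *\<^sub>C (x + y) = c *\<^sub>C x + c *\<^sub>C y"
    and scaleC_add_left: "(c + d) *\<^sub>C x = c *\<^sub>C x + d *\<^sub>C x"
    and scaleC_scaleC: "c *\<^sub>C d *\<^sub>C x = (c * d) *\<^sub>C x"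
    and scaleC_of_real: "complex_of_real r *\<^sub>C x = r *\<^sub>R x"
    and norm_scaleC: "norm (c *\<^sub>C x) = cmod c * norm x"

text \<open>The inner product is linear in the first argument.\<close>

class complex_hilbert_space = complex_normed_vector + complete_space +
  fixes cinner :: "'a \<Rightarrow> 'a \<Rightarrow> complex"
  assumes cinner_commute: "cinner x y = cnj (cinner y x)"
    and cinner_add_left: "cinner (x + y) z = cinner x z + cinner y z"
    and cinner_scaleC_left: "cinner (c *\<^sub>C x) y = c * cinner x y"
    and norm_eq_sqrt_cinner: "norm x = sqrt (Re (cinner x x))"

instantiation complex :: complex_hilbert_space
begin

definition scaleC_complex :: "complex \<Rightarrow> complex \<Rightarrow> complex" where
  "scaleC_complex c x = c * x"

definition cinner_complex :: "complex \<Rightarrow> complex \<Rightarrow> complex" where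
  "cinner_complex x y = x * cnj y"

instance
proof
  fix x :: complex
  show "norm x = sqrt (Re (cinner x x))"
    by (simp add: cinner_complex_def cmod_def power2_eq_square)
qed (simp_all add: scaleC_complex_def cinner_complex_def distrib_left distrib_right norm_mult
      scaleR_conv_of_real mult.assoc mult.commute)

end

instantiation prod :: (complex_normed_vector, complex_normed_vector) complex_normed_vector
begin

definition scaleC_prod :: "complex \<Rightarrow> 'a \<times> 'b \<Rightarrow> 'a \<times> 'b" where
  "scaleC_prod c x = (c *\<^sub>C fst x, c *\<^sub>C snd x)"

instance
proof
  fix c :: complex and x :: "'a \<times> 'b"
  have "norm (c *\<^sub>C x) = sqrt ((cmod c)\<^sup>2 * ((norm (fst x))\<^sup>2 + (norm (snd x))\<^sup>2))"
    by (simp add: scaleC_prod_def norm_prod_def norm_scaleC power_mult_distrib distrib_left)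
  then show "norm (c *\<^sub>C x) = cmod c * norm x"
    by (simp add: norm_prod_def real_sqrt_mult)
qed (auto simp: scaleC_prod_def scaleC_add_right scaleC_add_left scaleC_scaleC
      scaleC_of_real prod_eq_iff)

end

instantiation vec :: (complex_normed_vector, finite) complex_normed_vector
begin

definition scaleC_vec :: "complex \<Rightarrow> 'a ^ 'b \<Rightarrow> 'a ^ 'b" where
  "scaleC_vec c x = (\<chi> i. c *\<^sub>C x $ i)"

instance
proof
  fix c :: complex and x :: "'a ^ 'b"
  show "norm (c *\<^sub>C x) = cmod c * norm x"
    by (simp add: scaleC_vec_def norm_vec_def norm_scaleC L2_set_right_distrib)
qed (auto simp: scaleC_vec_def scaleC_add_right scaleC_add_left scaleC_scaleC
      scaleC_of_real vec_eq_iff)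

end

instantiation vec :: (complex_hilbert_space, finite) complex_hilbert_space
begin

definition cinner_vec :: "'a ^ 'b \<Rightarrow> 'a ^ 'b \<Rightarrow> complex" where
  "cinner_vec x y = (\<Sum>i\<in>UNIV. cinner (x $ i) (y $ i))"

instance
proof
  fix x y z :: "'a ^ 'b" and c :: complex
  show "cinner x y = cnj (cinner y x)"
    unfolding cinner_vec_def cnj_sum by (rule sum.cong[OF refl], rule cinner_commute)
  show "cinner (x + y) z = cinner x z + cinner y z"
    by (simp add: cinner_vec_def cinner_add_left sum.distrib)
  show "cinner (c *\<^sub>C x) y = c * cinner x y"
    by (simp add: cinner_vec_def scaleC_vec_def cinner_scaleC_left sum_distrib_left)
  have "(norm v)\<^sup>2 = Re (cinner v v)" for v :: 'a
  proof -
    have "0 \<le> Re (cinner v v)"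
      using norm_ge_zero[of v] unfolding norm_eq_sqrt_cinner[of v] by (simp only: real_sqrt_ge_0_iff)
    then show ?thesis
      unfolding norm_eq_sqrt_cinner[of v] by (rule real_sqrt_pow2)
  qed
  then show "norm x = sqrt (Re (cinner x x))"
    by (simp add: norm_vec_def L2_set_def cinner_vec_def Re_sum)
qed

end

definition clinear_on ::
    "'a::complex_normed_vector set \<Rightarrow> ('a \<Rightarrow> 'b::complex_normed_vector) \<Rightarrow> bool" where
  "clinear_on V L \<longleftrightarrow> (\<forall>x\<in>V. \<forall>y\<in>V. L (x + y) = L x + L y) \<and> (\<forall>c. \<forall>x\<in>V. L (c *\<^sub>C x) = c *\<^sub>C L x)"

definition linearly_homeomorphic ::
    "'a::complex_normed_vector set \<Rightarrow> 'b::complex_normed_vector set \<Rightarrow> bool" where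
  "linearly_homeomorphic V W \<longleftrightarrow> (\<exists>L M. clinear_on V L \<and> homeomorphism V W L M)"

text \<open>
  The domains considered here are relatively open in a complex subspace \<open>V\<close> of the ambient type.
  The derivative is therefore taken within \<open>D\<close>: it is determined by \<open>f\<close> on \<open>V\<close> only, and its values
  off \<open>V\<close> are an arbitrary complex linear extension, which always exists when the ambient type is
  finite-dimensional.
\<close>

definition holomorphic_map_on ::
    "('a::complex_normed_vector \<Rightarrow> 'b::complex_normed_vector) \<Rightarrow> 'a set \<Rightarrow> bool" where
  "holomorphic_map_on f D \<longleftrightarrow>
     (\<forall>p\<in>D. \<exists>f'. clinear_on UNIV f' \<and> (f has_derivative f') (at p within D))"

text \<open>
  The Hilbert space is all of the type \<open>'h\<close>; it is passed as the argument \<open>TYPE('h)\<close> below.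
\<close>

definition hol_embeddings ::
    "'a::complex_normed_vector set \<Rightarrow> ('a \<Rightarrow> 'h::complex_hilbert_space) set" where
  "hol_embeddings D = {f. holomorphic_map_on f D \<and> inj_on f D \<and>
     f ` D \<subseteq> ball 0 1 \<and> open (f ` D) \<and> connected (f ` D) \<and>
     holomorphic_map_on (inv_into D f) (f ` D)}"

definition squeezing_function ::
    "'h::complex_hilbert_space itself \<Rightarrow> 'a::complex_normed_vector set \<Rightarrow> 'a \<Rightarrow> real" where
  "squeezing_function H D p =
     Sup {r. r > 0 \<and> (\<exists>f :: 'a \<Rightarrow> 'h. f \<in> hol_embeddings D \<and> f p = 0 \<and> ball 0 r \<subseteq> f ` D)}"

definition squeezing_constant ::
    "'h::complex_hilbert_space itself \<Rightarrow> 'a::complex_normed_vector set \<Rightarrow> real" where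
  "squeezing_constant H D = (INF p\<in>D. squeezing_function H D p)"

text \<open>
  The complex Cayley algebra \<open>coct\<close>: three Cayley--Dickson doublings of \<open>\<complex>\<close> with trivial involution, all
  \<open>\<complex>\<close>-bilinear. On real coordinates they give the real Cayley algebra, of which the type below is
  thus the complexification.
\<close>

definition cd_mult ::
    "('a \<Rightarrow> 'a \<Rightarrow> 'a) \<Rightarrow> ('a \<Rightarrow> 'a) \<Rightarrow> 'a \<times> 'a \<Rightarrow> 'a \<times> 'a \<Rightarrow> 'a::ab_group_add \<times> 'a" where
  "cd_mult m s = (\<lambda>(a, b) (c, d). (m a c - m (s d) b, m d a + m b (s c)))"

definition cd_inv :: "('a \<Rightarrow> 'a) \<Rightarrow> 'a \<times> 'a \<Rightarrow> 'a::ab_group_add \<times> 'a" where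
  "cd_inv s = (\<lambda>(a, b). (s a, - b))"

type_synonym cquat = "(complex \<times> complex) \<times> (complex \<times> complex)"
type_synonym coct = "cquat \<times> cquat"

definition cquat_inv :: "cquat \<Rightarrow> cquat" where
  "cquat_inv = cd_inv (cd_inv id)"

definition cquat_mult :: "cquat \<Rightarrow> cquat \<Rightarrow> cquat" where
  "cquat_mult = cd_mult (cd_mult (*) id) (cd_inv id)"

definition coct_inv :: "coct \<Rightarrow> coct" where
  "coct_inv = cd_inv cquat_inv"

definition coct_mult :: "coct \<Rightarrow> coct \<Rightarrow> coct" where
  "coct_mult = cd_mult cquat_mult cquat_inv"

text \<open>
  Complex conjugation of the coordinates, that is, conjugation with respect to the real Cayley
  algebra; not to be confused with the \<open>\<complex>\<close>-linear canonical involution \<open>coct_inv\<close>.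
\<close>

definition coct_cnj :: "coct \<Rightarrow> coct" where
  "coct_cnj =
     (let c2 = map_prod cnj cnj; c4 = map_prod c2 c2 in map_prod c4 c4)"

type_synonym coct_mat = "coct ^ 3 ^ 3"

definition H3O :: "coct_mat set" where
  "H3O = {A. \<forall>i j. A $ i $ j = coct_inv (A $ j $ i)}"

definition mat_mult :: "coct_mat \<Rightarrow> coct_mat \<Rightarrow> coct_mat" where
  "mat_mult A B = (\<chi> i j. \<Sum>k\<in>UNIV. coct_mult (A $ i $ k) (B $ k $ j))"

definition jordan :: "coct_mat \<Rightarrow> coct_mat \<Rightarrow> coct_mat" where
  "jordan x y = (1/2) *\<^sub>R (mat_mult x y + mat_mult y x)"

definition mat_cnj :: "coct_mat \<Rightarrow> coct_mat" where
  "mat_cnj A = (\<chi> i j. coct_cnj (A $ i $ j))"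

definition triple :: "coct_mat \<Rightarrow> coct_mat \<Rightarrow> coct_mat \<Rightarrow> coct_mat" where
  "triple x y z =
     jordan (jordan x (mat_cnj y)) z + jordan x (jordan (mat_cnj y) z)
       - jordan (mat_cnj y) (jordan x z)"

definition tripotent :: "coct_mat \<Rightarrow> bool" where
  "tripotent e \<longleftrightarrow> e \<in> H3O \<and> triple e e e = e"

definition minimal_tripotent :: "coct_mat \<Rightarrow> bool" where
  "minimal_tripotent e \<longleftrightarrow>
     tripotent e \<and> e \<noteq> 0 \<and> {triple e x e | x. x \<in> H3O} = {c *\<^sub>C e | c. True}"

definition triple_orthogonal :: "coct_mat \<Rightarrow> coct_mat \<Rightarrow> bool" where
  "triple_orthogonal a b \<longleftrightarrow> (\<forall>x\<in>H3O. triple a b x = 0)"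

definition spectral_decomposition ::
    "coct_mat \<Rightarrow> real \<times> real \<times> real \<Rightarrow> coct_mat \<times> coct_mat \<times> coct_mat \<Rightarrow> bool" where
  "spectral_decomposition z = (\<lambda>(\<alpha>1, \<alpha>2, \<alpha>3) (e1, e2, e3).
     (\<forall>e\<in>{e1, e2, e3}. minimal_tripotent e) \<and>
     triple_orthogonal e1 e2 \<and> triple_orthogonal e2 e1 \<and>
     triple_orthogonal e1 e3 \<and> triple_orthogonal e3 e1 \<and>
     triple_orthogonal e2 e3 \<and> triple_orthogonal e3 e2 \<and>
     \<alpha>1 \<ge> \<alpha>2 \<and> \<alpha>2 \<ge> \<alpha>3 \<and> \<alpha>3 \<ge> 0 \<and>
     z = \<alpha>1 *\<^sub>R e1 + \<alpha>2 *\<^sub>R e2 + \<alpha>3 *\<^sub>R e3)"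

definition spectral_norm :: "coct_mat \<Rightarrow> real" where
  "spectral_norm z = (THE \<alpha>1. \<exists>\<alpha>2 \<alpha>3 e. spectral_decomposition z (\<alpha>1, \<alpha>2, \<alpha>3) e)"

definition D27 :: "coct_mat set" where
  "D27 = {z \<in> H3O. spectral_norm z < 1}"

end

theory Submission
  imports Defs "HOL-Complex_Analysis.Conformal_Mappings"
begin

text \<open>
  Write \<open>e\<^sub>1, e\<^sub>2, e\<^sub>3\<close> for the diagonal matrix units and \<open>\<alpha>\<^sub>1 \<ge> \<alpha>\<^sub>2 \<ge> \<alpha>\<^sub>3\<close> for the spectral values of a
  point \<open>z\<close>. The Hermitian norm of \<open>H\<^sub>3(O)\<close> satisfies \<open>\<parallel>z\<parallel>\<^sup>2 = \<alpha>\<^sub>1\<^sup>2 + \<alpha>\<^sub>2\<^sup>2 + \<alpha>\<^sub>3\<^sup>2\<close>, so its unit ball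
  lies in the domain and the domain lies in the ball of radius \<open>\<surd>3\<close>. Scaling by \<open>1 / \<surd>3\<close> therefore
  shows that the squeezing function is at least \<open>1 / \<surd>3\<close> at the origin, and because the domain is
  homogeneous it is at least \<open>1 / \<surd>3\<close> everywhere (\<open>D27_embedding\<close>).

  Conversely, let \<open>f\<close> embed the domain into the unit ball with \<open>f 0 = 0\<close> and \<open>r B \<subseteq> f(D)\<close>, and let
  \<open>T\<close> be its derivative at 0. The Schwarz lemma for \<open>f\<close> along the points \<open>e\<^sub>1 \<plusminus> e\<^sub>2 \<plusminus> e\<^sub>3\<close> of the closed
  domain gives \<open>\<parallel>T(e\<^sub>1 \<plusminus> e\<^sub>2 \<plusminus> e\<^sub>3)\<parallel> \<le> 1\<close>; averaging over the signs,
  \<open>\<parallel>T e\<^sub>1\<parallel>\<^sup>2 + \<parallel>T e\<^sub>2\<parallel>\<^sup>2 + \<parallel>T e\<^sub>3\<parallel>\<^sup>2 \<le> 1\<close>. The Schwarz lemma for the diagonal entries of the inverse of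
  \<open>f\<close>, which are bounded by 1 on the domain, gives \<open>r \<le> \<parallel>T e\<^sub>i\<parallel>\<close>. Hence \<open>3 r\<^sup>2 \<le> 1\<close>
  (\<open>D27_upper_bound\<close>).

  Both halves need a usable description of the spectral norm. The triple product is expressed by the
  Hermitian form and the antilinear quadratic map \<open>dag x\<close>, the complex conjugate of the Freudenthal
  adjoint \<open>x\<^sup>#\<close> (\<open>triple_alb_mat\<close>); so every unitary map that commutes with \<open>dag\<close> preserves the triple
  product. These maps form a compact group, the compact group of type \<open>E\<^sub>6\<close>. Maximizing
  \<open>3 \<bar>x\<^sub>1\<bar>\<^sup>2 + 2 \<bar>x\<^sub>2\<bar>\<^sup>2 + \<bar>x\<^sub>3\<bar>\<^sup>2\<close>, with \<open>x\<^sub>i\<close> the diagonal entries, over an orbit leads to a diagonal matrix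
  with entries of decreasing modulus (\<open>alb_diagonalize\<close>). This yields spectral decompositions, and it
  expresses the elementary symmetric functions of the \<open>\<alpha>\<^sub>i\<^sup>2\<close> as the invariants \<open>\<parallel>z\<parallel>\<^sup>2\<close>, \<open>\<parallel>z\<^sup>#\<parallel>\<^sup>2\<close> and
  \<open>\<bar>N(z)\<bar>\<^sup>2\<close>, where \<open>N\<close> is the cubic norm. The domain is then given by three polynomial inequalities, and it
  is the connected component of 0 in the set where
  \<open>\<Delta> = 1 - \<parallel>z\<parallel>\<^sup>2 + \<parallel>z\<^sup>#\<parallel>\<^sup>2 - \<bar>N(z)\<bar>\<^sup>2\<close> is positive.

  Homogeneity follows by diagonalizing a point and moving its diagonal entries to 0 one at a time. The
  map that does this is an explicit rational one, and the identity
  \<open>\<bar>1 - cnj a x\<^sub>1\<bar>\<^sup>2 \<Delta>(g\<^sub>a z) = (1 - \<bar>a\<bar>\<^sup>2) \<Delta>(z)\<close> together with connectedness shows that it maps the domain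
  to itself (\<open>alb_delta_moebius\<close>, \<open>alb_moebius_dom\<close>).
\<close>

section \<open>Complex vector spaces\<close>

lemma scaleC_0_left [simp]: "0 *\<^sub>C (x::'a::complex_normed_vector) = 0"
  using norm_scaleC[of 0 x] by simp

lemma scaleC_0_right [simp]: "c *\<^sub>C (0::'a::complex_normed_vector) = 0"
  using norm_scaleC[of c 0] by simp

lemma scaleC_1 [simp]: "1 *\<^sub>C (x::'a::complex_normed_vector) = x"
  using scaleC_of_real[of 1 x] by simp

lemma scaleC_minus_left [simp]: "(- c) *\<^sub>C (x::'a::complex_normed_vector) = - (c *\<^sub>C x)"
  using scaleC_add_left[of c "-c" x] by (simp add: eq_neg_iff_add_eq_0 add.commute)

lemma scaleC_minus_right [simp]: "c *\<^sub>C (- x::'a::complex_normed_vector) = - (c *\<^sub>C x)"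
  using scaleC_add_right[of c x "-x"] by (simp add: eq_neg_iff_add_eq_0 add.commute)

lemma scaleC_diff_right: "c *\<^sub>C (x - y::'a::complex_normed_vector) = c *\<^sub>C x - c *\<^sub>C y"
  using scaleC_add_right[of c x "-y"] by simp

lemma scaleC_diff_left: "(c - d) *\<^sub>C (x::'a::complex_normed_vector) = c *\<^sub>C x - d *\<^sub>C x"
  using scaleC_add_left[of c "-d" x] by simp

interpretation cvec: vector_space "scaleC :: complex \<Rightarrow> 'a \<Rightarrow> 'a::complex_normed_vector"
  by unfold_locales (simp_all add: scaleC_add_right scaleC_add_left scaleC_scaleC)

section \<open>The complex Cayley algebra\<close>

notation coct_mult (infixl "\<odot>" 70)

text \<open>
  The bilinear form that polarizes the norm of the algebra. It is symmetric; the Hermitian pairing of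
  \<open>a\<close> and \<open>b\<close> is \<open>a \<bullet>\<^sub>o coct_cnj b\<close>.
\<close>
definition oct_dot :: "coct \<Rightarrow> coct \<Rightarrow> complex" (infix "\<bullet>\<^sub>o" 70) where
  "oct_dot = (\<lambda>(((a1,a2),(a3,a4)),((a5,a6),(a7,a8))) (((b1,b2),(b3,b4)),((b5,b6),(b7,b8))).
     a1*b1+a2*b2+a3*b3+a4*b4+a5*b5+a6*b6+a7*b7+a8*b8)"

definition oct_of :: "complex \<Rightarrow> coct" where "oct_of c = (((c,0),(0,0)),((0,0),(0,0)))"

text \<open>
  The coefficient of the unit element; the image of \<open>oct_of\<close> is the centre.
\<close>
definition oct_sc :: "coct \<Rightarrow> complex" where "oct_sc a = fst (fst (fst a))"

lemma coct_exhaust: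
  obtains a1 a2 a3 a4 a5 a6 a7 a8 where "(a::coct) = (((a1,a2),(a3,a4)),((a5,a6),(a7,a8)))"
  by (metis prod.exhaust)

lemmas oct_coords = coct_mult_def cquat_mult_def coct_inv_def cquat_inv_def cd_mult_def cd_inv_def
  oct_dot_def oct_sc_def oct_of_def coct_cnj_def Let_def scaleC_prod_def scaleC_complex_def zero_prod_def


lemma oct_dot_commute: "a \<bullet>\<^sub>o b = b \<bullet>\<^sub>o a"
  by (cases a rule: coct_exhaust; cases b rule: coct_exhaust) (simp add: oct_coords)

lemma oct_dot_add_left: "(a + b) \<bullet>\<^sub>o c = a \<bullet>\<^sub>o c + b \<bullet>\<^sub>o c"
  by (cases a rule: coct_exhaust; cases b rule: coct_exhaust; cases c rule: coct_exhaust)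
     (simp add: oct_coords algebra_simps)

lemma oct_dot_scaleC_left: "(k *\<^sub>C a) \<bullet>\<^sub>o b = k * (a \<bullet>\<^sub>o b)"
  by (cases a rule: coct_exhaust; cases b rule: coct_exhaust) (simp add: oct_coords algebra_simps)

lemma oct_dot_add_right: "c \<bullet>\<^sub>o (a + b) = c \<bullet>\<^sub>o a + c \<bullet>\<^sub>o b"
  by (metis oct_dot_commute oct_dot_add_left)

lemma oct_dot_scaleC_right: "a \<bullet>\<^sub>o (k *\<^sub>C b) = k * (a \<bullet>\<^sub>o b)"
  by (metis oct_dot_commute oct_dot_scaleC_left)

lemma oct_dot_zero [simp]: "0 \<bullet>\<^sub>o b = 0" "b \<bullet>\<^sub>o 0 = 0"
  using oct_dot_scaleC_left[of 0 0 b] oct_dot_scaleC_right[of b 0 0] by simp_all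

lemma oct_dot_minus [simp]: "(- a) \<bullet>\<^sub>o b = - (a \<bullet>\<^sub>o b)" "a \<bullet>\<^sub>o (- b) = - (a \<bullet>\<^sub>o b)"
  using oct_dot_scaleC_left[of "-1" a b] oct_dot_scaleC_right[of a "-1" b] by simp_all

lemma oct_dot_diff_left: "(a - b) \<bullet>\<^sub>o c = a \<bullet>\<^sub>o c - b \<bullet>\<^sub>o c"
  using oct_dot_add_left[of a "-b" c] by simp

lemma oct_dot_diff_right: "c \<bullet>\<^sub>o (a - b) = c \<bullet>\<^sub>o a - c \<bullet>\<^sub>o b"
  using oct_dot_add_right[of c a "-b"] by simp

lemma oct_dot_scaleR: "(r *\<^sub>R a) \<bullet>\<^sub>o b = of_real r * (a \<bullet>\<^sub>o b)" "a \<bullet>\<^sub>o (r *\<^sub>R b) = of_real r * (a \<bullet>\<^sub>o b)"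
  by (simp_all flip: scaleC_of_real add: oct_dot_scaleC_left oct_dot_scaleC_right)

lemmas oct_dot_linear = oct_dot_add_left oct_dot_add_right oct_dot_diff_left oct_dot_diff_right
  oct_dot_scaleC_left oct_dot_scaleC_right oct_dot_scaleR

text \<open>
  The form is nondegenerate, so an equation between Cayley numbers can be tested against every \<open>t\<close>.
  Testing turns an equation with scalar coefficients into a polynomial identity over the complex
  numbers in the atoms \<open>a \<bullet>\<^sub>o t\<close>; most identities below are proved in this way.
\<close>
lemma oct_eqI: assumes "\<And>t. a \<bullet>\<^sub>o t = b \<bullet>\<^sub>o t" shows "a = b"
proof -
  obtain a1 a2 a3 a4 a5 a6 a7 a8 where a: "a = (((a1,a2),(a3,a4)),((a5,a6),(a7,a8)))"
    by (rule coct_exhaust)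
  obtain b1 b2 b3 b4 b5 b6 b7 b8 where b: "b = (((b1,b2),(b3,b4)),((b5,b6),(b7,b8)))"
    by (rule coct_exhaust)
  show ?thesis
    using assms[of "(((1,0),(0,0)),((0,0),(0,0)))"] assms[of "(((0,1),(0,0)),((0,0),(0,0)))"]
      assms[of "(((0,0),(1,0)),((0,0),(0,0)))"] assms[of "(((0,0),(0,1)),((0,0),(0,0)))"]
      assms[of "(((0,0),(0,0)),((1,0),(0,0)))"] assms[of "(((0,0),(0,0)),((0,1),(0,0)))"]
      assms[of "(((0,0),(0,0)),((0,0),(1,0)))"] assms[of "(((0,0),(0,0)),((0,0),(0,1)))"]
    unfolding a b by (simp add: oct_dot_def)
qed

lemma oct_mult_add_left: "(a + b) \<odot> c = a \<odot> c + b \<odot> c"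
  by (cases a rule: coct_exhaust; cases b rule: coct_exhaust; cases c rule: coct_exhaust)
     (simp add: oct_coords algebra_simps)

lemma oct_mult_add_right: "c \<odot> (a + b) = c \<odot> a + c \<odot> b"
  by (cases a rule: coct_exhaust; cases b rule: coct_exhaust; cases c rule: coct_exhaust)
     (simp add: oct_coords algebra_simps)

lemma oct_mult_scaleC_left: "(k *\<^sub>C a) \<odot> b = k *\<^sub>C (a \<odot> b)"
  by (cases a rule: coct_exhaust; cases b rule: coct_exhaust) (simp add: oct_coords algebra_simps)

lemma oct_mult_scaleC_right: "a \<odot> (k *\<^sub>C b) = k *\<^sub>C (a \<odot> b)"
  by (cases a rule: coct_exhaust; cases b rule: coct_exhaust) (simp add: oct_coords algebra_simps)

lemma oct_mult_zero [simp]: "0 \<odot> b = 0" "b \<odot> 0 = 0"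
  using oct_mult_scaleC_left[of 0 0 b] oct_mult_scaleC_right[of b 0 0] by simp_all

lemma oct_mult_minus [simp]: "(- a) \<odot> b = - (a \<odot> b)" "a \<odot> (- b) = - (a \<odot> b)"
  using oct_mult_scaleC_left[of "-1" a b] oct_mult_scaleC_right[of a "-1" b] by simp_all

lemma oct_mult_diff_left: "(a - b) \<odot> c = a \<odot> c - b \<odot> c"
  using oct_mult_add_left[of a "-b" c] by simp

lemma oct_mult_diff_right: "c \<odot> (a - b) = c \<odot> a - c \<odot> b"
  using oct_mult_add_right[of c a "-b"] by simp

lemma oct_mult_scaleR: "(r *\<^sub>R a) \<odot> b = r *\<^sub>R (a \<odot> b)" "a \<odot> (r *\<^sub>R b) = r *\<^sub>R (a \<odot> b)"
  by (simp_all flip: scaleC_of_real add: oct_mult_scaleC_left oct_mult_scaleC_right)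

lemmas oct_mult_linear = oct_mult_add_left oct_mult_add_right oct_mult_diff_left oct_mult_diff_right
  oct_mult_scaleC_left oct_mult_scaleC_right oct_mult_scaleR

lemma oct_inv_add: "coct_inv (a + b) = coct_inv a + coct_inv b"
  by (cases a rule: coct_exhaust; cases b rule: coct_exhaust) (simp add: oct_coords)

lemma oct_inv_scaleC: "coct_inv (k *\<^sub>C a) = k *\<^sub>C coct_inv a"
  by (cases a rule: coct_exhaust) (simp add: oct_coords)

lemma oct_inv_zero [simp]: "coct_inv 0 = 0"
  using oct_inv_scaleC[of 0 0] by simp

lemma oct_inv_minus [simp]: "coct_inv (- a) = - coct_inv a"
  using oct_inv_scaleC[of "-1" a] by simp

lemma oct_inv_diff: "coct_inv (a - b) = coct_inv a - coct_inv b"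
  using oct_inv_add[of a "-b"] by simp

lemma oct_inv_scaleR: "coct_inv (r *\<^sub>R a) = r *\<^sub>R coct_inv a"
  by (simp flip: scaleC_of_real add: oct_inv_scaleC)

lemmas oct_inv_linear = oct_inv_add oct_inv_diff oct_inv_scaleC oct_inv_scaleR

lemma oct_inv_inv [simp]: "coct_inv (coct_inv a) = a"
  by (cases a rule: coct_exhaust) (simp add: oct_coords)

lemma oct_inv_mult: "coct_inv (a \<odot> b) = coct_inv b \<odot> coct_inv a"
  by (cases a rule: coct_exhaust; cases b rule: coct_exhaust) (simp add: oct_coords algebra_simps)

lemma oct_dot_inv: "coct_inv a \<bullet>\<^sub>o b = a \<bullet>\<^sub>o coct_inv b"
  by (cases a rule: coct_exhaust; cases b rule: coct_exhaust) (simp add: oct_coords)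

lemma oct_inv_eq: "coct_inv a = (2 * oct_sc a) *\<^sub>C oct_of 1 - a"
  by (cases a rule: coct_exhaust) (simp add: oct_coords)

lemma oct_mult_of [simp]: "oct_of k \<odot> a = k *\<^sub>C a" "a \<odot> oct_of k = k *\<^sub>C a"
  by (cases a rule: coct_exhaust; simp add: oct_coords)+

lemma oct_inv_of [simp]: "coct_inv (oct_of k) = oct_of k"
  by (simp add: oct_coords)

lemma oct_dot_of [simp]: "a \<bullet>\<^sub>o oct_of k = k * oct_sc a" "oct_of k \<bullet>\<^sub>o a = k * oct_sc a"
  by (cases a rule: coct_exhaust; simp add: oct_coords)+

lemma oct_of_linear: "oct_of (c + d) = oct_of c + oct_of d" "oct_of (c - d) = oct_of c - oct_of d"
  "k *\<^sub>C oct_of c = oct_of (k * c)" "- oct_of c = oct_of (- c)"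
  by (simp_all add: oct_coords)

lemma oct_sc_linear: "oct_sc (a + b) = oct_sc a + oct_sc b" "oct_sc (a - b) = oct_sc a - oct_sc b"
  "oct_sc (k *\<^sub>C a) = k * oct_sc a" "oct_sc (- a) = - oct_sc a" "oct_sc (r *\<^sub>R a) = of_real r * oct_sc a"
  by (simp_all add: oct_coords scaleR_conv_of_real)

lemma oct_sc_inv [simp]: "oct_sc (coct_inv a) = oct_sc a"
  by (cases a rule: coct_exhaust) (simp add: oct_coords)

lemma oct_sc_of [simp]: "oct_sc (oct_of c) = c"
  by (simp add: oct_coords)

lemma oct_sc_mult: "oct_sc (a \<odot> b) = a \<bullet>\<^sub>o coct_inv b"
  by (cases a rule: coct_exhaust; cases b rule: coct_exhaust) (simp add: oct_coords algebra_simps)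

lemma oct_dot_mult_right: "(a \<odot> b) \<bullet>\<^sub>o c = a \<bullet>\<^sub>o (c \<odot> coct_inv b)"
  by (cases a rule: coct_exhaust; cases b rule: coct_exhaust; cases c rule: coct_exhaust)
     (simp add: oct_coords algebra_simps)

lemma oct_dot_mult_left: "(a \<odot> b) \<bullet>\<^sub>o c = b \<bullet>\<^sub>o (coct_inv a \<odot> c)"
  by (metis oct_dot_mult_right oct_inv_mult oct_dot_inv oct_inv_inv)

text \<open>
  Left alternativity in terms of the involution. Together with the fact that multiplication by \<open>a\<close>
  has adjoint multiplication by \<open>coct_inv a\<close>, it carries the composition law for the norm.
\<close>
lemma oct_alt_left: "coct_inv a \<odot> (a \<odot> b) = (a \<bullet>\<^sub>o a) *\<^sub>C b"
  by (cases a rule: coct_exhaust; cases b rule: coct_exhaust) (simp add: oct_coords algebra_simps)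

lemma oct_norm_mult_left: "(a \<odot> b) \<bullet>\<^sub>o (a \<odot> c) = (a \<bullet>\<^sub>o a) * (b \<bullet>\<^sub>o c)"
  by (simp add: oct_dot_mult_left oct_alt_left oct_dot_scaleC_right)

text \<open>
  Both factors of the composition law polarized.
\<close>
lemma oct_exchange: "(a \<odot> c) \<bullet>\<^sub>o (b \<odot> d) + (a \<odot> d) \<bullet>\<^sub>o (b \<odot> c) = 2 * (a \<bullet>\<^sub>o b) * (c \<bullet>\<^sub>o d)"
  using oct_norm_mult_left[of "a + b" c d] oct_norm_mult_left[of a c d] oct_norm_mult_left[of b c d]
  by (simp add: oct_mult_linear oct_dot_linear oct_dot_commute[of b a]
      oct_dot_commute[of "b \<odot> c" "a \<odot> d"] algebra_simps)

lemma oct_alt_right: "(b \<odot> a) \<odot> coct_inv a = (a \<bullet>\<^sub>o a) *\<^sub>C b"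
  using arg_cong[OF oct_alt_left[of "coct_inv a" "coct_inv b"], of coct_inv]
  by (simp add: oct_inv_mult oct_inv_linear oct_dot_inv)

lemma oct_alt_right2: "(b \<odot> a) \<odot> coct_inv c + (b \<odot> c) \<odot> coct_inv a = (2 * (a \<bullet>\<^sub>o c)) *\<^sub>C b"
  using oct_alt_right[of b "a + c"] oct_alt_right[of b a] oct_alt_right[of b c]
  by (simp add: oct_mult_linear oct_inv_linear oct_dot_linear oct_dot_commute[of c a]
      scaleC_add_left algebra_simps)

text \<open>
  Pairing with \<open>t\<close> and exchanging factors isolates \<open>u\<close>, and what remains depends on \<open>a\<close> and \<open>b\<close> only
  through their product. The middle Moufang identity is the comparison with the pair \<open>a \<odot> b\<close>, 1.
\<close>
lemma oct_bimult: "(u \<odot> a) \<odot> (b \<odot> u) = (2 * ((a \<odot> b) \<bullet>\<^sub>o coct_inv u)) *\<^sub>C u - (u \<bullet>\<^sub>o u) *\<^sub>C coct_inv (a \<odot> b)"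
proof (rule oct_eqI)
  fix t
  let ?s = "coct_inv u \<odot> coct_inv b"
  have "((u \<odot> a) \<odot> (b \<odot> u)) \<bullet>\<^sub>o t = (u \<odot> a) \<bullet>\<^sub>o (t \<odot> ?s)"
    by (simp add: oct_dot_mult_right oct_inv_mult)
  also have "\<dots> = 2 * (u \<bullet>\<^sub>o t) * (a \<bullet>\<^sub>o ?s) - (u \<odot> ?s) \<bullet>\<^sub>o (t \<odot> a)"
    using oct_exchange[of u a t ?s] by (simp add: algebra_simps)
  also have "u \<odot> ?s = (u \<bullet>\<^sub>o u) *\<^sub>C coct_inv b"
    using oct_alt_left[of "coct_inv u" "coct_inv b"] by (simp add: oct_dot_inv)
  also have "a \<bullet>\<^sub>o ?s = (a \<odot> b) \<bullet>\<^sub>o coct_inv u"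
    by (simp add: oct_dot_mult_right)
  also have "((u \<bullet>\<^sub>o u) *\<^sub>C coct_inv b) \<bullet>\<^sub>o (t \<odot> a) = (u \<bullet>\<^sub>o u) * (coct_inv (a \<odot> b) \<bullet>\<^sub>o t)"
    by (simp add: oct_dot_linear oct_inv_mult) (metis oct_dot_mult_right oct_inv_inv oct_dot_commute)
  finally show "((u \<odot> a) \<odot> (b \<odot> u)) \<bullet>\<^sub>o t =
      ((2 * ((a \<odot> b) \<bullet>\<^sub>o coct_inv u)) *\<^sub>C u - (u \<bullet>\<^sub>o u) *\<^sub>C coct_inv (a \<odot> b)) \<bullet>\<^sub>o t"
    by (simp add: oct_dot_linear algebra_simps)
qed

lemma oct_moufang: "(u \<odot> a) \<odot> (b \<odot> u) = (u \<odot> (a \<odot> b)) \<odot> u"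
  using oct_bimult[of u a b] oct_bimult[of u "a \<odot> b" "oct_of 1"] by simp

lemma oct_flexible: "(u \<odot> a) \<odot> u = u \<odot> (a \<odot> u)"
  using oct_moufang[of u "oct_of 1" a] by simp

lemma oct_cnj_add: "coct_cnj (a + b) = coct_cnj a + coct_cnj b"
  by (cases a rule: coct_exhaust; cases b rule: coct_exhaust) (simp add: oct_coords)

lemma oct_cnj_scaleC: "coct_cnj (k *\<^sub>C a) = cnj k *\<^sub>C coct_cnj a"
  by (cases a rule: coct_exhaust) (simp add: oct_coords)

lemma oct_cnj_zero [simp]: "coct_cnj 0 = 0"
  using oct_cnj_scaleC[of 0 0] by simp

lemma oct_cnj_minus [simp]: "coct_cnj (- a) = - coct_cnj a"
  using oct_cnj_scaleC[of "-1" a] by simp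

lemma oct_cnj_diff: "coct_cnj (a - b) = coct_cnj a - coct_cnj b"
  using oct_cnj_add[of a "-b"] by simp

lemma oct_cnj_scaleR: "coct_cnj (r *\<^sub>R a) = r *\<^sub>R coct_cnj a"
  using oct_cnj_scaleC[of "of_real r" a] by (simp add: scaleC_of_real)

lemmas oct_cnj_linear = oct_cnj_add oct_cnj_diff oct_cnj_scaleC oct_cnj_scaleR

lemma oct_cnj_cnj [simp]: "coct_cnj (coct_cnj a) = a"
  by (cases a rule: coct_exhaust) (simp add: oct_coords)

lemma oct_cnj_inv: "coct_cnj (coct_inv a) = coct_inv (coct_cnj a)"
  by (cases a rule: coct_exhaust) (simp add: oct_coords)

lemma oct_cnj_of [simp]: "coct_cnj (oct_of c) = oct_of (cnj c)"
  by (simp add: oct_coords)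

lemma oct_sc_cnj [simp]: "oct_sc (coct_cnj a) = cnj (oct_sc a)"
  by (cases a rule: coct_exhaust) (simp add: oct_coords)

lemma oct_cnj_mult: "coct_cnj (a \<odot> b) = coct_cnj a \<odot> coct_cnj b"
  by (cases a rule: coct_exhaust; cases b rule: coct_exhaust) (simp add: oct_coords algebra_simps)

lemma oct_cnj_dot: "coct_cnj a \<bullet>\<^sub>o coct_cnj b = cnj (a \<bullet>\<^sub>o b)"
  by (cases a rule: coct_exhaust; cases b rule: coct_exhaust) (simp add: oct_coords)

lemma oct_dot_cnj_self: "a \<bullet>\<^sub>o coct_cnj a = of_real ((norm a)\<^sup>2)"
  by (cases a rule: coct_exhaust)
     (simp add: oct_coords norm_prod_def complex_norm_square[symmetric])

section \<open>Coordinates on the Albert algebra\<close>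

text \<open>
  Coordinates on the Hermitian matrices: the diagonal entries, and for each index \<open>i\<close> the entry in row
  \<open>i + 1\<close> and column \<open>i + 2\<close>, where the arithmetic of the index type is modulo 3. With this
  labelling all formulas are invariant under the cyclic shift of the indices, so that one generic index
  suffices in most proofs.
\<close>
type_synonym alb = "(complex ^ 3) \<times> (coct ^ 3)"

definition dg :: "alb \<Rightarrow> 3 \<Rightarrow> complex" where "dg v i = fst v $ i"
definition od :: "alb \<Rightarrow> 3 \<Rightarrow> coct" where "od v i = snd v $ i"
definition alb_mk :: "(3 \<Rightarrow> complex) \<Rightarrow> (3 \<Rightarrow> coct) \<Rightarrow> alb" where
  "alb_mk x a = (\<chi> i. x i, \<chi> i. a i)"

lemma dg_mk [simp]: "dg (alb_mk x a) = x" and od_mk [simp]: "od (alb_mk x a) = a"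
  by (simp_all add: fun_eq_iff dg_def od_def alb_mk_def)

lemma alb_mk_eta [simp]: "alb_mk (dg v) (od v) = v"
  by (simp add: prod_eq_iff vec_eq_iff dg_def od_def alb_mk_def)

lemma alb_eqI: "(\<And>i. dg u i = dg v i) \<Longrightarrow> (\<And>i. od u i = od v i) \<Longrightarrow> u = v"
  by (simp add: prod_eq_iff vec_eq_iff dg_def od_def)

lemma alb_coords [simp]:
  "dg (u + v) i = dg u i + dg v i" "od (u + v) i = od u i + od v i"
  "dg (u - v) i = dg u i - dg v i" "od (u - v) i = od u i - od v i"
  "dg (- v) i = - dg v i" "od (- v) i = - od v i"
  "dg (c *\<^sub>C v) i = c * dg v i" "od (c *\<^sub>C v) i = c *\<^sub>C od v i"
  "dg (r *\<^sub>R v) i = of_real r * dg v i" "od (r *\<^sub>R v) i = r *\<^sub>R od v i"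
  "dg 0 i = 0" "od 0 i = 0"
  by (simp_all add: dg_def od_def scaleC_prod_def scaleC_vec_def scaleC_complex_def scaleR_complex.ctr complex_eq_iff)

lemma cyc3 [simp]: fixes i :: 3
  shows "i + 1 + 1 = i + 2" "i + 1 + 2 = i" "i + 2 + 1 = i" "i + 2 + 2 = i + 1" "i + 3 = i"
  using exhaust_3[of i] by auto

lemma cyc3_neq [simp]: fixes i :: 3
  shows "i + 1 \<noteq> i" "i + 2 \<noteq> i" "i + 1 \<noteq> i + 2" "i + 2 \<noteq> i + 1" "i \<noteq> i + 1" "i \<noteq> i + 2"
  using exhaust_3[of i] by auto

text \<open>
  Adding to the literal indices 1, 2, 3 produces the numerals 4 and 5.
\<close>
lemma num3 [simp]: "(4 :: 3) = 1" "(5 :: 3) = 2"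
  by simp_all

lemma sum_cyc3: "sum f (UNIV :: 3 set) = f i + f (i + 1) + f (i + 2)"
  using exhaust_3[of i] by (auto simp: sum_3 add_ac)

lemma all_cyc3: "(\<forall>j. P j) \<longleftrightarrow> P i \<and> P (i + 1) \<and> P (i + 2)" for i :: 3
  using exhaust_3[of i] by (auto simp: forall_3)

definition alb_cnj :: "alb \<Rightarrow> alb" where
  "alb_cnj v = alb_mk (\<lambda>i. cnj (dg v i)) (\<lambda>i. coct_cnj (od v i))"

text \<open>
  The trace of the Jordan product; an off-diagonal entry occurs twice in the matrix.
\<close>
definition tr_form :: "alb \<Rightarrow> alb \<Rightarrow> complex" where
  "tr_form u v = (\<Sum>i\<in>UNIV. dg u i * dg v i) + 2 * (\<Sum>i\<in>UNIV. od u i \<bullet>\<^sub>o od v i)"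

definition herm :: "alb \<Rightarrow> alb \<Rightarrow> complex" where
  "herm u v = tr_form u (alb_cnj v)"

definition hsq :: "alb \<Rightarrow> real" where
  "hsq v = (\<Sum>i\<in>UNIV. (cmod (dg v i))\<^sup>2) + 2 * (\<Sum>i\<in>UNIV. (norm (od v i))\<^sup>2)"

text \<open>
  The Freudenthal product, normalized so that \<open>cross v v\<close> is twice the adjoint \<open>sharp v\<close> defined next.
\<close>
definition cross :: "alb \<Rightarrow> alb \<Rightarrow> alb" where
  "cross u v = alb_mk
     (\<lambda>i. dg u (i+1) * dg v (i+2) + dg u (i+2) * dg v (i+1) - 2 * (od u i \<bullet>\<^sub>o od v i))
     (\<lambda>i. coct_inv (od u (i+1) \<odot> od v (i+2) + od v (i+1) \<odot> od u (i+2))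
            - dg u i *\<^sub>C od v i - dg v i *\<^sub>C od u i)"

text \<open>
  The adjugate matrix.
\<close>
definition sharp :: "alb \<Rightarrow> alb" where
  "sharp v = alb_mk (\<lambda>i. dg v (i+1) * dg v (i+2) - od v i \<bullet>\<^sub>o od v i)
     (\<lambda>i. coct_inv (od v (i+1) \<odot> od v (i+2)) - dg v i *\<^sub>C od v i)"

text \<open>
  The determinant.
\<close>
definition cubic_norm :: "alb \<Rightarrow> complex" where
  "cubic_norm v = dg v 1 * dg v 2 * dg v 3 - (\<Sum>i\<in>UNIV. dg v i * (od v i \<bullet>\<^sub>o od v i))
     + 2 * (od v 1 \<bullet>\<^sub>o coct_inv (od v 2 \<odot> od v 3))"

definition alb_jordan :: "alb \<Rightarrow> alb \<Rightarrow> alb" where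
  "alb_jordan u v = alb_mk
     (\<lambda>i. dg u i * dg v i + od u (i+1) \<bullet>\<^sub>o od v (i+1) + od u (i+2) \<bullet>\<^sub>o od v (i+2))
     (\<lambda>i. (1/2) *\<^sub>C ((dg u (i+1) + dg u (i+2)) *\<^sub>C od v i + (dg v (i+1) + dg v (i+2)) *\<^sub>C od u i
          + coct_inv (od u (i+1) \<odot> od v (i+2) + od v (i+1) \<odot> od u (i+2))))"

lemma alb_cnj_coords [simp]:
  "dg (alb_cnj v) i = cnj (dg v i)" "od (alb_cnj v) i = coct_cnj (od v i)"
  by (simp_all add: alb_cnj_def)

lemma cross_coords [simp]:
  "dg (cross u v) i = dg u (i+1) * dg v (i+2) + dg u (i+2) * dg v (i+1) - 2 * (od u i \<bullet>\<^sub>o od v i)"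
  "od (cross u v) i = coct_inv (od u (i+1) \<odot> od v (i+2) + od v (i+1) \<odot> od u (i+2))
            - dg u i *\<^sub>C od v i - dg v i *\<^sub>C od u i"
  by (simp_all add: cross_def)

lemma sharp_coords [simp]:
  "dg (sharp v) i = dg v (i+1) * dg v (i+2) - od v i \<bullet>\<^sub>o od v i"
  "od (sharp v) i = coct_inv (od v (i+1) \<odot> od v (i+2)) - dg v i *\<^sub>C od v i"
  by (simp_all add: sharp_def)

lemma alb_jordan_coords [simp]:
  "dg (alb_jordan u v) i = dg u i * dg v i + od u (i+1) \<bullet>\<^sub>o od v (i+1) + od u (i+2) \<bullet>\<^sub>o od v (i+2)"
  "od (alb_jordan u v) i = (1/2) *\<^sub>C ((dg u (i+1) + dg u (i+2)) *\<^sub>C od v i + (dg v (i+1) + dg v (i+2)) *\<^sub>C od u i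
          + coct_inv (od u (i+1) \<odot> od v (i+2) + od v (i+1) \<odot> od u (i+2)))"
  by (simp_all add: alb_jordan_def)

text \<open>
  The trilinear form \<open>oct_sc ((a \<odot> b) \<odot> c)\<close> is invariant under cyclic permutations.
\<close>
lemma oct_triality: "a \<bullet>\<^sub>o (coct_inv c \<odot> coct_inv b) = b \<bullet>\<^sub>o (coct_inv a \<odot> coct_inv c)"
proof -
  have "(coct_inv c \<odot> coct_inv b) \<bullet>\<^sub>o a = coct_inv c \<bullet>\<^sub>o (a \<odot> b)"
    by (simp add: oct_dot_mult_right)
  moreover have "(coct_inv a \<odot> coct_inv c) \<bullet>\<^sub>o b = coct_inv c \<bullet>\<^sub>o (a \<odot> b)"
    by (simp add: oct_dot_mult_left)
  ultimately show ?thesis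
    unfolding oct_dot_commute[of a "coct_inv c \<odot> coct_inv b"] oct_dot_commute[of b "coct_inv a \<odot> coct_inv c"]
    by (rule trans[OF _ sym])
qed

text \<open>
  Expansion of the determinant along row \<open>i\<close>.
\<close>
lemma cubic_norm_row:
  "cubic_norm v = dg v i * dg (sharp v) i + od v (i+1) \<bullet>\<^sub>o od (sharp v) (i+1)
     + od v (i+2) \<bullet>\<^sub>o od (sharp v) (i+2)"
proof -
  have c: "cubic_norm v = dg v i * dg v (i+1) * dg v (i+2)
      - (\<Sum>i\<in>UNIV. dg v i * (od v i \<bullet>\<^sub>o od v i)) + 2 * (od v i \<bullet>\<^sub>o coct_inv (od v (i+1) \<odot> od v (i+2)))"
    using exhaust_3[of i] oct_triality[of "od v 1" "od v 3" "od v 2"] oct_triality[of "od v 1" "od v 2" "od v 3"]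
      oct_triality[of "od v 3" "od v 2" "od v 1"]
    by (auto simp: cubic_norm_def oct_inv_mult)
  show ?thesis unfolding c sum_cyc3[of _ i]
    using oct_triality[of "od v i" "od v (i+2)" "od v (i+1)"] oct_triality[of "od v (i+1)" "od v i" "od v (i+2)"]
    by (simp add: oct_inv_linear oct_inv_mult oct_dot_linear algebra_simps)
qed

text \<open>
  A diagonal entry of the adjoint identity \<open>(v\<^sup>#)\<^sup># = N(v) v\<close>.
\<close>
lemma sharp_sharp_dg:
  "dg (sharp v) (i+1) * dg (sharp v) (i+2) - od (sharp v) i \<bullet>\<^sub>o od (sharp v) i = cubic_norm v * dg v i"
proof -
  have "coct_inv (a \<odot> b) \<bullet>\<^sub>o coct_inv (a \<odot> b) = (a \<bullet>\<^sub>o a) * (b \<bullet>\<^sub>o b)" for a b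
    by (simp add: oct_dot_inv oct_norm_mult_left)
  then show ?thesis unfolding cubic_norm_row[of v i]
    using oct_triality[of "od v i" "od v (i+2)" "od v (i+1)"] oct_triality[of "od v (i+1)" "od v i" "od v (i+2)"]
      oct_dot_commute[of "coct_inv (od v (i+1) \<odot> od v (i+2))" "od v i"]
    by (simp add: oct_inv_mult oct_dot_linear algebra_simps)
qed

text \<open>
  Two off-diagonal entries of the relation between a matrix and its adjugate; after expansion they
  amount to alternativity.
\<close>
lemma sharp_adjoint_od:
  "coct_inv (od v (i+2) \<odot> od (sharp v) i) + dg (sharp v) (i+2) *\<^sub>C od v (i+1) = - dg v i *\<^sub>C od (sharp v) (i+1)"
  "coct_inv (od (sharp v) i \<odot> od v (i+1)) + dg (sharp v) (i+1) *\<^sub>C od v (i+2) = - dg v i *\<^sub>C od (sharp v) (i+2)"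
  using oct_alt_right[of "od v (i+1)" "od v (i+2)"] oct_alt_left[of "od v (i+1)" "od v (i+2)"]
  by (simp_all add: oct_inv_linear oct_mult_linear oct_inv_mult scaleC_diff_left scaleC_diff_right scaleC_scaleC algebra_simps)

text \<open>
  The quadratic operator of the Jordan algebra in terms of the cubic structure. It reduces the Jordan
  triple product to the trace form and the Freudenthal product, which are far easier to keep invariant
  than iterated nonassociative products. Each side contains products of three off-diagonal entries that
  differ by linearized alternativity; the facts \<open>e\<close> in the proof fix one order of the factors.
\<close>
lemma alb_U_formula:
  "2 *\<^sub>C alb_jordan x (alb_jordan x w) - alb_jordan (alb_jordan x x) w
     = tr_form x w *\<^sub>C x - cross (sharp x) w"
proof (rule alb_eqI)
  fix i :: 3
  define a1 a2 a3 b1 b2 b3 where d: "a1 = od x i" "a2 = od x (i+1)" "a3 = od x (i+2)"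
    "b1 = od w i" "b2 = od w (i+1)" "b3 = od w (i+2)"
  note f = sum_cyc3[of _ i] d[symmetric] oct_inv_linear oct_inv_mult oct_mult_linear oct_dot_linear
  show "dg (2 *\<^sub>C alb_jordan x (alb_jordan x w) - alb_jordan (alb_jordan x x) w) i
     = dg (tr_form x w *\<^sub>C x - cross (sharp x) w) i"
    using oct_triality[of a1 a3 b2] oct_triality[of a1 b3 a2] oct_triality[of b1 a3 a2]
       oct_triality[of a2 a1 b3] oct_triality[of a2 b1 a3] oct_triality[of b2 a1 a3]
       oct_triality[of a3 a2 b1] oct_triality[of a3 b2 a1] oct_triality[of b3 a2 a1]
       oct_dot_commute[of a1 b1] oct_dot_commute[of a2 b2] oct_dot_commute[of a3 b3]
       oct_dot_commute[of "coct_inv a3 \<odot> coct_inv a2" b1] oct_dot_commute[of "coct_inv a1 \<odot> coct_inv a3" b2]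
       oct_dot_commute[of "coct_inv a2 \<odot> coct_inv a1" b3]
    by (simp add: tr_form_def f) (simp add: field_simps)
  show "od (2 *\<^sub>C alb_jordan x (alb_jordan x w) - alb_jordan (alb_jordan x x) w) i
     = od (tr_form x w *\<^sub>C x - cross (sharp x) w) i"
  proof (rule oct_eqI)
    fix t
    have l: "((a \<odot> b) \<odot> coct_inv b) \<bullet>\<^sub>o t = (b \<bullet>\<^sub>o b) * (a \<bullet>\<^sub>o t)"
         "(coct_inv b \<odot> (b \<odot> a)) \<bullet>\<^sub>o t = (b \<bullet>\<^sub>o b) * (a \<bullet>\<^sub>o t)" for a b
      by (simp_all add: oct_alt_right oct_alt_left oct_dot_linear)
    have e: "((a1 \<odot> a2) \<odot> coct_inv b2) \<bullet>\<^sub>o t = 2 * (a2 \<bullet>\<^sub>o b2) * (a1 \<bullet>\<^sub>o t) - ((a1 \<odot> b2) \<odot> coct_inv a2) \<bullet>\<^sub>o t"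
      "(coct_inv b3 \<odot> (a3 \<odot> a1)) \<bullet>\<^sub>o t = 2 * (a3 \<bullet>\<^sub>o b3) * (a1 \<bullet>\<^sub>o t) - (coct_inv a3 \<odot> (b3 \<odot> a1)) \<bullet>\<^sub>o t"
      using arg_cong[OF oct_alt_right2[of a1 a2 b2], of "\<lambda>s. s \<bullet>\<^sub>o t"]
        arg_cong[OF oct_alt_right2[of "coct_inv a1" "coct_inv a3" "coct_inv b3"], of "\<lambda>s. coct_inv s \<bullet>\<^sub>o t"]
      by (simp_all add: oct_dot_linear oct_inv_linear oct_inv_mult oct_dot_inv algebra_simps)
    show "od (2 *\<^sub>C alb_jordan x (alb_jordan x w) - alb_jordan (alb_jordan x x) w) i \<bullet>\<^sub>o t
     = od (tr_form x w *\<^sub>C x - cross (sharp x) w) i \<bullet>\<^sub>o t"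
      using oct_dot_commute[of a1 b1] oct_dot_commute[of a2 b2] oct_dot_commute[of a3 b3]
      by (simp add: tr_form_def f l e) (simp add: field_simps)
  qed
qed

lemma alb_eqI_dot:
  "(\<And>i. dg u i = dg v i) \<Longrightarrow> (\<And>i t. od u i \<bullet>\<^sub>o t = od v i \<bullet>\<^sub>o t) \<Longrightarrow> u = v"
  by (blast intro: alb_eqI oct_eqI)

lemmas oct_linear = oct_dot_linear oct_mult_linear oct_inv_linear oct_cnj_linear

lemma alb_jordan_commute: "alb_jordan u v = alb_jordan v u"
  by (rule alb_eqI) (simp_all add: oct_dot_commute add_ac mult_ac)

lemma alb_jordan_add_right: "alb_jordan u (v + w) = alb_jordan u v + alb_jordan u w"
  by (rule alb_eqI_dot) (simp_all add: oct_linear field_simps)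

lemma alb_jordan_add_left: "alb_jordan (u + v) w = alb_jordan u w + alb_jordan v w"
  by (metis alb_jordan_add_right alb_jordan_commute)

lemma alb_cnj_add: "alb_cnj (u + v) = alb_cnj u + alb_cnj v"
  by (rule alb_eqI) (simp_all add: oct_linear)

lemma alb_cnj_scaleC: "alb_cnj (c *\<^sub>C v) = cnj c *\<^sub>C alb_cnj v"
  by (rule alb_eqI) (simp_all add: oct_linear)

lemma alb_cnj_cnj [simp]: "alb_cnj (alb_cnj v) = v"
  by (rule alb_eqI) simp_all

lemma cross_add_right: "cross u (v + w) = cross u v + cross u w"
  by (rule alb_eqI_dot) (simp_all add: oct_linear scaleC_add_left algebra_simps)

lemma cross_commute: "cross u v = cross v u"
  by (rule alb_eqI) (simp_all add: oct_dot_commute add_ac mult_ac algebra_simps)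

lemma cross_add_left: "cross (u + v) w = cross u w + cross v w"
  by (metis cross_add_right cross_commute)

lemma cross_scaleC_right: "cross u (c *\<^sub>C v) = c *\<^sub>C cross u v"
  by (rule alb_eqI_dot) (simp_all add: oct_linear algebra_simps)

lemma cross_self: "cross v v = 2 *\<^sub>C sharp v"
  by (rule alb_eqI_dot) (simp_all add: oct_linear algebra_simps)

lemma sharp_add: "sharp (u + v) = sharp u + cross u v + sharp v"
  by (rule alb_eqI_dot) (simp_all add: oct_linear oct_dot_commute algebra_simps)

lemma tr_form_commute: "tr_form u v = tr_form v u"
  by (simp add: tr_form_def mult.commute oct_dot_commute)

lemma tr_form_add_right: "tr_form u (v + w) = tr_form u v + tr_form u w"
  by (simp add: tr_form_def oct_linear sum.distrib algebra_simps)

lemma tr_form_add_left: "tr_form (u + v) w = tr_form u w + tr_form v w"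
  by (metis tr_form_add_right tr_form_commute)

lemma tr_form_scaleC_left: "tr_form (c *\<^sub>C u) v = c * tr_form u v"
  by (simp add: tr_form_def oct_linear sum_distrib_left algebra_simps)

lemma herm_add_left: "herm (u + v) w = herm u w + herm v w"
  by (simp add: herm_def tr_form_add_left)

lemma herm_add_right: "herm w (u + v) = herm w u + herm w v"
  by (simp add: herm_def alb_cnj_add tr_form_add_right)

lemma herm_scaleC_left: "herm (c *\<^sub>C u) v = c * herm u v"
  by (simp add: herm_def tr_form_scaleC_left)

lemma herm_commute: "herm u v = cnj (herm v u)"
  by (simp add: herm_def tr_form_def cnj_sum flip: oct_cnj_dot)
     (simp add: mult.commute oct_dot_commute)

lemma herm_scaleC_right: "herm u (c *\<^sub>C v) = cnj c * herm u v"
  by (subst (1 2) herm_commute) (simp add: herm_scaleC_left)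

lemma herm_self: "herm v v = of_real (hsq v)"
  by (simp add: herm_def tr_form_def hsq_def oct_dot_cnj_self complex_norm_square[symmetric])

definition dcross :: "alb \<Rightarrow> alb \<Rightarrow> alb" where "dcross u v = alb_cnj (cross u v)"
text \<open>
  The conjugate adjoint; \<open>dcross\<close> is its polarization.
\<close>
definition dag :: "alb \<Rightarrow> alb" where "dag v = alb_cnj (sharp v)"

text \<open>
  The triple product of the matrices, as \<open>triple_alb_mat\<close> shows.
\<close>
definition alb_triple :: "alb \<Rightarrow> alb \<Rightarrow> alb \<Rightarrow> alb" where
  "alb_triple x y z = (1/2) *\<^sub>C (herm x y *\<^sub>C z + herm z y *\<^sub>C x - dcross (dcross x z) y)"

lemma dcross_add_right: "dcross u (v + w) = dcross u v + dcross u w"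
  by (simp add: dcross_def cross_add_right alb_cnj_add)

lemma dcross_commute: "dcross u v = dcross v u"
  by (simp add: dcross_def cross_commute)

lemma dcross_add_left: "dcross (u + v) w = dcross u w + dcross v w"
  by (metis dcross_add_right dcross_commute)

lemma dag_add: "dag (u + v) = dag u + dcross u v + dag v"
  by (simp add: dag_def dcross_def sharp_add alb_cnj_add)

section \<open>Hermitian matrices in coordinates\<close>

definition alb_mat :: "alb \<Rightarrow> coct_mat" where
  "alb_mat v = (\<chi> i j. if j = i then oct_of (dg v i) else if j = i + 1 then od v (i + 2)
     else coct_inv (od v (i + 1)))"

definition alb_of :: "coct_mat \<Rightarrow> alb" where
  "alb_of A = alb_mk (\<lambda>i. oct_sc (A $ i $ i)) (\<lambda>i. A $ (i + 1) $ (i + 2))"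

lemma alb_mat_nth [simp]: "alb_mat v $ i $ i = oct_of (dg v i)"
  "alb_mat v $ i $ (i + 1) = od v (i + 2)" "alb_mat v $ i $ (i + 2) = coct_inv (od v (i + 1))"
  "alb_mat v $ (i + 1) $ i = coct_inv (od v (i + 2))" "alb_mat v $ (i + 2) $ i = od v (i + 1)"
  "alb_mat v $ (i + 1) $ (i + 2) = od v i" "alb_mat v $ (i + 2) $ (i + 1) = coct_inv (od v i)"
  using exhaust_3[of i] by (auto simp: alb_mat_def)

lemma coct_mat_eqI:
  assumes "\<And>i. A $ i $ i = B $ i $ i" "\<And>i. A $ i $ (i + 1) = B $ i $ (i + 1)"
    "\<And>i. A $ i $ (i + 2) = B $ i $ (i + 2)"
  shows "A = (B :: coct_mat)"
proof -
  have "\<forall>j. A $ i $ j = B $ i $ j" for i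
    unfolding all_cyc3[of _ i] using assms by blast
  then show ?thesis by (simp add: vec_eq_iff)
qed

lemma alb_of_mat [simp]: "alb_of (alb_mat v) = v"
  by (rule alb_eqI) (simp_all add: alb_of_def)

lemma alb_mat_H3O [simp]: "alb_mat v \<in> H3O"
proof -
  have "\<forall>j. alb_mat v $ i $ j = coct_inv (alb_mat v $ j $ i)" for i
    unfolding all_cyc3[of _ i] by simp
  then show ?thesis unfolding H3O_def by blast
qed

lemma oct_of_sc: "a = coct_inv a \<Longrightarrow> oct_of (oct_sc a) = a"
  by (cases a rule: coct_exhaust) (auto simp: oct_coords equal_neg_zero)

lemma alb_mat_of: assumes "A \<in> H3O" shows "alb_mat (alb_of A) = A"
proof (rule coct_mat_eqI)
  have h: "A $ i $ j = coct_inv (A $ j $ i)" for i j using assms unfolding H3O_def by blast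
  fix i
  show "alb_mat (alb_of A) $ i $ i = A $ i $ i" using oct_of_sc[OF h] by (simp add: alb_of_def)
  show "alb_mat (alb_of A) $ i $ (i + 1) = A $ i $ (i + 1)" by (simp add: alb_of_def)
  show "alb_mat (alb_of A) $ i $ (i + 2) = A $ i $ (i + 2)" using h[of i "i + 2"]
    by (simp add: alb_of_def)
qed

lemma H3O_eq: "H3O = range alb_mat"
  using alb_mat_of by (metis (no_types, lifting) alb_mat_H3O image_subsetI rangeI subsetI subset_antisym)

lemma alb_mat_add: "alb_mat (u + v) = alb_mat u + alb_mat v"
  by (rule coct_mat_eqI) (simp_all add: oct_of_linear oct_inv_linear)

lemma alb_mat_scaleC: "alb_mat (c *\<^sub>C v) = c *\<^sub>C alb_mat v"
  by (rule coct_mat_eqI) (simp_all add: oct_of_linear oct_inv_linear scaleC_vec_def)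

lemma alb_of_add: "alb_of (A + B) = alb_of A + alb_of B"
  by (rule alb_eqI) (simp_all add: alb_of_def oct_sc_linear)

lemma alb_of_scaleC: "alb_of (c *\<^sub>C A) = c *\<^sub>C alb_of A"
  by (rule alb_eqI) (simp_all add: alb_of_def oct_sc_linear scaleC_vec_def)

lemma alb_mat_scaleR: "alb_mat (r *\<^sub>R v) = r *\<^sub>R alb_mat v"
  by (metis alb_mat_scaleC scaleC_of_real)

lemma alb_mat_minus: "alb_mat (- v) = - alb_mat v"
  using alb_mat_scaleR[of "-1" v] by simp

lemma alb_mat_diff: "alb_mat (u - v) = alb_mat u - alb_mat v"
  using alb_mat_add[of u "-v"] by (simp add: alb_mat_minus)

lemma alb_mat_zero [simp]: "alb_mat 0 = 0"
  using alb_mat_scaleR[of 0 0] by simp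

lemma alb_mat_inject [simp]: "alb_mat u = alb_mat v \<longleftrightarrow> u = v"
  by (metis alb_of_mat)

lemma oct_mult_inv_self2: "a \<odot> coct_inv b + b \<odot> coct_inv a = oct_of (2 * (a \<bullet>\<^sub>o b))"
  "coct_inv a \<odot> b + coct_inv b \<odot> a = oct_of (2 * (a \<bullet>\<^sub>o b))"
  by (cases a rule: coct_exhaust; cases b rule: coct_exhaust; simp add: oct_coords algebra_simps)+

lemma jordan_alb_mat: "jordan (alb_mat u) (alb_mat v) = alb_mat (alb_jordan u v)"
proof (rule coct_mat_eqI)
  fix i :: 3
  have nth: "jordan A B $ i $ j = (1/2) *\<^sub>C ((\<Sum>k\<in>UNIV. A $ i $ k \<odot> B $ k $ j) + (\<Sum>k\<in>UNIV. B $ i $ k \<odot> A $ k $ j))"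
    for A B i j
    using scaleC_of_real[of "1/2" "(\<Sum>k\<in>UNIV. A $ i $ k \<odot> B $ k $ j) + (\<Sum>k\<in>UNIV. B $ i $ k \<odot> A $ k $ j)"]
    by (simp add: jordan_def mat_mult_def)
  have half: "oct_of c + oct_of d = oct_of (c + d)" "(1/2) *\<^sub>C oct_of c = oct_of (c / 2)" for c d
    by (simp_all add: oct_of_linear)
  have "jordan (alb_mat u) (alb_mat v) $ i $ i =
     (1/2) *\<^sub>C (oct_of (2 * (dg u i * dg v i)) + (od u (i+2) \<odot> coct_inv (od v (i+2)) + od v (i+2) \<odot> coct_inv (od u (i+2)))
       + (coct_inv (od u (i+1)) \<odot> od v (i+1) + coct_inv (od v (i+1)) \<odot> od u (i+1)))"
    unfolding nth sum_cyc3[of _ i] by (rule oct_eqI, simp add: oct_linear)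
  also have "\<dots> = alb_mat (alb_jordan u v) $ i $ i"
    unfolding oct_mult_inv_self2 half by (simp add: add_divide_distrib algebra_simps)
  finally show "jordan (alb_mat u) (alb_mat v) $ i $ i = alb_mat (alb_jordan u v) $ i $ i" .
  show "jordan (alb_mat u) (alb_mat v) $ i $ (i + 1) = alb_mat (alb_jordan u v) $ i $ (i + 1)"
    unfolding nth sum_cyc3[of _ i] by (rule oct_eqI, simp add: oct_linear oct_inv_mult, simp add: field_simps)
  show "jordan (alb_mat u) (alb_mat v) $ i $ (i + 2) = alb_mat (alb_jordan u v) $ i $ (i + 2)"
    unfolding nth sum_cyc3[of _ i] by (rule oct_eqI, simp add: oct_linear oct_inv_mult, simp add: field_simps)
qed

lemma mat_cnj_alb_mat: "mat_cnj (alb_mat v) = alb_mat (alb_cnj v)"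
  by (rule coct_mat_eqI) (simp_all add: mat_cnj_def oct_cnj_inv)

text \<open>
  For \<open>z = x\<close> this is the formula for the quadratic operator with \<open>w\<close> the conjugate of \<open>y\<close>. Both sides are
  symmetric and additive in the outer arguments, so polarization gives the general case.
\<close>
lemma triple_alb_mat: "triple (alb_mat x) (alb_mat y) (alb_mat z) = alb_mat (alb_triple x y z)"
proof -
  define w where "w = alb_cnj y"
  define T where "T x z = alb_jordan (alb_jordan x w) z + alb_jordan x (alb_jordan w z)
       - alb_jordan w (alb_jordan x z)" for x z
  have diag: "T x x = alb_triple x y x" for x
  proof -
    have "T x x = 2 *\<^sub>C alb_jordan x (alb_jordan x w) - alb_jordan (alb_jordan x x) w"
      by (simp add: T_def alb_jordan_commute[of w] alb_jordan_commute[of "alb_jordan x w"]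
          alb_jordan_commute[of w "alb_jordan x x"] scaleC_add_left[of 1 1, simplified])
    also have "\<dots> = herm x y *\<^sub>C x - dcross (dag x) y"
      unfolding alb_U_formula
      by (rule alb_eqI) (simp_all add: herm_def w_def dcross_def dag_def oct_linear oct_cnj_dot[symmetric] oct_cnj_mult oct_cnj_inv)
    also have "dcross x x = 2 *\<^sub>C dag x"
      by (simp add: dcross_def dag_def cross_self alb_cnj_scaleC)
    then have "dcross (dcross x x) y = 2 *\<^sub>C dcross (dag x) y"
      by (simp add: dcross_def cross_commute[of _ y] cross_scaleC_right alb_cnj_scaleC)
    then have "herm x y *\<^sub>C x - dcross (dag x) y = alb_triple x y x"
      by (simp add: alb_triple_def scaleC_diff_right scaleC_add_right flip: scaleC_add_left)
    finally show ?thesis .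
  qed
  have pT: "T (x + z) (x + z) = T x x + T z z + 2 *\<^sub>C T x z"
  proof -
    have "T z x = T x z"
      by (simp add: T_def alb_jordan_commute[of w] alb_jordan_commute[of "alb_jordan x w" z]
          alb_jordan_commute[of x "alb_jordan z w"] alb_jordan_commute[of z x] add_ac)
    moreover have "T (x + z) (x + z) = T x x + T x z + T z x + T z z"
      by (simp add: T_def alb_jordan_add_left alb_jordan_add_right algebra_simps)
    ultimately show ?thesis by (simp add: scaleC_add_left[of 1 1, simplified])
  qed
  have pA: "alb_triple (x + z) y (x + z) = alb_triple x y x + alb_triple z y z + 2 *\<^sub>C alb_triple x y z"
  proof -
    have "dcross (dcross z x) y = dcross (dcross x z) y" by (simp add: dcross_commute[of z x])
    then show ?thesis
      by (simp add: alb_triple_def dcross_add_left dcross_add_right herm_add_left scaleC_scaleC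
           scaleC_add_left scaleC_add_right scaleC_diff_right cvec.scale_left_distrib)
         (simp add: algebra_simps flip: scaleC_add_left)
  qed
  have "2 *\<^sub>C T x z = 2 *\<^sub>C alb_triple x y z"
    using pT pA diag by (metis add_left_cancel)
  then have "T x z = alb_triple x y z" by (metis cvec.scale_cancel_left zero_neq_numeral)
  then show ?thesis
    by (simp add: triple_def mat_cnj_alb_mat jordan_alb_mat T_def w_def alb_mat_add[symmetric] alb_mat_diff[symmetric])
qed

section \<open>Unitary maps commuting with the conjugate adjoint\<close>

text \<open>
  The compact group of type \<open>E\<^sub>6\<close>. Each condition is closed under pointwise limits, and the last two
  suffice for invariance of the triple product.
\<close>
definition alb_group :: "(alb \<Rightarrow> alb) set" where
  "alb_group = {k. (\<forall>u v. k (u + v) = k u + k v) \<and> (\<forall>c v. k (c *\<^sub>C v) = c *\<^sub>C k v) \<and>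
     (\<forall>v. hsq (k v) = hsq v) \<and> (\<forall>v. dag (k v) = k (dag v))}"

lemma alb_groupD:
  assumes "k \<in> alb_group"
  shows "k (u + v) = k u + k v" "k (c *\<^sub>C v) = c *\<^sub>C k v" "hsq (k v) = hsq v" "dag (k v) = k (dag v)"
  using assms unfolding alb_group_def by blast+

lemma norm_le_hsq: "(norm v)\<^sup>2 \<le> hsq v" and hsq_le_norm: "hsq v \<le> 2 * (norm v)\<^sup>2"
proof -
  have "(norm v)\<^sup>2 = (\<Sum>i\<in>UNIV. (cmod (dg v i))\<^sup>2) + (\<Sum>i\<in>UNIV. (norm (od v i))\<^sup>2)"
    by (simp add: norm_prod_def norm_vec_def L2_set_def sum_nonneg dg_def od_def)
  moreover have "0 \<le> (\<Sum>i\<in>UNIV. (cmod (dg v i))\<^sup>2)" "0 \<le> (\<Sum>i\<in>UNIV. (norm (od v i))\<^sup>2)"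
    by (simp_all add: sum_nonneg)
  ultimately show "(norm v)\<^sup>2 \<le> hsq v" "hsq v \<le> 2 * (norm v)\<^sup>2"
    unfolding hsq_def by linarith+
qed

lemma hsq_nonneg [simp]: "0 \<le> hsq v"
  using norm_le_hsq[of v] zero_le_power2[of "norm v"] by linarith

lemma hsq_eq_0 [simp]: "hsq v = 0 \<longleftrightarrow> v = 0"
proof
  assume "hsq v = 0"
  then have "(norm v)\<^sup>2 \<le> 0" using norm_le_hsq[of v] by simp
  then show "v = 0" by simp
next
  assume "v = 0"
  then show "hsq v = 0" using hsq_le_norm[of v] hsq_nonneg[of v] by (simp del: hsq_nonneg)
qed

lemma hsq_scaleC: "hsq (c *\<^sub>C v) = (cmod c)\<^sup>2 * hsq v"
  by (simp add: hsq_def norm_mult norm_scaleC power_mult_distrib sum_distrib_left algebra_simps)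

lemma hsq_add: "hsq (u + v) = hsq u + hsq v + 2 * Re (herm u v)"
proof -
  have "of_real (hsq (u + v)) = of_real (hsq u) + of_real (hsq v) + (herm u v + cnj (herm u v))"
    by (simp flip: herm_self herm_commute[of v u] add: herm_add_left herm_add_right)
  also have "\<dots> = complex_of_real (hsq u + hsq v + 2 * Re (herm u v))"
    by (simp add: complex_add_cnj)
  finally show ?thesis by (simp only: of_real_eq_iff)
qed

lemma alb_group_herm:
  assumes "k \<in> alb_group" shows "herm (k u) (k v) = herm u v"
proof -
  have R: "Re (herm (k u) (k v)) = Re (herm u v)" for u v
    using hsq_add[of "k u" "k v"] hsq_add[of u v] alb_groupD(1,3)[OF assms] by (metis add_left_cancel mult_cancel_left zero_neq_numeral)
  have "Re (herm (k u) (\<i> *\<^sub>C k v)) = Re (herm u (\<i> *\<^sub>C v))"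
    using R[of u "\<i> *\<^sub>C v"] by (simp add: alb_groupD(2)[OF assms])
  then show ?thesis using R[of u v] by (simp add: herm_scaleC_right complex_eq_iff)
qed

lemma alb_group_dcross:
  assumes "k \<in> alb_group" shows "dcross (k u) (k v) = k (dcross u v)"
proof -
  have "k (dag u) + dcross (k u) (k v) + k (dag v) = k (dag u) + k (dcross u v) + k (dag v)"
    using dag_add[of "k u" "k v"] dag_add[of u v] alb_groupD[OF assms] by metis
  then show ?thesis by simp
qed

lemma alb_group_diff: assumes "k \<in> alb_group" shows "k (u - v) = k u - k v"
  using alb_groupD(1)[OF assms, of "u - v" v] by (simp add: eq_diff_eq)

lemma alb_group_triple:
  assumes "k \<in> alb_group" shows "alb_triple (k x) (k y) (k z) = k (alb_triple x y z)"
  by (simp add: alb_triple_def alb_group_herm[OF assms] alb_group_dcross[OF assms]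
      alb_groupD[OF assms] alb_group_diff[OF assms])

lemma tr_form_sharp: "tr_form v (sharp v) = 3 * cubic_norm v"
proof -
  have "3 * cubic_norm v = (\<Sum>i\<in>(UNIV::3 set). cubic_norm v)" by simp
  also have "\<dots> = (\<Sum>i\<in>UNIV. dg v i * dg (sharp v) i + od v (i+1) \<bullet>\<^sub>o od (sharp v) (i+1)
     + od v (i+2) \<bullet>\<^sub>o od (sharp v) (i+2))"
    by (rule sum.cong[OF refl cubic_norm_row])
  also have "\<dots> = tr_form v (sharp v)"
    unfolding tr_form_def by (simp add: sum_3 del: sharp_coords)
  finally show ?thesis by simp
qed

text \<open>
  The cubic norm is a third of the Hermitian pairing of \<open>v\<close> with \<open>dag v\<close>.
\<close>
lemma alb_group_cubic_norm:
  assumes "k \<in> alb_group" shows "cubic_norm (k v) = cubic_norm v"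
proof -
  have h: "herm v (dag v) = 3 * cubic_norm v" for v
    by (simp add: herm_def dag_def tr_form_sharp)
  show ?thesis using h[of "k v"] h[of v] alb_group_herm[OF assms, of v "dag v"] alb_groupD(4)[OF assms]
    by (metis mult_cancel_left zero_neq_numeral)
qed

lemma hsq_alb_cnj: "hsq (alb_cnj v) = hsq v"
proof -
  have "norm (coct_cnj a) = norm a" for a
    by (cases a rule: coct_exhaust) (simp add: oct_coords norm_prod_def)
  then show ?thesis by (simp add: hsq_def)
qed

lemma alb_group_hsq_sharp:
  assumes "k \<in> alb_group" shows "hsq (sharp (k v)) = hsq (sharp v)"
  using hsq_alb_cnj[of "sharp (k v)"] hsq_alb_cnj[of "sharp v"] alb_groupD(3,4)[OF assms]
  by (simp flip: dag_def)

lemma alb_group_comp: "k \<in> alb_group \<Longrightarrow> l \<in> alb_group \<Longrightarrow> (\<lambda>v. k (l v)) \<in> alb_group"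
  unfolding alb_group_def mem_Collect_eq by metis

lemma alb_group_id: "(\<lambda>v. v) \<in> alb_group"
  by (simp add: alb_group_def)

lemma alb_group_bounded_linear: assumes "k \<in> alb_group" shows "bounded_linear k"
    and alb_group_norm: "norm (k v) \<le> sqrt 2 * norm v"
proof -
  have n: "norm (k v) \<le> sqrt 2 * norm v" for v
  proof -
    have "(norm (k v))\<^sup>2 \<le> 2 * (norm v)\<^sup>2"
      using norm_le_hsq[of "k v"] hsq_le_norm[of v] alb_groupD(3)[OF assms, of v] by linarith
    then have "(norm (k v))\<^sup>2 \<le> (sqrt 2 * norm v)\<^sup>2" by (simp add: power_mult_distrib)
    then show ?thesis by (rule power2_le_imp_le) simp
  qed
  show "bounded_linear k"
  proof (rule bounded_linear_intro)
    fix u v and r :: real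
    show "k (u + v) = k u + k v" by (rule alb_groupD[OF assms])
    show "k (r *\<^sub>R v) = r *\<^sub>R k v" using alb_groupD(2)[OF assms, of "of_real r"] by (simp add: scaleC_of_real)
    show "norm (k v) \<le> norm v * sqrt 2" using n[of v] by (simp add: mult.commute)
  qed
  show "norm (k v) \<le> sqrt 2 * norm v" by (rule n)
qed

lemma alb_group_bij: assumes "k \<in> alb_group" shows "bij k"
proof -
  have "linear k" using alb_group_bounded_linear(1)[OF assms] by (rule bounded_linear.linear)
  moreover have "inj k"
  proof (rule injI)
    fix u v assume "k u = k v"
    then have "hsq (k (u - v)) = 0" by (simp add: alb_group_diff[OF assms])
    then show "u = v" by (simp add: alb_groupD(3)[OF assms])
  qed
  ultimately show ?thesis using linear_injective_imp_surjective by (auto simp: bij_def)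
qed

lemma alb_group_inv: assumes "k \<in> alb_group" shows "inv k \<in> alb_group"
proof -
  note b = alb_group_bij[OF assms]
  have 1: "k (inv k v) = v" for v using b by (simp add: bij_is_surj surj_f_inv_f)
  have i: "k u = k v \<longleftrightarrow> u = v" for u v using b by (simp add: bij_is_inj inj_eq)
  show ?thesis unfolding alb_group_def
  proof (safe)
    fix u v c
    show "inv k (u + v) = inv k u + inv k v" by (subst i[symmetric]) (simp add: 1 alb_groupD(1)[OF assms])
    show "inv k (c *\<^sub>C v) = c *\<^sub>C inv k v" by (subst i[symmetric]) (simp add: 1 alb_groupD(2)[OF assms])
    show "hsq (inv k v) = hsq v" using alb_groupD(3)[OF assms, of "inv k v"] by (simp add: 1)
    show "dag (inv k v) = inv k (dag v)"
      by (subst i[symmetric]) (simp add: 1 alb_groupD(4)[OF assms, symmetric])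
  qed
qed

section \<open>Rotations, phases and triality twists\<close>

text \<open>
  For a map that commutes with the complex conjugation, the Hermitian conditions reduce to bilinear
  ones.
\<close>
lemma alb_groupI_real:
  assumes "\<And>u v. k (u + v) = k u + k v" "\<And>c v. k (c *\<^sub>C v) = c *\<^sub>C k v"
    and "\<And>v. k (alb_cnj v) = alb_cnj (k v)"
    and "\<And>v w. tr_form (k v) (k w) = tr_form v w" "\<And>v. sharp (k v) = k (sharp v)"
  shows "k \<in> alb_group"
proof -
  have "complex_of_real (hsq (k v)) = of_real (hsq v)" for v
    by (simp add: herm_self[symmetric] herm_def assms(3)[symmetric] assms(4))
  then have "hsq (k v) = hsq v" for v by (simp only: of_real_eq_iff)
  then show ?thesis using assms unfolding alb_group_def dag_def by (simp del: split_paired_All)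
qed

definition alb_cyc :: "alb \<Rightarrow> alb" where
  "alb_cyc v = alb_mk (\<lambda>i. dg v (i + 1)) (\<lambda>i. od v (i + 1))"

lemma alb_cyc_coords [simp]: "dg (alb_cyc v) i = dg v (i + 1)" "od (alb_cyc v) i = od v (i + 1)"
  by (simp_all add: alb_cyc_def)

lemma alb_cyc_group: "alb_cyc \<in> alb_group"
  by (rule alb_groupI_real; (rule alb_eqI)?) (simp_all add: tr_form_def sum_3 add_ac)

text \<open>
  Conjugation of the matrix by the plane rotation with rows \<open>(c, s)\<close> and \<open>(- s, c)\<close> in the first two
  coordinates. Its entries are central, so no associativity is involved.
\<close>
definition alb_rot :: "real \<Rightarrow> real \<Rightarrow> alb \<Rightarrow> alb" where
  "alb_rot c s v = (let C = complex_of_real c; S = complex_of_real s; t = 2 * C * S * oct_sc (od v 3) in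
     alb_mk
      (\<lambda>i. if i = 1 then C\<^sup>2 * dg v 1 + t + S\<^sup>2 * dg v 2
        else if i = 2 then S\<^sup>2 * dg v 1 - t + C\<^sup>2 * dg v 2 else dg v 3)
      (\<lambda>i. if i = 1 then C *\<^sub>C od v 1 - S *\<^sub>C coct_inv (od v 2)
        else if i = 2 then C *\<^sub>C od v 2 + S *\<^sub>C coct_inv (od v 1)
        else C\<^sup>2 *\<^sub>C od v 3 - S\<^sup>2 *\<^sub>C coct_inv (od v 3) + oct_of (C * S * (dg v 2 - dg v 1))))"

lemma alb_rot_coords:
  "dg (alb_rot c s v) 1 = (of_real c)\<^sup>2 * dg v 1 + 2 * of_real c * of_real s * oct_sc (od v 3) + (of_real s)\<^sup>2 * dg v 2"
  "dg (alb_rot c s v) 2 = (of_real s)\<^sup>2 * dg v 1 - 2 * of_real c * of_real s * oct_sc (od v 3) + (of_real c)\<^sup>2 * dg v 2"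
  "dg (alb_rot c s v) 3 = dg v 3"
  "od (alb_rot c s v) 1 = of_real c *\<^sub>C od v 1 - of_real s *\<^sub>C coct_inv (od v 2)"
  "od (alb_rot c s v) 2 = of_real c *\<^sub>C od v 2 + of_real s *\<^sub>C coct_inv (od v 1)"
  "od (alb_rot c s v) 3 = (of_real c)\<^sup>2 *\<^sub>C od v 3 - (of_real s)\<^sup>2 *\<^sub>C coct_inv (od v 3)
      + oct_of (of_real c * of_real s * (dg v 2 - dg v 1))"
  by (simp_all add: alb_rot_def Let_def)

lemma alb_eqI3:
  assumes "dg u 1 = dg v 1" "dg u 2 = dg v 2" "dg u 3 = dg v 3"
    "od u 1 = od v 1" "od u 2 = od v 2" "od u 3 = od v 3"
  shows "u = v"
  using assms by (intro alb_eqI) (metis exhaust_3)+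

lemma oct_dot_inv2: "coct_inv a \<bullet>\<^sub>o b = 2 * oct_sc a * oct_sc b - a \<bullet>\<^sub>o b"
  by (simp add: oct_inv_eq oct_dot_linear)

lemma oct_dot_inv3: "a \<bullet>\<^sub>o coct_inv b = 2 * oct_sc a * oct_sc b - a \<bullet>\<^sub>o b"
  by (simp add: oct_inv_eq oct_dot_linear)

lemma oct_mult_inv_self: "a \<odot> coct_inv a = oct_of (a \<bullet>\<^sub>o a)" "coct_inv a \<odot> a = oct_of (a \<bullet>\<^sub>o a)"
  using oct_alt_right[of "oct_of 1" a] oct_alt_left[of a "oct_of 1"] by (simp_all add: oct_of_linear)

lemma oct_dot_inv_inv [simp]: "coct_inv a \<bullet>\<^sub>o coct_inv b = a \<bullet>\<^sub>o b"
  by (simp add: oct_dot_inv)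

lemma alb_rot_group: assumes "c\<^sup>2 + s\<^sup>2 = 1" shows "alb_rot c s \<in> alb_group"
proof (rule alb_groupI_real)
  define C S where "C = complex_of_real c" "S = complex_of_real s"
  have cs: "C\<^sup>2 + S\<^sup>2 = 1" using assms by (simp add: C_S_def flip: of_real_power of_real_add)
  note r = alb_rot_coords[of c s, folded C_S_def]
  have cc: "cnj C = C" "cnj S = S" by (simp_all add: C_S_def)
  fix v w :: alb and k :: complex
  show "alb_rot c s (v + w) = alb_rot c s v + alb_rot c s w"
    by (rule alb_eqI3; (rule oct_eqI)?) (simp_all add: r oct_linear oct_sc_linear algebra_simps)
  show "alb_rot c s (k *\<^sub>C w) = k *\<^sub>C alb_rot c s w"
    by (rule alb_eqI3; (rule oct_eqI)?) (simp_all add: r oct_linear oct_sc_linear algebra_simps)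
  show "alb_rot c s (alb_cnj w) = alb_cnj (alb_rot c s w)"
    by (rule alb_eqI3) (simp_all add: r oct_linear oct_sc_linear cc oct_cnj_inv)
  show "tr_form (alb_rot c s v) (alb_rot c s w) = tr_form v w"
    using cs by (simp add: tr_form_def sum_3 r oct_linear oct_sc_linear oct_dot_inv2 oct_dot_inv3) algebra
  define a1 a2 a3 where a: "a1 = od v 1" "a2 = od v 2" "a3 = od v 3"
  have h: "coct_inv a3 = (2 * oct_sc a3) *\<^sub>C oct_of 1 - a3" by (rule oct_inv_eq)
  note f = r a[symmetric] oct_linear oct_sc_linear
  show "sharp (alb_rot c s v) = alb_rot c s (sharp v)"
  proof (rule alb_eqI3)
    show "dg (sharp (alb_rot c s v)) 1 = dg (alb_rot c s (sharp v)) 1"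
      using cs oct_dot_commute[of a2 a1] by (simp add: f oct_sc_mult oct_dot_inv2 oct_dot_inv3) (algebra | simp add: algebra_simps power2_eq_square)
    show "dg (sharp (alb_rot c s v)) 2 = dg (alb_rot c s (sharp v)) 2"
      using cs oct_dot_commute[of a2 a1] by (simp add: f oct_sc_mult oct_dot_inv2 oct_dot_inv3) (algebra | simp add: algebra_simps power2_eq_square)
    show "dg (sharp (alb_rot c s v)) 3 = dg (alb_rot c s (sharp v)) 3"
      using cs oct_dot_commute[of a2 a1] by (simp add: f oct_sc_mult oct_dot_inv2 oct_dot_inv3) (algebra | simp add: algebra_simps power2_eq_square)
    show "od (sharp (alb_rot c s v)) 1 = od (alb_rot c s (sharp v)) 1"
      by (rule oct_eqI) (use cs in \<open>simp add: f h oct_inv_mult oct_mult_inv_self\<close>, (algebra | simp add: algebra_simps power2_eq_square))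
    show "od (sharp (alb_rot c s v)) 2 = od (alb_rot c s (sharp v)) 2"
      by (rule oct_eqI) (use cs in \<open>simp add: f h oct_inv_mult oct_mult_inv_self\<close>, (algebra | simp add: algebra_simps power2_eq_square))
    show "od (sharp (alb_rot c s v)) 3 = od (alb_rot c s (sharp v)) 3"
      by (rule oct_eqI) (use cs in \<open>simp add: f h oct_inv_mult oct_mult_inv_self\<close>, (algebra | simp add: algebra_simps power2_eq_square))
  qed
qed

text \<open>
  The matrix \<open>v\<close> goes to \<open>d v d\<close> with \<open>d\<close> diagonal with entries \<open>\<zeta>\<close>, \<open>cnj \<zeta>\<close>, 1 and \<open>\<zeta>\<^sup>2 = \<i>\<close>. The
  determinant of \<open>d\<close> is 1, which is what makes the map commute with \<open>dag\<close>. It multiplies the first two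
  diagonal entries by \<open>\<i>\<close> and \<open>- \<i>\<close> and fixes the off-diagonal entry between them.
\<close>
definition alb_phase :: "alb \<Rightarrow> alb" where
  "alb_phase v = (let \<zeta> = cis (pi/4) in alb_mk
     (\<lambda>i. if i = 1 then \<i> * dg v 1 else if i = 2 then - \<i> * dg v 2 else dg v 3)
     (\<lambda>i. if i = 1 then cnj \<zeta> *\<^sub>C od v 1 else if i = 2 then \<zeta> *\<^sub>C od v 2 else od v 3))"

lemma alb_phase_coords:
  "dg (alb_phase v) 1 = \<i> * dg v 1" "dg (alb_phase v) 2 = - \<i> * dg v 2" "dg (alb_phase v) 3 = dg v 3"
  "od (alb_phase v) 1 = cnj (cis (pi/4)) *\<^sub>C od v 1" "od (alb_phase v) 2 = cis (pi/4) *\<^sub>C od v 2"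
  "od (alb_phase v) 3 = od v 3"
  by (simp_all add: alb_phase_def Let_def)

lemma alb_phase_group: "alb_phase \<in> alb_group"
proof -
  define z where "z = cis (pi/4)"
  have z: "z * z = \<i>" "cnj z * cnj z = - \<i>" "z * cnj z = 1" "cmod z = 1"
    unfolding z_def by (simp_all add: cis_mult cis_cnj)
  note p = alb_phase_coords[folded z_def]
  have "alb_phase (u + v) = alb_phase u + alb_phase v" for u v
    by (rule alb_eqI3) (simp_all add: p scaleC_add_right algebra_simps)
  moreover have "alb_phase (c *\<^sub>C v) = c *\<^sub>C alb_phase v" for c v
    by (rule alb_eqI3) (simp_all add: p algebra_simps)
  moreover have "hsq (alb_phase v) = hsq v" for v
    by (simp add: hsq_def sum_3 p norm_mult norm_scaleC z)
  moreover have "dag (alb_phase v) = alb_phase (dag v)" for v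
  proof (rule alb_eqI3)
    have zi: "\<i> * z = - cnj z" "\<i> * cnj z = z"
      using z(1-3) by (metis i_squared minus_mult_left mult.assoc mult.commute mult_1 mult_minus1 , metis z(1,3) mult.assoc mult.commute mult_1)
    have m: "z * (z * t) = \<i> * t" "cnj z * (cnj z * t) = - (\<i> * t)" "z * (cnj z * t) = t" "cnj z * (z * t) = t"
      "\<i> * (z * t) = - (cnj z * t)" "\<i> * (cnj z * t) = z * t" for t
      using z zi by (simp_all flip: mult.assoc) (simp add: mult.commute)
    have ii: "\<i> * (\<i> * t) = - t" for t by (simp flip: mult.assoc)
    note simps = dag_def p oct_linear
    show "dg (dag (alb_phase v)) 1 = dg (alb_phase (dag v)) 1"
      by (simp add: simps) (simp add: m algebra_simps)
    show "dg (dag (alb_phase v)) 2 = dg (alb_phase (dag v)) 2"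
      by (simp add: simps) (simp add: m algebra_simps)
    show "dg (dag (alb_phase v)) 3 = dg (alb_phase (dag v)) 3"
      by (simp add: simps) (simp add: ii mult_ac)
    show "od (dag (alb_phase v)) 1 = od (alb_phase (dag v)) 1"
      by (rule oct_eqI, simp add: simps z) (simp add: m z algebra_simps)
    show "od (dag (alb_phase v)) 2 = od (alb_phase (dag v)) 2"
      by (rule oct_eqI, simp add: simps z) (simp add: m z algebra_simps)
    show "od (dag (alb_phase v)) 3 = od (alb_phase (dag v)) 3"
      by (rule oct_eqI, simp add: simps z)
  qed
  ultimately show ?thesis unfolding alb_group_def by blast
qed

text \<open>
  For a real unit \<open>u\<close> these maps fix the diagonal and turn the scalar part of the third off-diagonal
  entry into its coefficient along \<open>u\<close>.
\<close>
definition alb_twist :: "coct \<Rightarrow> alb \<Rightarrow> alb" where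
  "alb_twist u v = alb_mk (dg v)
     (\<lambda>i. if i = 1 then (u \<odot> od v 1) \<odot> u else if i = 2 then coct_inv u \<odot> od v 2
        else od v 3 \<odot> coct_inv u)"

lemma alb_twist_coords:
  "dg (alb_twist u v) i = dg v i" "od (alb_twist u v) 1 = (u \<odot> od v 1) \<odot> u"
  "od (alb_twist u v) 2 = coct_inv u \<odot> od v 2" "od (alb_twist u v) 3 = od v 3 \<odot> coct_inv u"
  by (simp_all add: alb_twist_def)

text \<open>
  Compatibility with the adjoint means three identities for products of two twisted entries. The first
  is the middle Moufang identity. It says that the twist preserves the cyclic trilinear form; the
  other two follow by pairing with an arbitrary \<open>s\<close>, written as a twisted entry, and rotating.
\<close>
lemma alb_twist_group:
  assumes u: "u \<bullet>\<^sub>o u = 1" "coct_cnj u = u"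
  shows "alb_twist u \<in> alb_group"
proof (rule alb_groupI_real)
  note p = alb_twist_coords[of u]
  fix v w :: alb and c :: complex
  show "alb_twist u (v + w) = alb_twist u v + alb_twist u w"
    by (rule alb_eqI3) (simp_all add: p oct_linear)
  show "alb_twist u (c *\<^sub>C w) = c *\<^sub>C alb_twist u w"
    by (rule alb_eqI3) (simp_all add: p oct_linear)
  show "alb_twist u (alb_cnj w) = alb_cnj (alb_twist u w)"
    by (rule alb_eqI3) (simp_all add: p oct_cnj_mult oct_cnj_inv u(2))
  have r: "(a \<odot> u) \<bullet>\<^sub>o (b \<odot> u) = a \<bullet>\<^sub>o b" "(a \<odot> coct_inv u) \<bullet>\<^sub>o (b \<odot> coct_inv u) = a \<bullet>\<^sub>o b" for a b
    using oct_norm_mult_left[of "coct_inv u" "coct_inv a" "coct_inv b"]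
      oct_norm_mult_left[of u "coct_inv a" "coct_inv b"] oct_dot_inv_inv[of "a \<odot> u" "b \<odot> u"]
      oct_dot_inv_inv[of "a \<odot> coct_inv u" "b \<odot> coct_inv u"]
    by (simp_all add: oct_inv_mult u)
  have l: "(u \<odot> a) \<bullet>\<^sub>o (u \<odot> b) = a \<bullet>\<^sub>o b" "(coct_inv u \<odot> a) \<bullet>\<^sub>o (coct_inv u \<odot> b) = a \<bullet>\<^sub>o b" for a b
    by (simp_all add: oct_norm_mult_left u)
  show "tr_form (alb_twist u v) (alb_twist u w) = tr_form v w"
    by (simp add: tr_form_def sum_3 p r l)
  have M1: "coct_inv ((coct_inv u \<odot> b) \<odot> (c \<odot> coct_inv u)) = (u \<odot> coct_inv (b \<odot> c)) \<odot> u" for b c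
    by (simp add: oct_moufang oct_inv_mult oct_flexible)
  have t: "((u \<odot> a) \<odot> u) \<bullet>\<^sub>o coct_inv ((coct_inv u \<odot> b) \<odot> (c \<odot> coct_inv u)) = a \<bullet>\<^sub>o coct_inv (b \<odot> c)" for a b c
    unfolding M1 by (simp add: r l)
  have tri: "a \<bullet>\<^sub>o coct_inv (b \<odot> c) = b \<bullet>\<^sub>o coct_inv (c \<odot> a)" for a b c
    using oct_triality[of a c b] by (simp add: oct_inv_mult)
  have M2: "coct_inv ((c \<odot> coct_inv u) \<odot> ((u \<odot> a) \<odot> u)) = coct_inv u \<odot> coct_inv (c \<odot> a)" for a c
  proof (rule oct_eqI)
    fix s
    have s: "s = coct_inv u \<odot> (u \<odot> s)" by (simp add: oct_alt_left u)
    show "coct_inv ((c \<odot> coct_inv u) \<odot> ((u \<odot> a) \<odot> u)) \<bullet>\<^sub>o s = (coct_inv u \<odot> coct_inv (c \<odot> a)) \<bullet>\<^sub>o s"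
      using t[of a "u \<odot> s" c] tri[of "(u \<odot> a) \<odot> u" "coct_inv u \<odot> (u \<odot> s)" "c \<odot> coct_inv u"]
        tri[of a "u \<odot> s" c] l(2)[of "coct_inv (c \<odot> a)" "u \<odot> s"] s
      by (metis oct_dot_commute)
  qed
  have M3: "coct_inv (((u \<odot> a) \<odot> u) \<odot> (coct_inv u \<odot> b)) = coct_inv (a \<odot> b) \<odot> coct_inv u" for a b
  proof (rule oct_eqI)
    fix s
    have s: "s = (s \<odot> u) \<odot> coct_inv u" by (simp add: oct_alt_right u)
    show "coct_inv (((u \<odot> a) \<odot> u) \<odot> (coct_inv u \<odot> b)) \<bullet>\<^sub>o s = (coct_inv (a \<odot> b) \<odot> coct_inv u) \<bullet>\<^sub>o s"
      using t[of a b "s \<odot> u"] tri[of "(s \<odot> u) \<odot> coct_inv u" "(u \<odot> a) \<odot> u" "coct_inv u \<odot> b"]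
        tri[of "s \<odot> u" a b] r(2)[of "coct_inv (a \<odot> b)" "s \<odot> u"] s
      by (metis oct_dot_commute)
  qed
  show "sharp (alb_twist u v) = alb_twist u (sharp v)"
    by (rule alb_eqI3) (simp_all add: p r l oct_linear M1 M2 M3)
qed

section \<open>Diagonalization\<close>

definition wsq :: "(3 \<Rightarrow> real) \<Rightarrow> alb \<Rightarrow> real" where
  "wsq w v = (\<Sum>i\<in>UNIV. w i * (cmod (dg v i))\<^sup>2)"

definition wsq_max :: "(3 \<Rightarrow> real) \<Rightarrow> alb \<Rightarrow> bool" where
  "wsq_max w v \<longleftrightarrow> (\<forall>k\<in>alb_group. wsq w (k v) \<le> wsq w v)"

lemma wsq_maxD: "wsq_max w v \<Longrightarrow> k \<in> alb_group \<Longrightarrow> wsq w (k v) \<le> wsq w v"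
  by (simp add: wsq_max_def)

lemma wsq_max_move:
  assumes "wsq_max w v" "k \<in> alb_group" "wsq w (k v) = wsq w v" shows "wsq_max w (k v)"
  unfolding wsq_max_def using wsq_maxD[OF assms(1) alb_group_comp[OF _ assms(2)]] assms(3) by simp

text \<open>
  The quarter turn exchanges the first two diagonal entries \<open>x\<close> and \<open>y\<close>, so maximality orders them by
  weight. Let \<open>r\<close> be the scalar part of the entry between them. Stationarity under rotations, for \<open>v\<close> and
  for its image under the phase map, gives the real and the imaginary part of
  \<open>w 1 * (cnj x * r) = cnj (w 2 * (cnj y * r))\<close>. If \<open>r \<noteq> 0\<close> then \<open>w 1 * cmod x = w 2 * cmod y\<close>, which is
  compatible with the ordering only if \<open>x = y = 0\<close>; but then a rotation by 45 degrees moves \<open>r\<close> onto the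
  diagonal and increases the mass.
\<close>
lemma wsq_max_sc:
  assumes w: "\<And>i. w i > 0" "w 1 \<noteq> w 2"
    and mx: "wsq_max w v"
  shows "(w 1 - w 2) * ((cmod (dg v 1))\<^sup>2 - (cmod (dg v 2))\<^sup>2) \<ge> 0" "oct_sc (od v 3) = 0"
proof -
  have swap: "(w 1 - w 2) * ((cmod (dg v 1))\<^sup>2 - (cmod (dg v 2))\<^sup>2) \<ge> 0"
    using wsq_maxD[OF mx alb_rot_group[of 0 1]] by (simp add: wsq_def sum_3 alb_rot_coords algebra_simps)
  then show "(w 1 - w 2) * ((cmod (dg v 1))\<^sup>2 - (cmod (dg v 2))\<^sup>2) \<ge> 0" .
  have stat: "w 1 * Re (cnj (dg v 1) * oct_sc (od v 3)) = w 2 * Re (cnj (dg v 2) * oct_sc (od v 3))"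
    if mx: "wsq_max w v" for v
  proof -
    define x y r where d: "x = dg v 1" "y = dg v 2" "r = oct_sc (od v 3)"
    define G where "G \<theta> = w 1 * ((((cos \<theta>)\<^sup>2 * Re x + 2 * cos \<theta> * sin \<theta> * Re r + (sin \<theta>)\<^sup>2 * Re y))\<^sup>2
        + (((cos \<theta>)\<^sup>2 * Im x + 2 * cos \<theta> * sin \<theta> * Im r + (sin \<theta>)\<^sup>2 * Im y))\<^sup>2)
      + w 2 * ((((sin \<theta>)\<^sup>2 * Re x - 2 * cos \<theta> * sin \<theta> * Re r + (cos \<theta>)\<^sup>2 * Re y))\<^sup>2
        + (((sin \<theta>)\<^sup>2 * Im x - 2 * cos \<theta> * sin \<theta> * Im r + (cos \<theta>)\<^sup>2 * Im y))\<^sup>2)" for \<theta>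
    have "G \<theta> \<le> G 0" for \<theta>
      using wsq_maxD[OF mx alb_rot_group[of "cos \<theta>" "sin \<theta>"]]
      by (simp add: wsq_def sum_3 alb_rot_coords cmod_power2 d[symmetric] G_def flip: of_real_power)
    moreover have "DERIV G 0 :> w 1 * (4 * Re x * Re r + 4 * Im x * Im r) - w 2 * (4 * Re y * Re r + 4 * Im y * Im r)"
      unfolding G_def by (auto intro!: derivative_eq_intros simp: algebra_simps)
    ultimately have "w 1 * (4 * Re x * Re r + 4 * Im x * Im r) - w 2 * (4 * Re y * Re r + 4 * Im y * Im r) = 0"
      by (intro DERIV_local_max[of G _ 0 1]) auto
    then show ?thesis by (simp add: d[symmetric] algebra_simps)
  qed
  define x y r where d: "x = dg v 1" "y = dg v 2" "r = oct_sc (od v 3)"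
  have 1: "w 1 * Re (cnj x * r) = w 2 * Re (cnj y * r)" unfolding d by (rule stat[OF mx])
  have "wsq w (alb_phase v) = wsq w v" by (simp add: wsq_def sum_3 alb_phase_coords norm_mult)
  then have "wsq_max w (alb_phase v)" by (rule wsq_max_move[OF mx alb_phase_group])
  from stat[OF this] have 2: "w 1 * Im (cnj x * r) = - w 2 * Im (cnj y * r)"
    by (simp add: alb_phase_coords d algebra_simps)
  show "oct_sc (od v 3) = 0"
  proof (rule ccontr)
    assume "oct_sc (od v 3) \<noteq> 0"
    then have r0: "r \<noteq> 0" by (simp add: d)
    have "cmod (of_real (w 1) * (cnj x * r)) = cmod (of_real (w 2) * (cnj y * r))"
    proof -
      have "of_real (w 1) * (cnj x * r) = cnj (of_real (w 2) * (cnj y * r))"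
        using 1 2 by (simp add: complex_eq_iff algebra_simps)
      then show ?thesis by (simp only: complex_mod_cnj)
    qed
    then have e: "w 1 * cmod x = w 2 * cmod y" using r0 w(1)[of 1] w(1)[of 2] by (simp add: norm_mult)
    have xy: "x = 0 \<and> y = 0"
    proof (cases "w 1 < w 2")
      case True
      then have "(cmod x)\<^sup>2 \<le> (cmod y)\<^sup>2" using swap by (simp add: d mult_le_0_iff zero_le_mult_iff)
      then have "cmod x \<le> cmod y" by (rule power2_le_imp_le) simp
      then have "w 2 * cmod y \<le> w 1 * cmod y" using e w(1)[of 1] by (metis less_eq_real_def mult_left_mono)
      then have "y = 0" using True by (metis mult_le_cancel_right norm_le_zero_iff not_le)
      then show ?thesis using e w(1)[of 1] by auto
    next
      case False
      then have "w 2 < w 1" using w(2) by simp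
      then have "(cmod y)\<^sup>2 \<le> (cmod x)\<^sup>2" using swap by (simp add: d mult_le_0_iff zero_le_mult_iff)
      then have "cmod y \<le> cmod x" by (rule power2_le_imp_le) simp
      then have "w 1 * cmod x \<le> w 2 * cmod x" using e w(1)[of 2] by (metis less_eq_real_def mult_left_mono)
      then have "x = 0" using \<open>w 2 < w 1\<close> by (metis mult_le_cancel_right norm_le_zero_iff not_le)
      then show ?thesis using e w(1)[of 2] by auto
    qed
    define h where "h = 1 / sqrt 2"
    have hh: "h\<^sup>2 + h\<^sup>2 = 1" "2 * h * h = 1" unfolding h_def by (simp_all add: power_divide)
    have "2 * complex_of_real h * complex_of_real h = 1"
      using hh(2) by (metis of_real_1 of_real_mult of_real_numeral)
    then have "w 1 * (cmod r)\<^sup>2 + w 2 * (cmod r)\<^sup>2 \<le> 0"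
      using wsq_maxD[OF mx alb_rot_group[OF hh(1)]] xy by (simp add: wsq_def sum_3 alb_rot_coords d)
    moreover have "w 1 * (cmod r)\<^sup>2 > 0" "w 2 * (cmod r)\<^sup>2 > 0" using r0 w(1)[of 1] w(1)[of 2] by auto
    ultimately show False by linarith
  qed
qed

lemma oct_eq_0_by_units:
  assumes "\<And>u. u \<bullet>\<^sub>o u = 1 \<Longrightarrow> coct_cnj u = u \<Longrightarrow> a \<bullet>\<^sub>o u = 0" shows "a = 0"
proof -
  obtain a1 a2 a3 a4 a5 a6 a7 a8 where a: "a = (((a1,a2),(a3,a4)),((a5,a6),(a7,a8)))"
    by (rule coct_exhaust)
  show ?thesis
    using assms[of "(((1,0),(0,0)),((0,0),(0,0)))"] assms[of "(((0,1),(0,0)),((0,0),(0,0)))"]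
      assms[of "(((0,0),(1,0)),((0,0),(0,0)))"] assms[of "(((0,0),(0,1)),((0,0),(0,0)))"]
      assms[of "(((0,0),(0,0)),((1,0),(0,0)))"] assms[of "(((0,0),(0,0)),((0,1),(0,0)))"]
      assms[of "(((0,0),(0,0)),((0,0),(1,0)))"] assms[of "(((0,0),(0,0)),((0,0),(0,1)))"]
    unfolding a by (simp add: oct_coords)
qed

text \<open>
  The twists fix the diagonal, so the twisted point is again maximal, and its scalar part is the
  coefficient of \<open>od v 3\<close> along \<open>u\<close>.
\<close>
lemma wsq_max_od3:
  assumes w: "\<And>i. w i > 0" "w 1 \<noteq> w 2"
    and mx: "wsq_max w v"
  shows "od v 3 = 0"
proof (rule oct_eq_0_by_units)
  fix u assume u: "u \<bullet>\<^sub>o u = 1" "coct_cnj u = u"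
  have "wsq w (alb_twist u v) = wsq w v" by (simp add: wsq_def alb_twist_coords)
  then have "wsq_max w (alb_twist u v)" by (rule wsq_max_move[OF mx alb_twist_group[OF u]])
  from wsq_max_sc(2)[OF w this] show "od v 3 \<bullet>\<^sub>o u = 0"
    by (simp add: alb_twist_coords oct_sc_mult)
qed

text \<open>
  The other two pairs of indices reduce to the first by the cyclic shift, which also shifts the weights;
  this is why the weights are kept general.
\<close>
lemma wsq_max_diag:
  assumes w: "\<And>i. w i > 0" "\<And>i. w i \<noteq> w (i + 1)"
    and mx: "wsq_max w v"
  shows "(w i - w (i + 1)) * ((cmod (dg v i))\<^sup>2 - (cmod (dg v (i + 1)))\<^sup>2) \<ge> 0 \<and> od v (i + 2) = 0"
proof -
  have main: "(w 1 - w 2) * ((cmod (dg v 1))\<^sup>2 - (cmod (dg v 2))\<^sup>2) \<ge> 0 \<and> od v 3 = 0"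
    if "\<forall>i. w i > 0" "\<forall>i. w i \<noteq> w (i + 1)" "wsq_max w v" for w v
  proof -
    have "w 1 \<noteq> w 2" using spec[OF that(2), of 1] by simp
    then show ?thesis using wsq_max_sc(1)[of w v] wsq_max_od3[of w v] that(1,3) by blast
  qed
  have cyc: "wsq_max (\<lambda>i. w (i + 1)) (alb_cyc v)" if mx: "wsq_max w v" for w v
    unfolding wsq_max_def
  proof
    fix k assume k: "k \<in> alb_group"
    have e: "wsq (\<lambda>i. w (i + 1)) (alb_cyc v) = wsq w v" for v
      by (simp add: wsq_def sum_3)
    have "alb_cyc (alb_cyc (alb_cyc u)) = u" for u by (rule alb_eqI3) simp_all
    then have "wsq (\<lambda>i. w (i + 1)) (k (alb_cyc v)) = wsq w (alb_cyc (alb_cyc (k (alb_cyc v))))"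
      using e[of "alb_cyc (alb_cyc (k (alb_cyc v)))"] by simp
    also have "\<dots> \<le> wsq w v"
      using wsq_maxD[OF mx alb_group_comp[OF alb_cyc_group alb_group_comp[OF alb_cyc_group
          alb_group_comp[OF k alb_cyc_group]]]] .
    finally show "wsq (\<lambda>i. w (i + 1)) (k (alb_cyc v)) \<le> wsq (\<lambda>i. w (i + 1)) (alb_cyc v)"
      by (simp add: e)
  qed
  have m2: "wsq_max (\<lambda>i. w (i + 2)) (alb_cyc (alb_cyc v))"
    using cyc[OF cyc[OF mx]] by simp
  have f1: "(w 1 - w 2) * ((cmod (dg v 1))\<^sup>2 - (cmod (dg v 2))\<^sup>2) \<ge> 0 \<and> od v 3 = 0"
    using main[of w v] w mx by blast
  have "w (i + 1) \<noteq> w (i + 1 + 1)" "w (i + 2) \<noteq> w (i + 1 + 2)" for i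
    using w(2)[of "i + 1"] w(2)[of "i + 2"] by simp_all
  then have f2: "(w 2 - w 3) * ((cmod (dg v 2))\<^sup>2 - (cmod (dg v 3))\<^sup>2) \<ge> 0 \<and> od v 1 = 0"
    and f3: "(w 3 - w 1) * ((cmod (dg v 3))\<^sup>2 - (cmod (dg v 1))\<^sup>2) \<ge> 0 \<and> od v 2 = 0"
    using main[OF _ _ cyc[OF mx]] main[OF _ _ m2] w(1) by simp_all
  show ?thesis
    using exhaust_3[of i] f1 f2 f3 by auto
qed

lemma alb_scaleR_conv: "r *\<^sub>R v = complex_of_real r *\<^sub>C (v::alb)"
  by (simp add: scaleC_of_real)

lemma bounded_linear_dg: "bounded_linear (\<lambda>v. dg v i)"
  unfolding dg_def by (intro bounded_linear_compose[OF bounded_linear_vec_nth] bounded_linear_fst)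

lemma bounded_linear_od: "bounded_linear (\<lambda>v. od v i)"
  unfolding od_def by (intro bounded_linear_compose[OF bounded_linear_vec_nth] bounded_linear_snd)

lemma bounded_bilinear_oct_dot: "bounded_bilinear (\<bullet>\<^sub>o)"
  unfolding bilinear_conv_bounded_bilinear[symmetric] bilinear_def
  by (intro conjI allI linearI) (simp_all add: oct_dot_linear scaleR_conv_of_real)

lemma cross_scaleC_left: "cross (c *\<^sub>C u) v = c *\<^sub>C cross u v"
  by (simp add: cross_commute[of _ v] cross_scaleC_right)

lemma bounded_bilinear_cross: "bounded_bilinear cross"
  unfolding bilinear_conv_bounded_bilinear[symmetric] bilinear_def
  by (intro conjI allI linearI)
     (simp_all add: cross_add_left cross_add_right alb_scaleR_conv cross_scaleC_left cross_scaleC_right)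

lemma sharp_eq_cross: "sharp v = (1/2) *\<^sub>R cross v v"
  by (simp add: cross_self alb_scaleR_conv scaleC_scaleC del: split_paired_All)

lemma continuous_dg [continuous_intros]: "continuous_on S f \<Longrightarrow> continuous_on S (\<lambda>x. dg (f x) i)"
  by (rule bounded_linear.continuous_on[OF bounded_linear_dg])

lemma continuous_od [continuous_intros]: "continuous_on S f \<Longrightarrow> continuous_on S (\<lambda>x. od (f x) i)"
  by (rule bounded_linear.continuous_on[OF bounded_linear_od])

lemma continuous_sharp [continuous_intros]: "continuous_on S f \<Longrightarrow> continuous_on S (\<lambda>x. sharp (f x))"
  unfolding sharp_eq_cross by (intro continuous_intros bounded_bilinear.continuous_on[OF bounded_bilinear_cross])

lemma continuous_alb_cnj [continuous_intros]: "continuous_on S f \<Longrightarrow> continuous_on S (\<lambda>x. alb_cnj (f x))"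
proof -
  have "linear alb_cnj"
    by (rule linearI) (simp_all add: alb_cnj_add alb_scaleR_conv alb_cnj_scaleC)
  then have "bounded_linear alb_cnj" by (rule linear_conv_bounded_linear[THEN iffD1])
  then show "continuous_on S f \<Longrightarrow> continuous_on S (\<lambda>x. alb_cnj (f x))"
    by (rule bounded_linear.continuous_on)
qed

lemma continuous_hsq [continuous_intros]: "continuous_on S f \<Longrightarrow> continuous_on S (\<lambda>x. hsq (f x))"
  unfolding hsq_def by (intro continuous_intros)

lemma continuous_cubic_norm [continuous_intros]: "continuous_on S f \<Longrightarrow> continuous_on S (\<lambda>x. cubic_norm (f x))"
  unfolding cubic_norm_row[of _ 1]
  by (intro continuous_intros bounded_bilinear.continuous_on[OF bounded_bilinear_oct_dot])

lemma compact_alb_group: "compact {B :: alb \<Rightarrow>\<^sub>L alb. blinfun_apply B \<in> alb_group}"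
proof (rule compact_eq_bounded_closed[THEN iffD2], rule conjI)
  show "bounded {B :: alb \<Rightarrow>\<^sub>L alb. blinfun_apply B \<in> alb_group}"
    unfolding bounded_iff using alb_group_norm by (intro exI[of _ "sqrt 2"]) (auto intro!: norm_blinfun_bound)
  have e: "{B :: alb \<Rightarrow>\<^sub>L alb. blinfun_apply B \<in> alb_group} =
     {B. \<forall>c v. blinfun_apply B (c *\<^sub>C v) = c *\<^sub>C blinfun_apply B v} \<inter> {B. \<forall>v. hsq (blinfun_apply B v) = hsq v} \<inter>
     {B. \<forall>v. dag (blinfun_apply B v) = blinfun_apply B (dag v)}"
    unfolding alb_group_def by (auto simp: blinfun.add_right simp del: split_paired_All)
  have b: "bounded_linear (\<lambda>v::alb. c *\<^sub>C v)" for c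
    by (rule bounded_linear_intro[where K = "cmod c"])
       (simp_all add: scaleC_add_right alb_scaleR_conv scaleC_scaleC mult.commute norm_scaleC)
  show "closed {B :: alb \<Rightarrow>\<^sub>L alb. blinfun_apply B \<in> alb_group}"
    unfolding e dag_def
    by (intro closed_Int closed_Collect_all closed_Collect_eq continuous_intros
        bounded_linear.continuous_on[OF b])
qed

lemma wsq_max_exists: "\<exists>k\<in>alb_group. wsq_max w (k v)"
proof -
  have "continuous_on UNIV (\<lambda>B :: alb \<Rightarrow>\<^sub>L alb. wsq w (B v))"
    unfolding wsq_def by (intro continuous_intros)
  then have "continuous_on {B :: alb \<Rightarrow>\<^sub>L alb. blinfun_apply B \<in> alb_group} (\<lambda>B. wsq w (B v))"
    by (rule continuous_on_subset) simp
  moreover have ap: "blinfun_apply (Blinfun k) = k" if "k \<in> alb_group" for k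
    using alb_group_bounded_linear(1)[OF that] by (rule bounded_linear_Blinfun_apply)
  have "{B :: alb \<Rightarrow>\<^sub>L alb. blinfun_apply B \<in> alb_group} \<noteq> {}"
    using ap[OF alb_group_id] alb_group_id by (metis empty_iff mem_Collect_eq)
  ultimately obtain B :: "alb \<Rightarrow>\<^sub>L alb" where B: "blinfun_apply B \<in> alb_group"
    and mx: "\<And>C :: alb \<Rightarrow>\<^sub>L alb. blinfun_apply C \<in> alb_group \<Longrightarrow> wsq w (C v) \<le> wsq w (B v)"
    using continuous_attains_sup[OF compact_alb_group] by blast
  have "wsq w (k (B v)) \<le> wsq w (B v)" if k: "k \<in> alb_group" for k
    using mx[of "Blinfun (\<lambda>v. k (B v))"] ap[OF alb_group_comp[OF k B]] alb_group_comp[OF k B] by simp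
  then show ?thesis using B by (auto simp: wsq_max_def)
qed

definition alb_diag :: "(3 \<Rightarrow> complex) \<Rightarrow> alb" where "alb_diag b = alb_mk b (\<lambda>_. 0)"

lemma alb_diag_coords [simp]: "dg (alb_diag b) i = b i" "od (alb_diag b) i = 0"
  by (simp_all add: alb_diag_def)

text \<open>
  Distinct weights make all off-diagonal entries vanish at the maximum, and decreasing weights sort the
  diagonal.
\<close>
lemma alb_diagonalize:
  obtains k b where "k \<in> alb_group" "k v = alb_diag b" "cmod (b 1) \<ge> cmod (b 2)" "cmod (b 2) \<ge> cmod (b 3)"
proof -
  \<comment> \<open>any strictly decreasing positive weights would do\<close>
  define w where "w i = (if i = 1 then 3 else if i = 2 then 2 else (1::real))" for i :: 3
  obtain k where k: "k \<in> alb_group" "wsq_max w (k v)" using wsq_max_exists by blast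
  have w: "\<And>i. w i > 0" "\<And>i. w i \<noteq> w (i + 1)"
    subgoal for i by (simp add: w_def)
    subgoal for i using exhaust_3[of i] by (auto simp: w_def)
    done
  note d = wsq_max_diag[OF w k(2)]
  have "od (k v) i = 0" for i using d[of "i + 1"] by simp
  then have "k v = alb_diag (dg (k v))" by (intro alb_eqI) simp_all
  moreover have "cmod (dg (k v) 2) \<le> cmod (dg (k v) 1)" "cmod (dg (k v) 3) \<le> cmod (dg (k v) 2)"
    using d[of 1] d[of 2] by (auto simp: w_def intro: power2_le_imp_le)
  ultimately show ?thesis using k(1) that by blast
qed

section \<open>Spectral decompositions\<close>

definition alb_unit :: "3 \<Rightarrow> alb" where "alb_unit i = alb_diag (\<lambda>j. if j = i then 1 else 0)"

lemma alb_unit_coords [simp]: "dg (alb_unit i) j = (if j = i then 1 else 0)" "od (alb_unit i) j = 0"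
  by (simp_all add: alb_unit_def)

lemma alb_diag_unit: "alb_diag b = b 1 *\<^sub>C alb_unit 1 + b 2 *\<^sub>C alb_unit 2 + b 3 *\<^sub>C alb_unit 3"
  by (rule alb_eqI3) simp_all

lemma herm_alb_unit [simp]: "herm x (alb_unit i) = dg x i"
  by (simp add: herm_def tr_form_def if_distrib sum.delta cong: if_cong)

lemma dag_alb_unit: "dag (alb_unit i) = 0"
  unfolding dag_def by (rule alb_eqI) (auto simp: oct_linear)

lemma alb_triple_unit_orth:
  assumes "i \<noteq> j" shows "alb_triple (alb_unit i) (alb_unit j) x = 0"
proof -
  have j: "j = i + 1 \<or> j = i + 2" using assms exhaust_3[of i] exhaust_3[of j] by auto
  have "dcross (dcross (alb_unit i) x) (alb_unit j) = dg x j *\<^sub>C alb_unit i"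
  proof -
    have "dg (dcross (dcross (alb_unit i) x) (alb_unit j)) l = dg (dg x j *\<^sub>C alb_unit i) l \<and>
       od (dcross (dcross (alb_unit i) x) (alb_unit j)) l = od (dg x j *\<^sub>C alb_unit i) l" for l
      using j exhaust_3[of i] exhaust_3[of l]
      by (elim disjE) (simp_all add: dcross_def oct_linear)
    then show ?thesis by (intro alb_eqI) simp_all
  qed
  then show ?thesis using assms by (simp add: alb_triple_def)
qed

lemma dcross_scaleC: "dcross (c *\<^sub>C u) v = cnj c *\<^sub>C dcross u v" "dcross u (c *\<^sub>C v) = cnj c *\<^sub>C dcross u v"
proof -
  show 1: "dcross u (c *\<^sub>C v) = cnj c *\<^sub>C dcross u v" for u v
    by (simp add: dcross_def cross_scaleC_right alb_cnj_scaleC)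
  show "dcross (c *\<^sub>C u) v = cnj c *\<^sub>C dcross u v"
    using 1[of v u] by (simp add: dcross_commute[of _ v])
qed

lemma alb_triple_scaleC:
  "alb_triple (a *\<^sub>C x) (b *\<^sub>C y) (c *\<^sub>C z) = (a * cnj b * c) *\<^sub>C alb_triple x y z"
  by (simp add: alb_triple_def dcross_scaleC herm_scaleC_left herm_scaleC_right scaleC_scaleC
      scaleC_add_right scaleC_diff_right algebra_simps)

lemma dcross_self: "dcross x x = 2 *\<^sub>C dag x"
  by (simp add: dcross_def dag_def cross_self alb_cnj_scaleC)

lemma alb_triple_rank_one:
  assumes "dag e = 0" shows "alb_triple e y e = herm e y *\<^sub>C e"
  by (simp add: alb_triple_def dcross_self assms dcross_scaleC(1)[of 0 0 y, simplified] scaleC_scaleC flip: scaleC_add_left)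

text \<open>
  The points with vanishing adjoint have rank one: the triple product collapses to
  \<open>{e,y,e} = herm e y *\<^sub>C e\<close>.
\<close>
lemma minimal_tripotent_rank_one:
  assumes "dag e = 0" "hsq e = 1" shows "minimal_tripotent (alb_mat e)"
proof -
  have t: "alb_triple e y e = herm e y *\<^sub>C e" for y by (rule alb_triple_rank_one[OF assms(1)])
  have h: "herm e e = 1" using assms(2) by (simp add: herm_self)
  have "{triple (alb_mat e) x (alb_mat e) | x. x \<in> H3O} = {c *\<^sub>C alb_mat e | c. True}" (is "?A = ?B")
  proof
    show "?A \<subseteq> ?B" by (auto simp: H3O_eq triple_alb_mat t alb_mat_scaleC)
    show "?B \<subseteq> ?A"
    proof
      fix y assume "y \<in> ?B"
      then obtain c where y: "y = c *\<^sub>C alb_mat e" by auto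
      have "triple (alb_mat e) (alb_mat (cnj c *\<^sub>C e)) (alb_mat e) = y"
        unfolding triple_alb_mat t herm_scaleC_right h by (simp add: alb_mat_scaleC y)
      then show "y \<in> ?A" by (auto intro!: exI[of _ "alb_mat (cnj c *\<^sub>C e)"])
    qed
  qed
  moreover have "e \<noteq> 0" using assms(2) hsq_eq_0[of e] by linarith
  ultimately show ?thesis
    using alb_mat_inject[of e 0] by (simp add: minimal_tripotent_def tripotent_def triple_alb_mat t h del: alb_mat_inject)
qed

text \<open>
  The tripotents are the preimages of the diagonal units, each multiplied by the phase of the
  corresponding diagonal entry.
\<close>
lemma spectral_decomposition_exists:
  assumes k: "k \<in> alb_group" and v: "k v = alb_diag b"
    and s: "cmod (b 1) \<ge> cmod (b 2)" "cmod (b 2) \<ge> cmod (b 3)"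
  shows "\<exists>e. spectral_decomposition (alb_mat v) (cmod (b 1), cmod (b 2), cmod (b 3)) e"
proof -
  have "\<exists>p. cmod p = 1 \<and> b i = of_real (cmod (b i)) * p" for i
  proof (cases "b i = 0")
    case True
    then show ?thesis by (intro exI[of _ 1]) simp
  next
    case False
    then show ?thesis by (intro exI[of _ "b i / of_real (cmod (b i))"]) (simp add: norm_divide)
  qed
  then obtain p where p: "\<And>i. cmod (p i) = 1" "\<And>i. b i = of_real (cmod (b i)) * p i" by metis
  define l where "l = inv k"
  have l: "l \<in> alb_group" unfolding l_def by (rule alb_group_inv[OF k])
  define e where "e i = p i *\<^sub>C l (alb_unit i)" for i
  have lk: "l (k v) = v" using alb_group_bij[OF k] by (simp add: l_def bij_is_inj)
  have "v = l (alb_diag b)" by (simp add: lk flip: v)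
  also have "\<dots> = b 1 *\<^sub>C l (alb_unit 1) + b 2 *\<^sub>C l (alb_unit 2) + b 3 *\<^sub>C l (alb_unit 3)"
    by (simp add: alb_diag_unit alb_groupD[OF l])
  finally have v': "v = b 1 *\<^sub>C l (alb_unit 1) + b 2 *\<^sub>C l (alb_unit 2) + b 3 *\<^sub>C l (alb_unit 3)" .
  have be: "b i *\<^sub>C l (alb_unit i) = cmod (b i) *\<^sub>R e i" for i
    unfolding e_def alb_scaleR_conv scaleC_scaleC using p(2)[of i] by simp
  have veq: "v = cmod (b 1) *\<^sub>R e 1 + cmod (b 2) *\<^sub>R e 2 + cmod (b 3) *\<^sub>R e 3"
    using v' unfolding be .
  have l0: "l 0 = 0" using alb_groupD(2)[OF l, of 0 0] by simp
  have min: "minimal_tripotent (alb_mat (e i))" for i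
  proof (rule minimal_tripotent_rank_one)
    have "dag (p i *\<^sub>C alb_unit i) = 0"
      using dcross_self[of "p i *\<^sub>C alb_unit i"] dcross_self[of "alb_unit i"]
      by (simp add: dcross_scaleC dag_alb_unit)
    then show "dag (e i) = 0"
      using alb_groupD(4)[OF l, of "p i *\<^sub>C alb_unit i"]
      by (simp add: l0 e_def alb_groupD(2)[OF l, symmetric])
    have "of_real (hsq (alb_unit i)) = complex_of_real 1"
      unfolding herm_self[symmetric] by simp
    then show "hsq (e i) = 1"
      by (simp add: e_def hsq_scaleC p alb_groupD(3)[OF l])
  qed
  have orth: "triple_orthogonal (alb_mat (e i)) (alb_mat (e j))" if "i \<noteq> j" for i j
  proof -
    have "alb_triple (e i) (e j) x = 0" for x
    proof -
      have "alb_triple (e i) (e j) (l y) = 0" for y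
        using alb_triple_scaleC[of "p i" "l (alb_unit i)" "p j" "l (alb_unit j)" 1 "l y"]
        by (simp add: e_def alb_group_triple[OF l] alb_triple_unit_orth[OF that] l0)
      from this[of "k x"] show ?thesis using alb_group_bij[OF k] by (simp add: l_def bij_is_inj)
    qed
    then show ?thesis by (auto simp: triple_orthogonal_def H3O_eq triple_alb_mat)
  qed
  have "alb_mat v = cmod (b 1) *\<^sub>R alb_mat (e 1) + cmod (b 2) *\<^sub>R alb_mat (e 2) + cmod (b 3) *\<^sub>R alb_mat (e 3)"
    by (subst veq) (simp add: alb_mat_add alb_mat_scaleR)
  then have "spectral_decomposition (alb_mat v) (cmod (b 1), cmod (b 2), cmod (b 3))
      (alb_mat (e 1), alb_mat (e 2), alb_mat (e 3))"
    using min orth s by (simp add: spectral_decomposition_def)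
  then show ?thesis ..
qed

lemma alb_triple_add:
  "alb_triple (x + x') y z = alb_triple x y z + alb_triple x' y z"
  "alb_triple x (y + y') z = alb_triple x y z + alb_triple x y' z"
  "alb_triple x y (z + z') = alb_triple x y z + alb_triple x y z'"
  by (simp_all add: alb_triple_def herm_add_left herm_add_right dcross_add_left dcross_add_right
      scaleC_add_left scaleC_add_right scaleC_diff_right)

lemma alb_triple_scaleR:
  "alb_triple (a *\<^sub>R x) (b *\<^sub>R y) (c *\<^sub>R z) = (a * b * c) *\<^sub>R alb_triple x y z"
  unfolding alb_scaleR_conv alb_triple_scaleC by simp

lemma alb_triple_commute: "alb_triple x y z = alb_triple z y x"
  by (simp add: alb_triple_def dcross_commute[of x z] add.commute)

text \<open>
  Mutually orthogonal nonzero tripotents.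
\<close>
definition alb_frame :: "(3 \<Rightarrow> alb) \<Rightarrow> bool" where
  "alb_frame e \<longleftrightarrow> (\<forall>i. alb_triple (e i) (e i) (e i) = e i \<and> e i \<noteq> 0) \<and>
     (\<forall>i j x. i \<noteq> j \<longrightarrow> alb_triple (e i) (e j) x = 0)"

text \<open>
  By orthogonality and the symmetry of the triple product in its outer arguments, only one of the nine
  terms of the expansion survives, so the frame consists of eigenvectors of \<open>x \<mapsto> {z,z,x}\<close>.
\<close>
lemma alb_frame_eigen:
  fixes a :: "3 \<Rightarrow> real"
  assumes "alb_frame e" and z: "z = a 1 *\<^sub>R e 1 + a 2 *\<^sub>R e 2 + a 3 *\<^sub>R e 3"
  shows "alb_triple z z (c *\<^sub>R e i) = (c * (a i)\<^sup>2) *\<^sub>R e i"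
proof -
  have t: "alb_triple (e j) (e j) (e j) = e j" "\<And>j i x. i \<noteq> j \<Longrightarrow> alb_triple (e i) (e j) x = 0" for j
    using assms(1) unfolding alb_frame_def by blast+
  have o: "alb_triple (e j) (e l) (e i) = (if j = i \<and> l = i then e i else 0)" for j l
    using t alb_triple_commute[of "e j" "e l" "e i"] by metis
  have s: "alb_triple (a *\<^sub>R x) (b *\<^sub>R y) z = (a * b) *\<^sub>R alb_triple x y z"
    "alb_triple x y (a *\<^sub>R z) = a *\<^sub>R alb_triple x y z" for a b x y z
    using alb_triple_scaleR[of a x b y 1 z] alb_triple_scaleR[of 1 x 1 y a z] by simp_all
  show ?thesis
    unfolding z using exhaust_3[of i]
    by (auto simp: alb_triple_add s o power2_eq_square)
qed

text \<open>
  This gives uniqueness of the largest spectral value. Let \<open>L x = {z,z,x}\<close>. The operator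
  \<open>(L - b\<^sub>3\<^sup>2) (L - b\<^sub>2\<^sup>2) (L - b\<^sub>1\<^sup>2)\<close> kills \<open>z\<close>, by the second decomposition. If \<open>a\<^sub>1\<close> exceeded all \<open>b\<^sub>i\<close>,
  the first decomposition would show a nonzero coefficient at \<open>e\<^sub>1\<close>.
\<close>
lemma alb_frame_le:
  fixes a b :: "3 \<Rightarrow> real"
  assumes e: "alb_frame e" and z: "z = a 1 *\<^sub>R e 1 + a 2 *\<^sub>R e 2 + a 3 *\<^sub>R e 3"
    and f: "alb_frame f" and z': "z = b 1 *\<^sub>R f 1 + b 2 *\<^sub>R f 2 + b 3 *\<^sub>R f 3"
    and b: "\<And>i. 0 \<le> b i" "\<And>i. b i \<le> b 1"
  shows "a 1 \<le> b 1"
proof (rule ccontr)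
  assume "\<not> a 1 \<le> b 1"
  then have lt: "b i < a 1" for i using b(2)[of i] by linarith
  define M where "M c x = alb_triple z z x - c *\<^sub>R x" for c :: real and x :: alb
  have M_add: "M c (x + y) = M c x + M c y" for c x y
    by (simp add: M_def alb_triple_add algebra_simps)
  have Me: "M c (r *\<^sub>R e i) = (r * ((a i)\<^sup>2 - c)) *\<^sub>R e i" for c r i
    by (simp add: M_def alb_frame_eigen[OF e z] algebra_simps)
  have Mf: "M c (r *\<^sub>R f i) = (r * ((b i)\<^sup>2 - c)) *\<^sub>R f i" for c r i
    by (simp add: M_def alb_frame_eigen[OF f z'] algebra_simps)
  define P where "P = M ((b 3)\<^sup>2) (M ((b 2)\<^sup>2) (M ((b 1)\<^sup>2) z))"
  have P0: "P = 0"
    unfolding P_def by (subst z') (simp add: M_add Mf)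
  define q where "q i = a i * ((a i)\<^sup>2 - (b 1)\<^sup>2) * ((a i)\<^sup>2 - (b 2)\<^sup>2) * ((a i)\<^sup>2 - (b 3)\<^sup>2)" for i
  have Pe: "P = q 1 *\<^sub>R e 1 + q 2 *\<^sub>R e 2 + q 3 *\<^sub>R e 3"
    unfolding P_def q_def by (subst z) (simp add: M_add Me)
  have "q 1 *\<^sub>R e 1 = alb_triple (e 1) (e 1) P"
    using alb_frame_eigen[OF e, of "e 1" "\<lambda>i. if i = 1 then 1 else 0"] unfolding Pe by (simp add: alb_triple_add)
  also have "\<dots> = 0"
    unfolding P0 using alb_triple_scaleR[of 1 "e 1" 1 "e 1" 0 0] by simp
  finally have "q 1 = 0" using e by (simp add: alb_frame_def)
  moreover have "(b i)\<^sup>2 < (a 1)\<^sup>2" for i using lt[of i] b(1)[of i] by (intro power_strict_mono) auto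
  then have "(a 1)\<^sup>2 - (b i)\<^sup>2 \<noteq> 0" for i by (metis less_irrefl right_minus_eq)
  moreover have "a 1 \<noteq> 0" using lt[of 1] b(1)[of 1] by linarith
  ultimately show False unfolding q_def by simp
qed

lemma spectral_decomposition_frame:
  assumes "spectral_decomposition (alb_mat v) (\<alpha>1, \<alpha>2, \<alpha>3) es"
  obtains e and a :: "3 \<Rightarrow> real" where "alb_frame e" "v = a 1 *\<^sub>R e 1 + a 2 *\<^sub>R e 2 + a 3 *\<^sub>R e 3" "a 1 = \<alpha>1"
    "\<And>i. 0 \<le> a i" "\<And>i. a i \<le> a 1"
proof -
  obtain e1 e2 e3 where es: "es = (e1, e2, e3)" by (cases es) auto
  note sd = assms[unfolded es spectral_decomposition_def prod.case]
  have H: "e1 \<in> H3O" "e2 \<in> H3O" "e3 \<in> H3O" using sd by (auto simp: minimal_tripotent_def tripotent_def)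
  define e where "e i = alb_of (if i = 1 then e1 else if i = 2 then e2 else e3)" for i :: 3
  define a where "a i = (if i = 1 then \<alpha>1 else if i = 2 then \<alpha>2 else \<alpha>3)" for i :: 3
  have em: "alb_mat (e 1) = e1" "alb_mat (e 2) = e2" "alb_mat (e 3) = e3"
    using H by (simp_all add: e_def alb_mat_of)
  have T: "triple (alb_mat x) (alb_mat y) (alb_mat z) = 0 \<longleftrightarrow> alb_triple x y z = 0" for x y z
    using alb_mat_inject[of "alb_triple x y z" 0] by (simp add: triple_alb_mat del: alb_mat_inject)
  have orth: "triple_orthogonal (alb_mat x) (alb_mat y) \<longleftrightarrow> (\<forall>w. alb_triple x y w = 0)" for x y
    by (auto simp: triple_orthogonal_def H3O_eq T simp del: split_paired_All)
  have "alb_frame e"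
    unfolding alb_frame_def
  proof (intro conjI allI impI)
    fix i j x
    have "\<forall>e\<in>{e1, e2, e3}. minimal_tripotent e" using sd by blast
    then have "minimal_tripotent (alb_mat (e i))" using exhaust_3[of i] em by auto
    then show "alb_triple (e i) (e i) (e i) = e i" "e i \<noteq> 0"
      using alb_mat_inject[of "e i" 0] by (auto simp: minimal_tripotent_def tripotent_def triple_alb_mat)
    assume "i \<noteq> j"
    have "triple_orthogonal (alb_mat (e i)) (alb_mat (e j))"
      using exhaust_3[of i] exhaust_3[of j] \<open>i \<noteq> j\<close> sd em by auto
    then show "alb_triple (e i) (e j) x = 0" unfolding orth by blast
  qed
  moreover have "alb_mat v = alb_mat (a 1 *\<^sub>R e 1 + a 2 *\<^sub>R e 2 + a 3 *\<^sub>R e 3)"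
    using sd by (simp add: alb_mat_add alb_mat_scaleR em a_def)
  then have "v = a 1 *\<^sub>R e 1 + a 2 *\<^sub>R e 2 + a 3 *\<^sub>R e 3" by (simp only: alb_mat_inject)
  moreover have "a 1 = \<alpha>1" "\<And>i. 0 \<le> a i" "\<And>i. a i \<le> a 1" using sd by (auto simp: a_def)
  ultimately show ?thesis by (rule that)
qed

lemma spectral_norm_eq:
  assumes "k \<in> alb_group" "k v = alb_diag b" "cmod (b 1) \<ge> cmod (b 2)" "cmod (b 2) \<ge> cmod (b 3)"
  shows "spectral_norm (alb_mat v) = cmod (b 1)"
  unfolding spectral_norm_def
proof (rule the_equality)
  show "\<exists>\<alpha>2 \<alpha>3 e. spectral_decomposition (alb_mat v) (cmod (b 1), \<alpha>2, \<alpha>3) e"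
    using spectral_decomposition_exists[OF assms] by blast
next
  fix \<alpha> assume "\<exists>\<alpha>2 \<alpha>3 e. spectral_decomposition (alb_mat v) (\<alpha>, \<alpha>2, \<alpha>3) e"
  then obtain \<alpha>2 \<alpha>3 es where 1: "spectral_decomposition (alb_mat v) (\<alpha>, \<alpha>2, \<alpha>3) es" by blast
  obtain fs where 2: "spectral_decomposition (alb_mat v) (cmod (b 1), cmod (b 2), cmod (b 3)) fs"
    using spectral_decomposition_exists[OF assms] by blast
  from 1 obtain e and a :: "3 \<Rightarrow> real" where e: "alb_frame e" "v = a 1 *\<^sub>R e 1 + a 2 *\<^sub>R e 2 + a 3 *\<^sub>R e 3" "a 1 = \<alpha>"
    "\<And>i. 0 \<le> a i" "\<And>i. a i \<le> a 1" by (rule spectral_decomposition_frame) (rule that)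
  from 2 obtain f and c :: "3 \<Rightarrow> real" where f: "alb_frame f" "v = c 1 *\<^sub>R f 1 + c 2 *\<^sub>R f 2 + c 3 *\<^sub>R f 3" "c 1 = cmod (b 1)"
    "\<And>i. 0 \<le> c i" "\<And>i. c i \<le> c 1" by (rule spectral_decomposition_frame) (rule that)
  show "\<alpha> = cmod (b 1)"
    using alb_frame_le[OF e(1,2) f(1,2,4,5)] alb_frame_le[OF f(1,2) e(1,2,4,5)] e(3) f(3) by simp
qed

section \<open>The domain in coordinates\<close>

definition alb_delta :: "alb \<Rightarrow> real" where
  "alb_delta v = 1 - hsq v + hsq (sharp v) - (cmod (cubic_norm v))\<^sup>2"

text \<open>
  With \<open>c\<^sub>i = 1 - \<alpha>\<^sub>i\<^sup>2\<close>, the three quantities are the elementary symmetric functions of the \<open>c\<^sub>i\<close>; they are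
  all positive exactly if every \<open>c\<^sub>i\<close> is.
\<close>
definition alb_dom :: "alb set" where
  "alb_dom = {v. 0 < alb_delta v \<and> 0 < 3 - 2 * hsq v + hsq (sharp v) \<and> 0 < 3 - hsq v}"

text \<open>
  The polynomial \<open>(t + a) (t + b) (t + c)\<close> has nonnegative coefficients and leading coefficient 1, so it
  has no root \<open>t = - a > 0\<close>.
\<close>
lemma esymm_nonneg:
  fixes a b c :: real
  assumes "0 \<le> a * b * c" "0 \<le> a * b + b * c + c * a" "0 \<le> a + b + c" shows "0 \<le> a"
proof (rule ccontr)
  assume "\<not> 0 \<le> a"
  then have t: "0 < - a" by simp
  have "(- a)^3 + (a + b + c) * (- a)\<^sup>2 + (a * b + b * c + c * a) * (- a) + a * b * c = 0"
    by algebra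
  moreover have "0 < (- a)^3" using t by simp
  moreover have "0 \<le> (a + b + c) * (- a)\<^sup>2" "0 \<le> (a * b + b * c + c * a) * (- a)"
    using assms t by (simp_all add: mult_nonneg_nonpos2 mult_le_0_iff zero_le_mult_iff)
  ultimately show False using assms(1) by linarith
qed

lemma esymm_pos:
  fixes a b c :: real
  shows "0 < a * b * c \<and> 0 < a * b + b * c + c * a \<and> 0 < a + b + c \<longleftrightarrow> 0 < a \<and> 0 < b \<and> 0 < c"
proof
  assume "0 < a * b * c \<and> 0 < a * b + b * c + c * a \<and> 0 < a + b + c"
  then show "0 < a \<and> 0 < b \<and> 0 < c"
    using esymm_nonneg[of a b c] esymm_nonneg[of b c a] esymm_nonneg[of c a b]
    by (auto simp: less_le mult_ac add_ac)
qed (simp add: add_pos_pos)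

lemma alb_diag_invariants:
  assumes "k \<in> alb_group" "k v = alb_diag b"
  defines "c \<equiv> \<lambda>i. 1 - (cmod (b i))\<^sup>2"
  shows "alb_delta v = c 1 * c 2 * c 3"
    and "3 - 2 * hsq v + hsq (sharp v) = c 1 * c 2 + c 2 * c 3 + c 3 * c 1"
    and "3 - hsq v = c 1 + c 2 + c 3"
proof -
  have h: "hsq v = (cmod (b 1))\<^sup>2 + (cmod (b 2))\<^sup>2 + (cmod (b 3))\<^sup>2"
    using alb_groupD(3)[OF assms(1), of v] by (simp add: assms(2) hsq_def sum_3)
  have s: "hsq (sharp v) = (cmod (b 2) * cmod (b 3))\<^sup>2 + (cmod (b 3) * cmod (b 1))\<^sup>2 + (cmod (b 1) * cmod (b 2))\<^sup>2"
    using alb_group_hsq_sharp[OF assms(1), of v] by (simp add: assms(2) hsq_def sum_3 norm_mult)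
  have "cubic_norm v = cubic_norm (alb_diag b)"
    using alb_group_cubic_norm[OF assms(1), of v] by (simp add: assms(2))
  also have "\<dots> = b 1 * b 2 * b 3" by (simp add: cubic_norm_def)
  finally have n: "cmod (cubic_norm v) = cmod (b 1) * cmod (b 2) * cmod (b 3)"
    by (simp add: norm_mult)
  show "alb_delta v = c 1 * c 2 * c 3" "3 - 2 * hsq v + hsq (sharp v) = c 1 * c 2 + c 2 * c 3 + c 3 * c 1"
    "3 - hsq v = c 1 + c 2 + c 3"
    unfolding alb_delta_def h s n c_def by algebra+
qed

lemma alb_dom_diag:
  assumes "k \<in> alb_group" "k v = alb_diag b"
  shows "v \<in> alb_dom \<longleftrightarrow> (\<forall>i. cmod (b i) < 1)"
  using esymm_pos[of "1 - (cmod (b 1))\<^sup>2" "1 - (cmod (b 2))\<^sup>2" "1 - (cmod (b 3))\<^sup>2"]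
  unfolding alb_dom_def mem_Collect_eq alb_diag_invariants[OF assms]
  by (simp add: forall_3 power_less_one_iff abs_square_less_1)

lemma D27_eq: "D27 = alb_mat ` alb_dom"
proof -
  have "spectral_norm (alb_mat v) < 1 \<longleftrightarrow> v \<in> alb_dom" for v
  proof -
    obtain k b where kb: "k \<in> alb_group" "k v = alb_diag b" "cmod (b 1) \<ge> cmod (b 2)" "cmod (b 2) \<ge> cmod (b 3)"
      by (rule alb_diagonalize)
    show ?thesis unfolding spectral_norm_eq[OF kb] alb_dom_diag[OF kb(1,2)]
      using kb(3,4) by (auto simp: forall_3)
  qed
  then show ?thesis by (auto simp: D27_def H3O_eq)
qed

lemma alb_dom_group: "k \<in> alb_group \<Longrightarrow> k v \<in> alb_dom \<longleftrightarrow> v \<in> alb_dom"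
  by (simp add: alb_dom_def alb_delta_def alb_groupD alb_group_hsq_sharp alb_group_cubic_norm)

lemma continuous_alb_delta: "continuous_on UNIV alb_delta"
  unfolding alb_delta_def by (intro continuous_intros)

lemma open_alb_dom: "open alb_dom"
proof -
  have e: "alb_dom = {v. 0 < alb_delta v} \<inter> {v. 0 < 3 - 2 * hsq v + hsq (sharp v)} \<inter> {v. 0 < 3 - hsq v}"
    by (auto simp: alb_dom_def simp del: split_paired_All)
  show ?thesis unfolding e
    by (intro open_Int open_Collect_less continuous_alb_delta continuous_intros)
qed

text \<open>
  The domain is relatively closed in the set where \<open>alb_delta\<close> is positive: on the closure all factors
  \<open>1 - \<alpha>\<^sub>i\<^sup>2\<close> are nonnegative, and their product is \<open>alb_delta\<close>. This drives the connectedness argument for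
  the Moebius maps.
\<close>
lemma alb_dom_closure: assumes "v \<in> closure alb_dom" "0 < alb_delta v" shows "v \<in> alb_dom"
proof -
  have "closure alb_dom \<subseteq> {v. 0 \<le> alb_delta v} \<inter> {v. 0 \<le> 3 - 2 * hsq v + hsq (sharp v)} \<inter> {v. 0 \<le> 3 - hsq v}"
    by (intro closure_minimal closed_Int closed_Collect_le continuous_alb_delta continuous_intros)
       (auto simp: alb_dom_def simp del: split_paired_All)
  then have ge: "0 \<le> 3 - 2 * hsq v + hsq (sharp v)" "0 \<le> 3 - hsq v" using assms(1) by auto
  obtain k b where kb: "k \<in> alb_group" "k v = alb_diag b" by (rule alb_diagonalize)
  define c where "c i = 1 - (cmod (b i))\<^sup>2" for i
  note inv = alb_diag_invariants[OF kb, folded c_def]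
  have "0 \<le> c 1" "0 \<le> c 2" "0 \<le> c 3"
    using esymm_nonneg[of "c 1" "c 2" "c 3"] esymm_nonneg[of "c 2" "c 3" "c 1"] esymm_nonneg[of "c 3" "c 1" "c 2"]
      ge assms(2) unfolding inv by (auto simp: mult_ac add_ac)
  moreover have "c 1 \<noteq> 0" "c 2 \<noteq> 0" "c 3 \<noteq> 0" using assms(2) unfolding inv by auto
  ultimately have "0 < c 1" "0 < c 2" "0 < c 3" by (simp_all add: less_le)
  then show ?thesis
    unfolding alb_dom_diag[OF kb] by (simp add: forall_3 c_def abs_square_less_1)
qed

lemma alb_dom_scale: assumes "v \<in> alb_dom" "cmod r \<le> 1" shows "r *\<^sub>C v \<in> alb_dom"
proof -
  obtain k b where kb: "k \<in> alb_group" "k v = alb_diag b" by (rule alb_diagonalize)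
  have "k (r *\<^sub>C v) = alb_diag (\<lambda>i. r * b i)"
    unfolding alb_groupD(2)[OF kb(1)] kb(2) by (rule alb_eqI) simp_all
  then show ?thesis
    using assms alb_dom_diag[OF kb] alb_dom_diag[OF kb(1), of "r *\<^sub>C v"]
    by (simp add: norm_mult) (metis le_less_trans mult_left_le_one_le norm_ge_zero)
qed

lemma zero_alb_dom: "0 \<in> alb_dom"
proof -
  have "(0::alb) = alb_diag (\<lambda>_. 0)" by (rule alb_eqI) simp_all
  then show ?thesis using alb_dom_diag[OF alb_group_id, of 0 "\<lambda>_. 0"] by simp
qed

lemma connected_alb_dom: "connected alb_dom"
proof (rule starlike_imp_connected)
  show "starlike alb_dom"
    unfolding starlike_def
  proof (intro bexI[of _ 0] ballI subsetI)
    fix v x assume "v \<in> alb_dom" "x \<in> closed_segment 0 v"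
    then obtain u where "0 \<le> u" "u \<le> 1" "x = u *\<^sub>R v" by (auto simp: in_segment)
    then show "x \<in> alb_dom" using alb_dom_scale[OF \<open>v \<in> alb_dom\<close>, of "of_real u"] by (simp add: scaleC_of_real)
  qed (rule zero_alb_dom)
qed

lemma alb_dom_hsq_less: "v \<in> alb_dom \<Longrightarrow> hsq v < 3"
  by (simp add: alb_dom_def)

lemma hsq_less_1_alb_dom: assumes "hsq v < 1" shows "v \<in> alb_dom"
proof -
  obtain k b where kb: "k \<in> alb_group" "k v = alb_diag b" by (rule alb_diagonalize)
  have "(cmod (b i))\<^sup>2 \<le> hsq (alb_diag b)" for i
    using member_le_sum[of i UNIV "\<lambda>i. (cmod (b i))\<^sup>2"] by (simp add: hsq_def)
  then have "(cmod (b i))\<^sup>2 < 1" for i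
    using assms alb_groupD(3)[OF kb(1), of v] unfolding kb(2) by (metis le_less_trans)
  then show ?thesis unfolding alb_dom_diag[OF kb] by (simp add: abs_square_less_1)
qed

lemma cmod_oct_dot_self: "cmod (a \<bullet>\<^sub>o a) \<le> (norm a)\<^sup>2"
proof -
  obtain a1 a2 a3 a4 a5 a6 a7 a8 where a: "a = (((a1,a2),(a3,a4)),((a5,a6),(a7,a8)))"
    by (rule coct_exhaust)
  have "cmod (a \<bullet>\<^sub>o a) \<le> cmod (a1*a1) + cmod (a2*a2) + cmod (a3*a3) + cmod (a4*a4) + cmod (a5*a5)
      + cmod (a6*a6) + cmod (a7*a7) + cmod (a8*a8)"
    unfolding a oct_dot_def prod.case by (intro order.trans[OF norm_triangle_ineq] add_mono order.refl)
  then show ?thesis by (simp add: a norm_prod_def norm_mult power2_eq_square)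
qed

text \<open>
  For a point of rank one, \<open>\<bar>f\<^sub>j f\<^sub>k\<bar>\<close> equals \<open>\<bar>b \<bullet>\<^sub>o b\<bar> \<le> \<parallel>b\<parallel>\<^sup>2\<close> for the entry \<open>b\<close> between the
  diagonal entries \<open>f\<^sub>j\<close> and \<open>f\<^sub>k\<close>. Hence the square of the sum of the \<open>\<bar>f\<^sub>i\<bar>\<close> is at most \<open>hsq f\<close>.
\<close>
lemma rank_one_diag_le:
  assumes "dag f = 0" "hsq f = 1"
  shows "cmod (dg f 1) + cmod (dg f 2) + cmod (dg f 3) \<le> 1"
proof -
  have "alb_cnj (dag f) = 0" unfolding assms(1) by (rule alb_eqI) simp_all
  then have "sharp f = 0" by (simp add: dag_def)
  then have "dg (sharp f) i = 0" for i by simp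
  then have "cmod (dg f (i+1)) * cmod (dg f (i+2)) = cmod (od f i \<bullet>\<^sub>o od f i)" for i
    by (simp flip: norm_mult)
  then have le: "cmod (dg f (i+1)) * cmod (dg f (i+2)) \<le> (norm (od f i))\<^sup>2" for i
    by (simp add: cmod_oct_dot_self)
  have "(cmod (dg f 1) + cmod (dg f 2) + cmod (dg f 3))\<^sup>2
     = (cmod (dg f 1))\<^sup>2 + (cmod (dg f 2))\<^sup>2 + (cmod (dg f 3))\<^sup>2 + 2 * (cmod (dg f 2) * cmod (dg f 3)
       + cmod (dg f 3) * cmod (dg f 1) + cmod (dg f 1) * cmod (dg f 2))"
    by algebra
  also have "\<dots> \<le> hsq f"
    using le[of 1] le[of 2] le[of 3] by (simp add: hsq_def sum_3)
  finally have "(cmod (dg f 1) + cmod (dg f 2) + cmod (dg f 3))\<^sup>2 \<le> 1\<^sup>2"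
    by (simp add: assms(2))
  then show ?thesis by (rule power2_le_imp_le) simp
qed

text \<open>
  Diagonalizing \<open>v\<close> turns the entry into a combination of the \<open>b j\<close> with the conjugated diagonal entries of a
  rank-one unit vector as coefficients, whose moduli add up to at most 1.
\<close>
lemma alb_dom_dg_less_1: assumes "v \<in> alb_dom" shows "cmod (dg v i) < 1"
proof -
  obtain k b where kb: "k \<in> alb_group" "k v = alb_diag b" "cmod (b 1) \<ge> cmod (b 2)" "cmod (b 2) \<ge> cmod (b 3)"
    by (rule alb_diagonalize)
  define f where "f = k (alb_unit i)"
  have f: "dag f = 0" "hsq f = 1"
  proof -
    have "k 0 = 0" using alb_groupD(2)[OF kb(1), of 0 0] by simp
    then show "dag f = 0" by (simp add: f_def alb_groupD(4)[OF kb(1)] dag_alb_unit)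
    have "complex_of_real (hsq (alb_unit i)) = of_real 1" unfolding herm_self[symmetric] by simp
    then show "hsq f = 1" unfolding f_def alb_groupD(3)[OF kb(1)] by (simp only: of_real_eq_iff)
  qed
  have "dg v i = herm (alb_diag b) f"
    using alb_group_herm[OF kb(1), of v "alb_unit i"] by (simp add: kb(2) f_def)
  also have "\<dots> = b 1 * cnj (dg f 1) + b 2 * cnj (dg f 2) + b 3 * cnj (dg f 3)"
    by (simp add: herm_def tr_form_def sum_3)
  also have "cmod \<dots> \<le> cmod (b 1) * cmod (dg f 1) + cmod (b 2) * cmod (dg f 2) + cmod (b 3) * cmod (dg f 3)"
    by (intro order.trans[OF norm_triangle_ineq] add_mono) (simp_all add: norm_mult)
  also have "\<dots> \<le> cmod (b 1) * (cmod (dg f 1) + cmod (dg f 2) + cmod (dg f 3))"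
    using kb(3,4) by (simp add: distrib_left mult_right_mono add_mono)
  also have "\<dots> \<le> cmod (b 1)"
    using rank_one_diag_le[OF f] by (rule mult_left_le) simp
  also have "\<dots> < 1" using assms alb_dom_diag[OF kb(1,2)] by simp
  finally show ?thesis .
qed

section \<open>Moebius transformations\<close>

text \<open>
  The transvection that moves \<open>a e\<^sub>1\<close> to 0. For matrices \<open>Z\<close> over an associative algebra it reads
  \<open>P\<^sup>-\<^sup>1 (Z - A) (1 - A\<^sup>* Z)\<^sup>-\<^sup>1 Q\<close> with \<open>A = a e\<^sub>1\<close>, \<open>P\<^sup>2 = 1 - A A\<^sup>*\<close> and \<open>Q\<^sup>2 = 1 - A\<^sup>* A\<close>; the entries below are those
  of this product, with the quadratic terms collected in the adjoint.
\<close>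
definition alb_moebius :: "complex \<Rightarrow> alb \<Rightarrow> alb" where
  "alb_moebius a v = (let d = 1 - cnj a * dg v 1; s = complex_of_real (sqrt (1 - (cmod a)\<^sup>2)); y = sharp v in
     (1 / d) *\<^sub>C alb_mk
      (\<lambda>i. if i = 1 then dg v 1 - a else if i = 2 then dg v 2 - cnj a * dg y 3 else dg v 3 - cnj a * dg y 2)
      (\<lambda>i. if i = 1 then od v 1 + cnj a *\<^sub>C od y 1 else s *\<^sub>C od v i))"

lemma alb_moebius_coords:
  fixes v a defines "d \<equiv> 1 - cnj a * dg v 1" and "s \<equiv> complex_of_real (sqrt (1 - (cmod a)\<^sup>2))" and "y \<equiv> sharp v"
  shows "dg (alb_moebius a v) 1 = (dg v 1 - a) / d" "dg (alb_moebius a v) 2 = (dg v 2 - cnj a * dg y 3) / d"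
    "dg (alb_moebius a v) 3 = (dg v 3 - cnj a * dg y 2) / d"
    "od (alb_moebius a v) 1 = (1 / d) *\<^sub>C (od v 1 + cnj a *\<^sub>C od y 1)"
    "od (alb_moebius a v) 2 = (s / d) *\<^sub>C od v 2" "od (alb_moebius a v) 3 = (s / d) *\<^sub>C od v 3"
  by (simp_all add: alb_moebius_def Let_def d_def s_def y_def scaleC_scaleC)

text \<open>
  In projective terms the transvection acts linearly on the tuple \<open>(1, v, sharp v, cubic_norm v)\<close>, the
  first entry becoming \<open>d\<close>. The proof is that the numerator of each entry, which is quadratic in the
  new coordinates, is divisible by \<open>d\<close>; this uses the relations between \<open>v\<close>, its adjugate and its
  determinant.
\<close>
lemma alb_moebius_sharp:
  fixes v a defines "d \<equiv> 1 - cnj a * dg v 1" and "s \<equiv> complex_of_real (sqrt (1 - (cmod a)\<^sup>2))" and "y \<equiv> sharp v"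
  assumes a: "cmod a < 1" and d: "d \<noteq> 0"
  shows "dg (sharp (alb_moebius a v)) 1 = (dg y 1 - cnj a * cubic_norm v) / d"
    and "dg (sharp (alb_moebius a v)) 2 = (dg y 2 - a * dg v 3) / d"
    and "dg (sharp (alb_moebius a v)) 3 = (dg y 3 - a * dg v 2) / d"
    and "od (sharp (alb_moebius a v)) 1 = (1 / d) *\<^sub>C (od y 1 + a *\<^sub>C od v 1)"
    and "od (sharp (alb_moebius a v)) 2 = (s / d) *\<^sub>C od y 2"
    and "od (sharp (alb_moebius a v)) 3 = (s / d) *\<^sub>C od y 3"
    and "cubic_norm (alb_moebius a v) = (cubic_norm v - a * dg y 1) / d"
proof -
  define N where "N = cubic_norm v"
  have "(cmod a)\<^sup>2 < 1" using a by (simp add: abs_square_less_1)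
  then have "s * s = of_real (1 - (cmod a)\<^sup>2)" by (simp add: s_def flip: of_real_mult)
  then have s: "s * s = 1 - a * cnj a" unfolding of_real_diff complex_norm_square by simp
  note c = alb_moebius_coords[of a v, folded d_def s_def y_def]
  have dd: "d = 1 - cnj a * dg v 1" by (simp add: d_def)
  have y: "dg y 1 = dg v 2 * dg v 3 - od v 1 \<bullet>\<^sub>o od v 1" "dg y 2 = dg v 3 * dg v 1 - od v 2 \<bullet>\<^sub>o od v 2"
    "dg y 3 = dg v 1 * dg v 2 - od v 3 \<bullet>\<^sub>o od v 3"
    by (simp_all add: y_def)
  have row: "N = dg v 1 * dg y 1 + od v 2 \<bullet>\<^sub>o od y 2 + od v 3 \<bullet>\<^sub>o od y 3"
    "N = dg v 2 * dg y 2 + od v 3 \<bullet>\<^sub>o od y 3 + od v 1 \<bullet>\<^sub>o od y 1"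
    "N = dg v 3 * dg y 3 + od v 1 \<bullet>\<^sub>o od y 1 + od v 2 \<bullet>\<^sub>o od y 2"
    unfolding y_def N_def
    subgoal using cubic_norm_row[of v 1] by (simp del: sharp_coords)
    subgoal using cubic_norm_row[of v 2] by (simp del: sharp_coords)
    subgoal using cubic_norm_row[of v 3] by (simp del: sharp_coords)
    done
  have ss: "dg y 2 * dg y 3 - od y 1 \<bullet>\<^sub>o od y 1 = N * dg v 1"
    using sharp_sharp_dg[of v 1] unfolding y_def N_def by (simp del: sharp_coords)
  have o: "coct_inv (od v 2 \<odot> od v 3) = od y 1 + dg v 1 *\<^sub>C od v 1"
    "coct_inv (od v 3 \<odot> od v 1) = od y 2 + dg v 2 *\<^sub>C od v 2"
    "coct_inv (od v 1 \<odot> od v 2) = od y 3 + dg v 3 *\<^sub>C od v 3"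
    by (simp_all add: y_def)
  have ad: "coct_inv (od v 3 \<odot> od y 1) = - dg v 1 *\<^sub>C od y 2 - dg y 3 *\<^sub>C od v 2"
    "coct_inv (od y 1 \<odot> od v 2) = - dg v 1 *\<^sub>C od y 3 - dg y 2 *\<^sub>C od v 3"
    using sharp_adjoint_od[of v 1] unfolding y_def by (simp_all add: algebra_simps del: sharp_coords)
  show s1: "dg (sharp (alb_moebius a v)) 1 = (dg y 1 - cnj a * cubic_norm v) / d"
  proof -
    define w where "w = od v 1 + cnj a *\<^sub>C od y 1"
    have "(dg v 2 - cnj a * dg y 3) * (dg v 3 - cnj a * dg y 2) - w \<bullet>\<^sub>o w = (dg y 1 - cnj a * N) * d"
      using row ss y(1) oct_dot_commute[of "od y 1" "od v 1"] unfolding dd w_def oct_linear by algebra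
    moreover have "dg (sharp (alb_moebius a v)) 1
        = ((dg v 2 - cnj a * dg y 3) * (dg v 3 - cnj a * dg y 2) - w \<bullet>\<^sub>o w) / (d * d)"
      using d unfolding sharp_coords by (simp add: c[folded w_def] oct_dot_linear) (simp add: divide_simps)
    ultimately show ?thesis using d by (simp add: N_def)
  qed
  show "dg (sharp (alb_moebius a v)) 2 = (dg y 2 - a * dg v 3) / d"
  proof -
    have "(dg v 3 - cnj a * dg y 2) * (dg v 1 - a) - s * s * (od v 2 \<bullet>\<^sub>o od v 2) = (dg y 2 - a * dg v 3) * d"
      using y(2) s unfolding dd by algebra
    moreover have "dg (sharp (alb_moebius a v)) 2
        = ((dg v 3 - cnj a * dg y 2) * (dg v 1 - a) - s * s * (od v 2 \<bullet>\<^sub>o od v 2)) / (d * d)"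
      using d unfolding sharp_coords by (simp add: c oct_linear) (simp add: divide_simps)
    ultimately show ?thesis using d by simp
  qed
  show "dg (sharp (alb_moebius a v)) 3 = (dg y 3 - a * dg v 2) / d"
  proof -
    have "(dg v 1 - a) * (dg v 2 - cnj a * dg y 3) - s * s * (od v 3 \<bullet>\<^sub>o od v 3) = (dg y 3 - a * dg v 2) * d"
      using y(3) s unfolding dd by algebra
    moreover have "dg (sharp (alb_moebius a v)) 3
        = ((dg v 1 - a) * (dg v 2 - cnj a * dg y 3) - s * s * (od v 3 \<bullet>\<^sub>o od v 3)) / (d * d)"
      using d unfolding sharp_coords by (simp add: c oct_linear) (simp add: divide_simps)
    ultimately show ?thesis using d by simp
  qed
  show "od (sharp (alb_moebius a v)) 1 = (1 / d) *\<^sub>C (od y 1 + a *\<^sub>C od v 1)"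
  proof (rule oct_eqI)
    fix t
    have "s * s * ((od y 1 + dg v 1 *\<^sub>C od v 1) \<bullet>\<^sub>o t) - (dg v 1 - a) * ((od v 1 + cnj a *\<^sub>C od y 1) \<bullet>\<^sub>o t)
        = d * ((od y 1 + a *\<^sub>C od v 1) \<bullet>\<^sub>o t)"
      unfolding oct_linear dd using s by algebra
    moreover have "od (sharp (alb_moebius a v)) 1 \<bullet>\<^sub>o t
        = (s * s * ((od y 1 + dg v 1 *\<^sub>C od v 1) \<bullet>\<^sub>o t) - (dg v 1 - a) * ((od v 1 + cnj a *\<^sub>C od y 1) \<bullet>\<^sub>o t)) / (d * d)"
      using d unfolding sharp_coords by (simp add: c o oct_linear) (simp add: divide_simps)
    ultimately show "od (sharp (alb_moebius a v)) 1 \<bullet>\<^sub>o t = (1 / d) *\<^sub>C (od y 1 + a *\<^sub>C od v 1) \<bullet>\<^sub>o t"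
      using d by (simp add: oct_dot_scaleC_left del: cvec.scale_right_distrib)
  qed
  show s2: "od (sharp (alb_moebius a v)) 2 = (s / d) *\<^sub>C od y 2"
  proof (rule oct_eqI)
    fix t
    have "(od y 2 + dg v 2 *\<^sub>C od v 2) \<bullet>\<^sub>o t + cnj a * ((- dg v 1 *\<^sub>C od y 2 - dg y 3 *\<^sub>C od v 2) \<bullet>\<^sub>o t)
       - (dg v 2 - cnj a * dg y 3) * (od v 2 \<bullet>\<^sub>o t) = d * (od y 2 \<bullet>\<^sub>o t)"
      unfolding oct_linear dd by (simp add: oct_linear algebra_simps)
    moreover have "od (sharp (alb_moebius a v)) 2 \<bullet>\<^sub>o t = s * ((od y 2 + dg v 2 *\<^sub>C od v 2) \<bullet>\<^sub>o t
       + cnj a * ((- dg v 1 *\<^sub>C od y 2 - dg y 3 *\<^sub>C od v 2) \<bullet>\<^sub>o t) - (dg v 2 - cnj a * dg y 3) * (od v 2 \<bullet>\<^sub>o t)) / (d * d)"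
      using d unfolding sharp_coords by (simp add: c o ad oct_linear) (simp add: divide_simps algebra_simps)
    ultimately show "od (sharp (alb_moebius a v)) 2 \<bullet>\<^sub>o t = (s / d) *\<^sub>C od y 2 \<bullet>\<^sub>o t"
      using d by (simp add: oct_dot_scaleC_left)
  qed
  show s3: "od (sharp (alb_moebius a v)) 3 = (s / d) *\<^sub>C od y 3"
  proof (rule oct_eqI)
    fix t
    have "(od y 3 + dg v 3 *\<^sub>C od v 3) \<bullet>\<^sub>o t + cnj a * ((- dg v 1 *\<^sub>C od y 3 - dg y 2 *\<^sub>C od v 3) \<bullet>\<^sub>o t)
       - (dg v 3 - cnj a * dg y 2) * (od v 3 \<bullet>\<^sub>o t) = d * (od y 3 \<bullet>\<^sub>o t)"
      unfolding oct_linear dd by (simp add: oct_linear algebra_simps)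
    moreover have "od (sharp (alb_moebius a v)) 3 \<bullet>\<^sub>o t = s * ((od y 3 + dg v 3 *\<^sub>C od v 3) \<bullet>\<^sub>o t
       + cnj a * ((- dg v 1 *\<^sub>C od y 3 - dg y 2 *\<^sub>C od v 3) \<bullet>\<^sub>o t) - (dg v 3 - cnj a * dg y 2) * (od v 3 \<bullet>\<^sub>o t)) / (d * d)"
      using d unfolding sharp_coords by (simp add: c o ad oct_linear) (simp add: divide_simps algebra_simps)
    ultimately show "od (sharp (alb_moebius a v)) 3 \<bullet>\<^sub>o t = (s / d) *\<^sub>C od y 3 \<bullet>\<^sub>o t"
      using d by (simp add: oct_dot_scaleC_left)
  qed
  have "cubic_norm (alb_moebius a v) = dg (alb_moebius a v) 1 * dg (sharp (alb_moebius a v)) 1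
      + od (alb_moebius a v) 2 \<bullet>\<^sub>o od (sharp (alb_moebius a v)) 2 + od (alb_moebius a v) 3 \<bullet>\<^sub>o od (sharp (alb_moebius a v)) 3"
    using cubic_norm_row[of "alb_moebius a v" 1] by (simp del: sharp_coords)
  also have "\<dots> = ((dg v 1 - a) * (dg y 1 - cnj a * N) + s * s * (od v 2 \<bullet>\<^sub>o od y 2 + od v 3 \<bullet>\<^sub>o od y 3)) / (d * d)"
    unfolding s1[folded N_def] s2 s3 c using d by (simp add: oct_linear field_simps)
  also have "(dg v 1 - a) * (dg y 1 - cnj a * N) + s * s * (od v 2 \<bullet>\<^sub>o od y 2 + od v 3 \<bullet>\<^sub>o od y 3) = (N - a * dg y 1) * d"
    using row(1) s unfolding dd by algebra
  finally show "cubic_norm (alb_moebius a v) = (cubic_norm v - a * dg y 1) / d"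
    using d by (simp add: N_def)
qed

text \<open>
  The map \<open>(p, q) \<mapsto> (p + a q, q + cnj a p)\<close> is a hyperbolic rotation up to scale.
\<close>
lemma cmod_hyp: "(cmod (p + a * q))\<^sup>2 - (cmod (q + cnj a * p))\<^sup>2 = (1 - (cmod a)\<^sup>2) * ((cmod p)\<^sup>2 - (cmod q)\<^sup>2)"
  unfolding cmod_power2 by (simp add: algebra_simps power2_eq_square)

lemma oct_hyp: "(norm (p + a *\<^sub>C q))\<^sup>2 - (norm (q + cnj a *\<^sub>C p))\<^sup>2 = (1 - (cmod a)\<^sup>2) * ((norm p)\<^sup>2 - (norm (q::coct))\<^sup>2)"
proof -
  have "complex_of_real ((norm (p + a *\<^sub>C q))\<^sup>2 - (norm (q + cnj a *\<^sub>C p))\<^sup>2)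
     = of_real ((1 - (cmod a)\<^sup>2) * ((norm p)\<^sup>2 - (norm q)\<^sup>2))"
    unfolding of_real_diff of_real_mult of_real_1 oct_dot_cnj_self[symmetric] complex_norm_square
    by (simp add: oct_linear algebra_simps)
  then show ?thesis by (simp only: of_real_eq_iff)
qed

text \<open>
  The summands of \<open>alb_delta\<close> pair up: 1 with \<open>dg v 1\<close>, \<open>dg y 1\<close> with the cubic norm, and each remaining
  entry of \<open>y\<close> with an entry of \<open>v\<close>. On each pair the transvection acts as a hyperbolic rotation, or as
  a dilation by the square root of \<open>1 - \<bar>a\<bar>\<^sup>2\<close>, divided by the common denominator.
\<close>
lemma alb_delta_moebius:
  assumes a: "cmod a < 1" and d: "1 - cnj a * dg v 1 \<noteq> 0"
  shows "(cmod (1 - cnj a * dg v 1))\<^sup>2 * alb_delta (alb_moebius a v) = (1 - (cmod a)\<^sup>2) * alb_delta v"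
proof -
  define D where "D = 1 - cnj a * dg v 1"
  define y where "y = sharp v"
  define S where "S = sqrt (1 - (cmod a)\<^sup>2)"
  have "(cmod a)\<^sup>2 \<le> 1" using a by (simp add: abs_square_le_1)
  then have S: "S\<^sup>2 = 1 - (cmod a)\<^sup>2" by (simp add: S_def)
  have D0: "(cmod D)\<^sup>2 \<noteq> 0" using d by (simp add: D_def)
  note c = alb_moebius_coords[of a v, folded D_def y_def S_def]
    alb_moebius_sharp[OF a d, folded D_def y_def S_def]
  have 1: "(cmod D)\<^sup>2 * hsq (alb_moebius a v) = (cmod (dg v 1 - a))\<^sup>2 + (cmod (dg v 2 - cnj a * dg y 3))\<^sup>2
     + (cmod (dg v 3 - cnj a * dg y 2))\<^sup>2 + 2 * ((norm (od v 1 + cnj a *\<^sub>C od y 1))\<^sup>2 + S\<^sup>2 * (norm (od v 2))\<^sup>2 + S\<^sup>2 * (norm (od v 3))\<^sup>2)"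
    using D0 unfolding hsq_def sum_3 c norm_scaleC by (simp add: norm_divide norm_mult power_divide power_mult_distrib field_simps)
  have 2: "(cmod D)\<^sup>2 * hsq (sharp (alb_moebius a v)) = (cmod (dg y 1 - cnj a * cubic_norm v))\<^sup>2 + (cmod (dg y 2 - a * dg v 3))\<^sup>2
     + (cmod (dg y 3 - a * dg v 2))\<^sup>2 + 2 * ((norm (od y 1 + a *\<^sub>C od v 1))\<^sup>2 + S\<^sup>2 * (norm (od y 2))\<^sup>2 + S\<^sup>2 * (norm (od y 3))\<^sup>2)"
    using D0 unfolding hsq_def sum_3 c norm_scaleC by (simp add: norm_divide norm_mult power_divide power_mult_distrib field_simps)
  have 3: "(cmod D)\<^sup>2 * (cmod (cubic_norm (alb_moebius a v)))\<^sup>2 = (cmod (cubic_norm v - a * dg y 1))\<^sup>2"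
    using D0 unfolding c by (simp add: norm_divide power_divide)
  have h: "(cmod D)\<^sup>2 - (cmod (dg v 1 - a))\<^sup>2 = S\<^sup>2 * (1 - (cmod (dg v 1))\<^sup>2)"
    "(cmod (dg y 1 - cnj a * cubic_norm v))\<^sup>2 - (cmod (cubic_norm v - a * dg y 1))\<^sup>2 = S\<^sup>2 * ((cmod (dg y 1))\<^sup>2 - (cmod (cubic_norm v))\<^sup>2)"
    "(cmod (dg y 2 - a * dg v 3))\<^sup>2 - (cmod (dg v 3 - cnj a * dg y 2))\<^sup>2 = S\<^sup>2 * ((cmod (dg y 2))\<^sup>2 - (cmod (dg v 3))\<^sup>2)"
    "(cmod (dg y 3 - a * dg v 2))\<^sup>2 - (cmod (dg v 2 - cnj a * dg y 3))\<^sup>2 = S\<^sup>2 * ((cmod (dg y 3))\<^sup>2 - (cmod (dg v 2))\<^sup>2)"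
    "(norm (od y 1 + a *\<^sub>C od v 1))\<^sup>2 - (norm (od v 1 + cnj a *\<^sub>C od y 1))\<^sup>2 = S\<^sup>2 * ((norm (od y 1))\<^sup>2 - (norm (od v 1))\<^sup>2)"
    using cmod_hyp[of 1 "- cnj a" "dg v 1"] cmod_hyp[of "dg y 1" "- cnj a" "cubic_norm v"]
      cmod_hyp[of "dg y 2" "- a" "dg v 3"] cmod_hyp[of "dg y 3" "- a" "dg v 2"] oct_hyp[of "od y 1" a "od v 1"]
    by (simp_all add: S D_def)
  have "hsq v = (cmod (dg v 1))\<^sup>2 + (cmod (dg v 2))\<^sup>2 + (cmod (dg v 3))\<^sup>2 + 2 * ((norm (od v 1))\<^sup>2 + (norm (od v 2))\<^sup>2 + (norm (od v 3))\<^sup>2)" for v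
    by (simp add: hsq_def sum_3)
  from this[of v] this[of y] show ?thesis
    unfolding alb_delta_def D_def[symmetric] y_def[symmetric] S[symmetric]
    using 1 2 3 h by (simp add: algebra_simps)
qed

text \<open>
  The formulas for the transformed adjoint make both steps linear. The denominators of
  the two maps multiply to \<open>1 - \<bar>a\<bar>\<^sup>2\<close>, which is also the factor that the numerators pick up.
\<close>
lemma alb_moebius_inverse:
  assumes a: "cmod a < 1" and d: "1 - cnj a * dg v 1 \<noteq> 0"
  shows "alb_moebius (- a) (alb_moebius a v) = v"
proof -
  define D where "D = 1 - cnj a * dg v 1"
  define y where "y = sharp v"
  define S where "S = complex_of_real (sqrt (1 - (cmod a)\<^sup>2))"
  define w where "w = alb_moebius a v"
  have "(cmod a)\<^sup>2 < 1" using a by (simp add: abs_square_less_1)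
  then have "S * S = of_real (1 - (cmod a)\<^sup>2)" by (simp add: S_def flip: of_real_mult)
  then have S: "S * S = 1 - a * cnj a" unfolding of_real_diff complex_norm_square by simp
  have S0: "S \<noteq> 0" using \<open>(cmod a)\<^sup>2 < 1\<close> by (simp add: S_def)
  have D0: "D \<noteq> 0" using d by (simp add: D_def)
  note c = alb_moebius_coords[of a v, folded D_def y_def S_def w_def]
    alb_moebius_sharp[OF a d, folded D_def y_def S_def w_def]
  define E where "E = 1 + cnj a * dg w 1"
  have E: "E = S * S / D" using D0 unfolding E_def c S by (simp add: field_simps D_def)
  have E0: "E \<noteq> 0" using D0 S0 by (simp add: E)
  have DE: "D * E = S * S" using D0 by (simp add: E)
  have m: "dg (alb_moebius (-a) w) 1 = (dg w 1 + a) / E" "dg (alb_moebius (-a) w) 2 = (dg w 2 + cnj a * dg (sharp w) 3) / E"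
    "dg (alb_moebius (-a) w) 3 = (dg w 3 + cnj a * dg (sharp w) 2) / E"
    "od (alb_moebius (-a) w) 1 = (1 / E) *\<^sub>C (od w 1 - cnj a *\<^sub>C od (sharp w) 1)"
    "od (alb_moebius (-a) w) 2 = (S / E) *\<^sub>C od w 2" "od (alb_moebius (-a) w) 3 = (S / E) *\<^sub>C od w 3"
    using alb_moebius_coords[of "-a" w] by (simp_all add: E_def S_def)
  show ?thesis unfolding w_def[symmetric]
  proof (rule alb_eqI3)
    have "x - a * cnj a * x = D * E * x" for x by (simp add: DE S algebra_simps)
    then have r: "(x - a * cnj a * x) / (D * E) = x" for x using D0 E0 by (simp only:) simp
    have "(dg v 1 - a) / D + a = (dg v 1 - a + a * D) / D" using D0 by (simp add: field_simps)
    also have "dg v 1 - a + a * D = dg v 1 - a * cnj a * dg v 1" by (simp add: D_def algebra_simps)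
    finally show "dg (alb_moebius (-a) w) 1 = dg v 1"
      unfolding m c using r[of "dg v 1"] by simp
    show "dg (alb_moebius (-a) w) 2 = dg v 2"
      unfolding m c using D0 E0 r[of "dg v 2"] by (simp add: field_simps)
    show "dg (alb_moebius (-a) w) 3 = dg v 3"
      unfolding m c using D0 E0 r[of "dg v 3"] by (simp add: field_simps)
    have "od w 1 - cnj a *\<^sub>C od (sharp w) 1 = (1 / D) *\<^sub>C ((1 - a * cnj a) *\<^sub>C od v 1)"
      unfolding c by (rule oct_eqI) (simp add: oct_linear algebra_simps)
    then show "od (alb_moebius (-a) w) 1 = od v 1"
      unfolding m using D0 E0 DE S by (simp add: scaleC_scaleC S0 E)
    show "od (alb_moebius (-a) w) 2 = od v 2" "od (alb_moebius (-a) w) 3 = od v 3"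
      unfolding m c using D0 E0 DE S0 by (simp_all add: scaleC_scaleC E)
  qed
qed

section \<open>Holomorphic maps\<close>

lemma holomorphic_map_on_compose:
  assumes f: "holomorphic_map_on f S" and g: "holomorphic_map_on g T" and st: "f ` S \<subseteq> T"
  shows "holomorphic_map_on (\<lambda>x. g (f x)) S"
  unfolding holomorphic_map_on_def
proof
  fix p assume p: "p \<in> S"
  obtain f' where f': "clinear_on UNIV f'" "(f has_derivative f') (at p within S)"
    using f p unfolding holomorphic_map_on_def by blast
  have "f p \<in> T" using p st by blast
  then obtain g' where g': "clinear_on UNIV g'" "(g has_derivative g') (at (f p) within T)"
    using g unfolding holomorphic_map_on_def by blast
  have "((\<lambda>x. g (f x)) has_derivative (\<lambda>x. g' (f' x))) (at p within S)"
    by (rule has_derivative_in_compose[OF f'(2) has_derivative_subset[OF g'(2) st]])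
  moreover have "clinear_on UNIV (\<lambda>x. g' (f' x))" using f'(1) g'(1) by (simp add: clinear_on_def)
  ultimately show "\<exists>f'. clinear_on UNIV f' \<and> ((\<lambda>x. g (f x)) has_derivative f') (at p within S)" by blast
qed

lemma holomorphic_map_on_clinear:
  assumes "clinear_on UNIV f" "bounded_linear f" shows "holomorphic_map_on f S"
  unfolding holomorphic_map_on_def using assms bounded_linear_imp_has_derivative by blast

lemma holomorphic_map_on_cong:
  assumes "holomorphic_map_on f S" "\<And>x. x \<in> S \<Longrightarrow> g x = f x" shows "holomorphic_map_on g S"
  using assms unfolding holomorphic_map_on_def by (metis has_derivative_transform)

lemma holomorphic_map_on_imp_continuous_on: "holomorphic_map_on f S \<Longrightarrow> continuous_on S f"
  unfolding holomorphic_map_on_def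
  by (meson continuous_on_eq_continuous_within has_derivative_continuous)

lemma bounded_bilinear_scaleC: "bounded_bilinear (scaleC :: complex \<Rightarrow> 'a \<Rightarrow> 'a::complex_normed_vector)"
proof
  show "\<exists>K. \<forall>c (x::'a). norm (c *\<^sub>C x) \<le> norm c * norm x * K"
    by (rule exI[of _ 1]) (simp add: norm_scaleC)
qed (simp_all add: scaleC_add_left scaleC_add_right scaleC_scaleC scaleR_conv_of_real mult.commute flip: scaleC_of_real)

lemma clinear_on_scaleR: "clinear_on UNIV f \<Longrightarrow> f (r *\<^sub>R x) = r *\<^sub>R f x"
  by (simp add: clinear_on_def flip: scaleC_of_real)

lemma clinear_imp_linear: "clinear_on UNIV f \<Longrightarrow> linear f"
  by (rule linearI) (simp_all add: clinear_on_scaleR clinear_on_def)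

lemma clinear_imp_bounded_linear:
  fixes f :: "'a :: {complex_normed_vector, euclidean_space} \<Rightarrow> 'b :: complex_normed_vector"
  shows "clinear_on UNIV f \<Longrightarrow> bounded_linear f"
  by (rule linear_conv_bounded_linear[THEN iffD1, OF clinear_imp_linear])

lemma alb_group_clinear: "k \<in> alb_group \<Longrightarrow> clinear_on UNIV k"
  by (simp add: clinear_on_def alb_groupD del: split_paired_All)

lemma has_derivative_sharp: "(sharp has_derivative cross p) (at p)"
proof -
  have "((\<lambda>v. (1/2) *\<^sub>R cross v v) has_derivative (\<lambda>h. (1/2) *\<^sub>R (cross p h + cross h p))) (at p)"
    by (intro has_derivative_scaleR_right bounded_bilinear.FDERIV[OF bounded_bilinear_cross] has_derivative_ident)
  moreover have "(1/2) *\<^sub>R (cross p h + cross h p) = cross p h" for h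
    by (simp add: cross_commute[of h p] flip: scaleR_2)
  ultimately show ?thesis by (simp add: sharp_eq_cross[abs_def])
qed

text \<open>
  The numerator is an affine function of \<open>v\<close> and \<open>sharp v\<close>, and the derivative of \<open>sharp\<close> at \<open>p\<close> is the complex
  linear map \<open>cross p\<close>.
\<close>
lemma holomorphic_alb_moebius:
  assumes "\<And>v. v \<in> S \<Longrightarrow> 1 - cnj a * dg v 1 \<noteq> 0"
  shows "holomorphic_map_on (alb_moebius a) S"
  unfolding holomorphic_map_on_def
proof
  fix p assume p: "p \<in> S"
  define s where "s = complex_of_real (sqrt (1 - (cmod a)\<^sup>2))"
  define L where "L v = alb_mk (dg v) (\<lambda>i. if i = 1 then od v 1 else s *\<^sub>C od v i)" for v
  define Q where "Q y = alb_mk (\<lambda>i. if i = 1 then 0 else if i = 2 then - cnj a * dg y 3 else - cnj a * dg y 2)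
      (\<lambda>i. if i = 1 then cnj a *\<^sub>C od y 1 else 0)" for y
  define P where "P v = L v + Q (sharp v) - a *\<^sub>C alb_unit 1" for v
  define d where "d v = 1 - cnj a * dg v 1" for v
  have m: "alb_moebius a = (\<lambda>v. (1 / d v) *\<^sub>C P v)"
  proof
    fix v show "alb_moebius a v = (1 / d v) *\<^sub>C P v"
      unfolding alb_moebius_def Let_def P_def L_def Q_def d_def s_def
      by (rule arg_cong[where f = "scaleC _"], rule alb_eqI3) simp_all
  qed
  have cL: "clinear_on UNIV L" and cQ: "clinear_on UNIV Q"
    unfolding clinear_on_def L_def Q_def
    by (intro conjI ballI allI; rule alb_eqI3; simp add: scaleC_add_right scaleC_scaleC algebra_simps)+
  have cC: "clinear_on UNIV (cross p)"
    by (simp add: clinear_on_def cross_add_right cross_scaleC_right)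
  have dP: "(P has_derivative (\<lambda>h. L h + Q (cross p h))) (at p)"
  proof -
    have "((\<lambda>v. L v + Q (sharp v) - a *\<^sub>C alb_unit 1) has_derivative (\<lambda>h. L h + Q (cross p h) - 0)) (at p)"
      by (intro has_derivative_diff has_derivative_add has_derivative_const
          bounded_linear_imp_has_derivative[OF clinear_imp_bounded_linear[OF cL]]
          bounded_linear.has_derivative[OF clinear_imp_bounded_linear[OF cQ]] has_derivative_sharp)
    then show ?thesis by (simp add: P_def[abs_def])
  qed
  have dp: "d p \<noteq> 0" using assms[OF p] by (simp add: d_def)
  have dd: "((\<lambda>v. 1 / d v) has_derivative (\<lambda>h. cnj a * dg h 1 / (d p * d p))) (at p)"
  proof -
    have "(d has_derivative (\<lambda>h. 0 - cnj a * dg h 1)) (at p)"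
      unfolding d_def[abs_def]
      by (intro has_derivative_diff has_derivative_const has_derivative_mult_right
          bounded_linear_imp_has_derivative bounded_linear_dg)
    from has_derivative_divide'[OF has_derivative_const[of 1] this dp] show ?thesis by simp
  qed
  define T where "T h = (1 / d p) *\<^sub>C (L h + Q (cross p h)) + (cnj a * dg h 1 / (d p * d p)) *\<^sub>C P p" for h
  have "(alb_moebius a has_derivative T) (at p)"
    unfolding m T_def[abs_def] by (rule bounded_bilinear.FDERIV[OF bounded_bilinear_scaleC dd dP])
  moreover have "clinear_on UNIV T"
    using cL cQ cC unfolding clinear_on_def T_def
    by (simp add: scaleC_add_left scaleC_add_right scaleC_scaleC distrib_left add_divide_distrib algebra_simps del: split_paired_All)
  ultimately show "\<exists>f'. clinear_on UNIV f' \<and> (alb_moebius a has_derivative f') (at p within S)"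
    using has_derivative_at_withinI by blast
qed

section \<open>Homogeneity\<close>

text \<open>
  Biholomorphic self-maps of the domain, each given together with its inverse.
\<close>
definition alb_auto :: "(alb \<Rightarrow> alb) \<Rightarrow> (alb \<Rightarrow> alb) \<Rightarrow> bool" where
  "alb_auto \<phi> \<psi> \<longleftrightarrow> holomorphic_map_on \<phi> alb_dom \<and> holomorphic_map_on \<psi> alb_dom \<and>
     (\<forall>v\<in>alb_dom. \<phi> v \<in> alb_dom \<and> \<psi> v \<in> alb_dom \<and> \<psi> (\<phi> v) = v \<and> \<phi> (\<psi> v) = v)"

lemma alb_auto_compose:
  assumes "alb_auto \<phi> \<psi>" "alb_auto \<phi>' \<psi>'"
  shows "alb_auto (\<lambda>v. \<phi>' (\<phi> v)) (\<lambda>v. \<psi> (\<psi>' v))"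
  using assms holomorphic_map_on_compose[of \<phi> alb_dom \<phi>' alb_dom] holomorphic_map_on_compose[of \<psi>' alb_dom \<psi> alb_dom]
  unfolding alb_auto_def by (simp add: image_subset_iff)

lemma alb_auto_group:
  assumes "k \<in> alb_group" shows "alb_auto k (inv k)"
proof -
  have h: "holomorphic_map_on l alb_dom" if "l \<in> alb_group" for l
    by (intro holomorphic_map_on_clinear alb_group_clinear alb_group_bounded_linear that)
  have "k (inv k v) = v" "inv k (k v) = v" for v
    using alb_group_bij[OF assms] by (simp_all add: bij_is_inj bij_is_surj surj_f_inv_f)
  then show ?thesis
    unfolding alb_auto_def using h assms alb_group_inv alb_dom_group by metis
qed

lemma alb_moebius_denominator:
  assumes "cmod a < 1" "v \<in> alb_dom" shows "1 - cnj a * dg v 1 \<noteq> 0"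
proof
  assume "1 - cnj a * dg v 1 = 0"
  then have "cmod a * cmod (dg v 1) = 1" by (metis complex_mod_cnj eq_iff_diff_eq_0 norm_mult norm_one)
  moreover have "cmod a * cmod (dg v 1) < 1 * 1"
    using assms alb_dom_dg_less_1 by (intro mult_strict_mono') auto
  ultimately show False by simp
qed

lemma alb_moebius_diag:
  assumes "cmod (b 1) < 1"
  shows "alb_moebius (b 1) (alb_diag b) = alb_diag (\<lambda>i. if i = 1 then 0 else b i)"
proof -
  have "1 - cnj (b 1) * b 1 \<noteq> 0"
  proof
    assume "1 - cnj (b 1) * b 1 = 0"
    then have "cmod (b 1) * cmod (b 1) = 1" by (metis complex_mod_cnj eq_iff_diff_eq_0 norm_mult norm_one)
    moreover have "cmod (b 1) * cmod (b 1) < 1 * 1" using assms by (intro mult_strict_mono') auto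
    ultimately show False by simp
  qed
  then show ?thesis
    by (intro alb_eqI3) (simp_all add: alb_moebius_coords field_simps)
qed

text \<open>
  The image of the domain is connected, meets the domain, and lies in the set where \<open>alb_delta\<close> is
  positive, of which the domain is a relatively open and closed part.
\<close>
lemma alb_moebius_dom:
  assumes a: "cmod a < 1" and v: "v \<in> alb_dom" shows "alb_moebius a v \<in> alb_dom"
proof -
  let ?C = "alb_moebius a ` alb_dom"
  have "connected ?C"
    by (intro connected_continuous_image connected_alb_dom holomorphic_map_on_imp_continuous_on
        holomorphic_alb_moebius alb_moebius_denominator[OF a])
  have a2: "0 < 1 - (cmod a)\<^sup>2" using a by (simp add: abs_square_less_1)
  have pos: "0 < alb_delta w" if "w \<in> ?C" for w
  proof -
    from that obtain u where u: "u \<in> alb_dom" "w = alb_moebius a u" by blast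
    have "0 < (1 - (cmod a)\<^sup>2) * alb_delta u" using a2 u by (simp add: alb_dom_def)
    then have "0 < (cmod (1 - cnj a * dg u 1))\<^sup>2 * alb_delta w"
      using alb_delta_moebius[OF a alb_moebius_denominator[OF a u(1)]] u(2) by simp
    then show ?thesis by (simp add: zero_less_mult_iff)
  qed
  have zero: "alb_moebius a 0 \<in> alb_dom"
  proof -
    have "alb_moebius a 0 = alb_diag (\<lambda>i. if i = 1 then - a else 0)"
      by (rule alb_eqI3) (simp_all add: alb_moebius_coords)
    from alb_dom_diag[OF alb_group_id this] show ?thesis using a by simp
  qed
  have "alb_dom \<inter> ?C = {} \<or> - closure alb_dom \<inter> ?C = {}"
  proof (rule connectedD[OF \<open>connected ?C\<close> open_alb_dom])
    show "open (- closure alb_dom)" by (rule open_Compl[OF closed_closure])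
    show "alb_dom \<inter> - closure alb_dom \<inter> ?C = {}" using closure_subset by blast
    show "?C \<subseteq> alb_dom \<union> - closure alb_dom" using pos alb_dom_closure by blast
  qed
  moreover have "alb_dom \<inter> ?C \<noteq> {}" using zero zero_alb_dom by blast
  ultimately have "alb_moebius a v \<in> closure alb_dom" using v by blast
  then show ?thesis using alb_dom_closure pos v by blast
qed

lemma alb_auto_moebius:
  assumes "cmod a < 1" shows "alb_auto (alb_moebius a) (alb_moebius (- a))"
proof -
  have a': "cmod (- a) < 1" using assms by simp
  have h: "holomorphic_map_on (alb_moebius a) alb_dom" if "cmod a < 1" for a
    by (rule holomorphic_alb_moebius[OF alb_moebius_denominator[OF that]])
  show ?thesis
    unfolding alb_auto_def
    using h[OF assms] h[OF a'] alb_moebius_dom[OF assms] alb_moebius_dom[OF a']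
      alb_moebius_inverse[OF assms alb_moebius_denominator[OF assms]]
      alb_moebius_inverse[OF a' alb_moebius_denominator[OF a']] by simp
qed

text \<open>
  After diagonalization, a transvection clears the first diagonal entry and leaves the other two; three
  rounds of this, with a cyclic shift after each, reach 0.
\<close>
lemma alb_dom_homogeneous:
  assumes "p \<in> alb_dom" obtains \<phi> \<psi> where "alb_auto \<phi> \<psi>" "\<phi> p = 0"
proof -
  define tr where "tr u v \<longleftrightarrow> (\<exists>\<phi> \<psi>. alb_auto \<phi> \<psi> \<and> \<phi> u = v)" for u v
  have trans: "tr u w" if "tr u v" "tr v w" for u v w
    using that alb_auto_compose unfolding tr_def by blast
  obtain k b where kb: "k \<in> alb_group" "k p = alb_diag b" by (rule alb_diagonalize)
  have b: "cmod (b i) < 1" for i using assms alb_dom_diag[OF kb] by blast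
  have step: "tr (alb_diag b) (alb_diag (\<lambda>i. if i = 3 then 0 else b (i + 1)))" if "cmod (b 1) < 1" for b
  proof (rule trans)
    show "tr (alb_diag b) (alb_diag (\<lambda>i. if i = 1 then 0 else b i))"
      unfolding tr_def using alb_auto_moebius[OF that] alb_moebius_diag[of b, OF that] by blast
    have "alb_cyc (alb_diag (\<lambda>i. if i = 1 then 0 else b i)) = alb_diag (\<lambda>i. if i = 3 then 0 else b (i + 1))"
      by (rule alb_eqI3) simp_all
    then show "tr (alb_diag (\<lambda>i. if i = 1 then 0 else b i)) (alb_diag (\<lambda>i. if i = 3 then 0 else b (i + 1)))"
      unfolding tr_def using alb_auto_group[OF alb_cyc_group] by blast
  qed
  \<comment> \<open>the effect of one round on the diagonal: the cleared first entry arrives in the third place\<close>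
  define c where "c b i = (if i = 3 then 0 else b (i + 1))" for b :: "3 \<Rightarrow> complex" and i :: 3
  have step': "tr (alb_diag b) (alb_diag (c b))" if "cmod (b 1) < 1" for b
    using step[of b, OF that] by (simp add: c_def[abs_def])
  have "tr p (alb_diag b)" unfolding tr_def using alb_auto_group[OF kb(1)] kb(2) by blast
  moreover have "tr (alb_diag b) (alb_diag (c b))" by (rule step'[OF b])
  moreover have "tr (alb_diag (c b)) (alb_diag (c (c b)))" by (rule step') (simp add: c_def b)
  moreover have "tr (alb_diag (c (c b))) (alb_diag (c (c (c b))))" by (rule step') (simp add: c_def b)
  moreover have "alb_diag (c (c (c b))) = 0" by (rule alb_eqI3) (simp_all add: c_def)
  ultimately have "tr p 0" using trans by metis
  then show ?thesis using that unfolding tr_def by blast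
qed

section \<open>Orthonormal bases and unitary maps\<close>

definition herm_form :: "('a::complex_normed_vector \<Rightarrow> 'a \<Rightarrow> complex) \<Rightarrow> bool" where
  "herm_form f \<longleftrightarrow> (\<forall>x y z. f (x + y) z = f x z + f y z) \<and> (\<forall>c x y. f (c *\<^sub>C x) y = c * f x y) \<and>
     (\<forall>x y. f x y = cnj (f y x)) \<and> (\<forall>x. x \<noteq> 0 \<longrightarrow> 0 < Re (f x x))"

definition orthonormal_family :: "('a \<Rightarrow> 'a \<Rightarrow> complex) \<Rightarrow> ('i \<Rightarrow> 'a) \<Rightarrow> 'i set \<Rightarrow> bool" where
  "orthonormal_family f e T \<longleftrightarrow> finite T \<and> (\<forall>b\<in>T. \<forall>c\<in>T. f (e b) (e c) = (if b = c then 1 else 0))"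

context
  fixes f :: "'a::complex_normed_vector \<Rightarrow> 'a \<Rightarrow> complex"
  assumes f: "herm_form f"
begin

lemma hf_left: "f (x + y) z = f x z + f y z" "f (c *\<^sub>C x) y = c * f x y"
  and hf_commute: "f x y = cnj (f y x)" and hf_pos: "x \<noteq> 0 \<Longrightarrow> 0 < Re (f x x)"
  using f unfolding herm_form_def by blast+

lemma hf_right: "f z (x + y) = f z x + f z y" "f y (c *\<^sub>C x) = cnj c * f y x"
proof -
  show "f z (x + y) = f z x + f z y"
    using hf_commute[of z "x + y"] hf_commute[of z x] hf_commute[of z y] by (simp add: hf_left)
  show "f y (c *\<^sub>C x) = cnj c * f y x"
    using hf_commute[of y "c *\<^sub>C x"] hf_commute[of y x] by (simp add: hf_left)
qed

lemma hf_zero [simp]: "f 0 x = 0" "f x 0 = 0"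
  using hf_left(2)[of 0 0 x] hf_right(2)[of x 0 0] by simp_all

lemma hf_sum_left: "f (\<Sum>b\<in>T. g b) y = (\<Sum>b\<in>T. f (g b) y)"
  by (induction T rule: infinite_finite_induct) (simp_all add: hf_left)

lemma hf_sum_right: "f y (\<Sum>b\<in>T. g b) = (\<Sum>b\<in>T. f y (g b))"
  by (induction T rule: infinite_finite_induct) (simp_all add: hf_right)

lemma hf_self_real: "f x x = of_real (Re (f x x))"
  using hf_commute[of x x] by (simp add: complex_eq_iff)

lemma orthonormal_coeff:
  assumes "orthonormal_family f e T" "b \<in> T" shows "f (\<Sum>c\<in>T. u c *\<^sub>C e c) (e b) = u b"
proof -
  have "f (\<Sum>c\<in>T. u c *\<^sub>C e c) (e b) = (\<Sum>c\<in>T. if c = b then u c else 0)"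
    unfolding hf_sum_left hf_left using assms by (intro sum.cong) (auto simp: orthonormal_family_def)
  then show ?thesis using assms by (simp add: orthonormal_family_def)
qed

lemma orthonormal_square:
  assumes "orthonormal_family f e T"
  shows "f (\<Sum>c\<in>T. u c *\<^sub>C e c) (\<Sum>c\<in>T. u c *\<^sub>C e c) = (\<Sum>c\<in>T. u c * cnj (u c))"
proof -
  have "f (\<Sum>c\<in>T. u c *\<^sub>C e c) (\<Sum>c\<in>T. u c *\<^sub>C e c) = (\<Sum>b\<in>T. cnj (u b) * f (\<Sum>c\<in>T. u c *\<^sub>C e c) (e b))"
    unfolding hf_sum_right hf_right ..
  also have "\<dots> = (\<Sum>c\<in>T. u c * cnj (u c))"
    by (intro sum.cong) (simp_all add: orthonormal_coeff[OF assms])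
  finally show ?thesis .
qed

lemma orthonormal_independent:
  assumes "orthonormal_family f (\<lambda>b. b) T" shows "cvec.independent T"
proof
  assume "cvec.dependent T"
  moreover have fin: "finite T" using assms by (simp add: orthonormal_family_def)
  ultimately obtain u v where "v \<in> T" "u v \<noteq> 0" "(\<Sum>v\<in>T. u v *\<^sub>C v) = 0"
    unfolding cvec.dependent_finite[OF fin] by blast
  then show False using orthonormal_coeff[OF assms, of v u] by simp
qed

text \<open>
  An orthonormal set of maximal cardinality exists because orthonormal sets are independent. If some \<open>v\<close>
  differed from its expansion, the normalized difference could be added to the set.
\<close>
lemma orthonormal_basis_exists:
  assumes B: "finite (B :: 'a set)" "cvec.span B = UNIV"
  obtains T where "orthonormal_family f (\<lambda>b. b) T" "\<And>v. v = (\<Sum>b\<in>T. f v b *\<^sub>C b)" "cvec.span T = UNIV"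
proof -
  let ?P = "\<lambda>T. orthonormal_family f (\<lambda>b. b) T"
  have bound: "card T \<le> card B" if "?P T" for T
    using cvec.independent_span_bound[OF B(1) orthonormal_independent[OF that]] B(2) by simp
  have "?P {}" by (simp add: orthonormal_family_def)
  then obtain T where T: "?P T" and mx: "\<And>S. ?P S \<Longrightarrow> card S \<le> card T"
    using ex_has_greatest_nat[of ?P "{}" card "Suc (card B)"] bound less_Suc_eq_le by metis
  have fin: "finite T" using T by (simp add: orthonormal_family_def)
  have rep: "v = (\<Sum>b\<in>T. f v b *\<^sub>C b)" for v
  proof (rule ccontr)
    define w where "w = v - (\<Sum>b\<in>T. f v b *\<^sub>C b)"
    assume "v \<noteq> (\<Sum>b\<in>T. f v b *\<^sub>C b)"
    then have "w \<noteq> 0" by (simp add: w_def)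
    then have w: "0 < Re (f w w)" by (rule hf_pos)
    have orth: "f w b = 0" if "b \<in> T" for b
      using hf_left(1)[of w "\<Sum>b\<in>T. f v b *\<^sub>C b" b] orthonormal_coeff[OF T that, of "f v"] by (simp add: w_def)
    have orth': "f b w = 0" if "b \<in> T" for b using hf_commute[of b w] orth[OF that] by simp
    define r where "r = complex_of_real (1 / sqrt (Re (f w w)))"
    define e where "e = r *\<^sub>C w"
    have "f e e = r * cnj r * f w w" by (simp add: e_def hf_left hf_right)
    also have "\<dots> = 1"
      using w by (subst hf_self_real) (simp add: r_def flip: of_real_mult)
    finally have ee: "f e e = 1" .
    have eb: "f e b = 0" "f b e = 0" if "b \<in> T" for b
      using orth[OF that] orth'[OF that] by (simp_all add: e_def hf_left hf_right)
    have "e \<notin> T" using eb(1)[of e] ee by auto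
    have "?P (insert e T)"
      using T ee eb \<open>e \<notin> T\<close> by (auto simp: orthonormal_family_def)
    from mx[OF this] show False using \<open>e \<notin> T\<close> fin by simp
  qed
  have "v \<in> cvec.span T" for v
    by (subst rep) (intro cvec.span_sum cvec.span_scale cvec.span_base)
  then show ?thesis using that T rep by blast
qed

end

lemma herm_form_herm: "herm_form herm"
proof -
  have "0 < Re (herm x x)" if "x \<noteq> 0" for x
    using that hsq_nonneg[of x] by (simp add: herm_self less_le)
  then show ?thesis
    unfolding herm_form_def using herm_add_left herm_scaleC_left herm_commute by blast
qed

lemma alb_finite_span: obtains B :: "alb set" where "finite B" "cvec.span B = UNIV"
proof -
  have "v \<in> cvec.span (Basis :: alb set)" for v
  proof -
    have "(\<Sum>b\<in>Basis. of_real (v \<bullet> b) *\<^sub>C b) \<in> cvec.span (Basis :: alb set)"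
      by (intro cvec.span_sum cvec.span_scale cvec.span_base)
    then show ?thesis by (simp add: scaleC_of_real euclidean_representation)
  qed
  then have "cvec.span (Basis :: alb set) = UNIV" by blast
  then show ?thesis by (rule that[OF finite_Basis])
qed

text \<open>
  Pulling back the inner product along \<open>A\<close> gives a second Hermitian form on the same space. Matching
  orthonormal bases of the two forms, which have equal cardinality, corrects \<open>A\<close> to an isometry.
\<close>
lemma unitary_exists:
  fixes A :: "alb \<Rightarrow> 'h::complex_hilbert_space"
  assumes A: "clinear_on UNIV A" "bij A"
  obtains M :: "alb \<Rightarrow> 'h" where "clinear_on UNIV M" "bij M" "\<And>v. (norm (M v))\<^sup>2 = hsq v"
proof -
  have Aadd: "A (u + v) = A u + A v" and Asc: "A (c *\<^sub>C u) = c *\<^sub>C A u" for u v c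
    using A(1) by (simp_all add: clinear_on_def del: split_paired_All)
  define g where "g u v = cinner (A u) (A v)" for u v
  have pos: "0 < Re (cinner x x)" if "x \<noteq> 0" for x :: 'h
    using that norm_eq_sqrt_cinner[of x] by (metis not_less real_sqrt_le_0_iff norm_le_zero_iff)
  have g: "herm_form g"
    unfolding herm_form_def
  proof (intro conjI allI impI)
    fix x y z :: alb and c
    show "g (x + y) z = g x z + g y z" by (simp add: g_def Aadd cinner_add_left)
    show "g (c *\<^sub>C x) y = c * g x y" by (simp add: g_def Asc cinner_scaleC_left)
    show "g x y = cnj (g y x)" unfolding g_def by (rule cinner_commute)
    assume "x \<noteq> 0"
    then have "A x \<noteq> 0" using Asc[of 0 0] injD[OF bij_is_inj[OF A(2)], of x 0] by auto
    then show "0 < Re (g x x)" unfolding g_def by (rule pos)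
  qed
  obtain B :: "alb set" where B: "finite B" "cvec.span B = UNIV" by (rule alb_finite_span)
  obtain T1 where T1: "orthonormal_family herm (\<lambda>b. b) T1" "\<And>v. v = (\<Sum>b\<in>T1. herm v b *\<^sub>C b)" "cvec.span T1 = UNIV"
    using orthonormal_basis_exists[OF herm_form_herm B] by blast
  obtain T2 where T2: "orthonormal_family g (\<lambda>b. b) T2" "\<And>v. v = (\<Sum>b\<in>T2. g v b *\<^sub>C b)" "cvec.span T2 = UNIV"
    using orthonormal_basis_exists[OF g B] by blast
  have fin: "finite T1" "finite T2" using T1(1) T2(1) by (simp_all add: orthonormal_family_def)
  have "card T1 = card T2"
    using cvec.independent_span_bound[OF fin(2) orthonormal_independent[OF herm_form_herm T1(1)]]
      cvec.independent_span_bound[OF fin(1) orthonormal_independent[OF g T2(1)]] T1(3) T2(3) by simp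
  then obtain \<sigma> where \<sigma>: "bij_betw \<sigma> T1 T2" using finite_same_card_bij[OF fin] by blast
  define J where "J v = (\<Sum>b\<in>T1. herm v b *\<^sub>C \<sigma> b)" for v
  have fam: "orthonormal_family g \<sigma> T1"
    unfolding orthonormal_family_def
  proof (intro conjI ballI)
    fix b c assume bc: "b \<in> T1" "c \<in> T1"
    then have "\<sigma> b \<in> T2" "\<sigma> c \<in> T2" "\<sigma> b = \<sigma> c \<longleftrightarrow> b = c"
      using \<sigma> by (auto simp: bij_betw_def inj_on_eq_iff simp del: split_paired_All)
    then show "g (\<sigma> b) (\<sigma> c) = (if b = c then 1 else 0)"
      using T2(1) unfolding orthonormal_family_def by metis
  qed (rule fin)
  have "g (J v) (J v) = herm v v" for v
    using orthonormal_square[OF g fam, of "herm v"] orthonormal_square[OF herm_form_herm T1(1), of "herm v"]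
    by (simp add: J_def T1(2)[of v, symmetric])
  then have nJ: "(norm (A (J v)))\<^sup>2 = hsq v" for v
    unfolding norm_eq_sqrt_cinner g_def by (simp add: herm_self)
  have cJ: "clinear_on UNIV J"
    by (simp add: clinear_on_def J_def herm_add_left herm_scaleC_left scaleC_add_left sum.distrib cvec.scale_sum_right scaleC_scaleC)
  have "inj J"
  proof (rule injI)
    fix u v assume "J u = J v"
    then have "J (u - v) = 0" using cJ unfolding clinear_on_def by (metis UNIV_I add_diff_cancel_right' diff_add_cancel eq_iff_diff_eq_0)
    then have "hsq (u - v) = 0" using nJ[of "u - v"] Asc[of 0 0] by simp
    then show "u = v" by simp
  qed
  then have "bij J" using linear_injective_imp_surjective[OF clinear_imp_linear[OF cJ]] by (simp add: bij_def)
  show ?thesis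
  proof (rule that[of "\<lambda>v. A (J v)"])
    show "clinear_on UNIV (\<lambda>v. A (J v))"
      using A(1) cJ unfolding clinear_on_def by (simp del: split_paired_All)
    show "bij (\<lambda>v. A (J v))" using bij_comp[OF \<open>bij J\<close> A(2)] by (simp add: comp_def)
  qed (rule nJ)
qed

section \<open>The lower bound\<close>

lemma clinear_alb_mat: "clinear_on UNIV alb_mat"
  by (simp add: clinear_on_def alb_mat_add alb_mat_scaleC del: split_paired_All)

lemma clinear_alb_of: "clinear_on UNIV alb_of"
  by (simp add: clinear_on_def alb_of_add alb_of_scaleC)

lemmas holomorphic_alb_mat = holomorphic_map_on_clinear[OF clinear_alb_mat clinear_imp_bounded_linear[OF clinear_alb_mat]]
lemmas holomorphic_alb_of = holomorphic_map_on_clinear[OF clinear_alb_of clinear_imp_bounded_linear[OF clinear_alb_of]]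

lemma clinear_scaleC_compose:
  assumes "clinear_on UNIV f" shows "clinear_on UNIV (\<lambda>x. c *\<^sub>C f x)" "clinear_on UNIV (\<lambda>x. f (c *\<^sub>C x))"
  using assms unfolding clinear_on_def by (simp_all add: scaleC_add_right scaleC_scaleC mult.commute del: split_paired_All)

lemma clinear_inv:
  assumes "clinear_on UNIV f" "bij f" shows "clinear_on UNIV (inv f)"
proof -
  have 1: "f (inv f y) = y" for y using assms(2) by (simp add: bij_is_surj surj_f_inv_f)
  have i: "f x = f y \<longleftrightarrow> x = y" for x y using assms(2) by (simp add: bij_is_inj inj_eq)
  have "f (inv f (x + y)) = f (inv f x + inv f y)" "f (inv f (c *\<^sub>C x)) = f (c *\<^sub>C inv f x)" for x y c
    using assms(1) 1 unfolding clinear_on_def by simp_all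
  then show ?thesis unfolding i clinear_on_def by simp
qed

text \<open>
  The embedding is an automorphism of the domain moving \<open>p\<close> to 0, followed by the unitary map scaled by
  \<open>1 / \<surd>3\<close>.
\<close>
lemma D27_embedding:
  fixes M :: "alb \<Rightarrow> 'h::complex_hilbert_space"
  assumes M: "clinear_on UNIV M" "bij M" "\<And>v. (norm (M v))\<^sup>2 = hsq v" and p: "p \<in> D27"
  obtains f :: "coct_mat \<Rightarrow> 'h" where "f \<in> hol_embeddings D27" "f p = 0" "ball 0 (1 / sqrt 3) \<subseteq> f ` D27"
proof -
  define F where "F v = complex_of_real (1 / sqrt 3) *\<^sub>C M v" for v
  define F' where "F' y = inv M (complex_of_real (sqrt 3) *\<^sub>C y)" for y
  have c: "complex_of_real (1 / sqrt 3) * complex_of_real (sqrt 3) = 1"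
    by (simp flip: of_real_mult)
  have iM: "M (inv M y) = y" "inv M (M v) = v" for y v
    using M(2) by (simp_all add: bij_is_inj bij_is_surj surj_f_inv_f)
  have FF': "F (F' y) = y" for y by (simp add: F_def F'_def iM scaleC_scaleC c)
  have F'F: "F' (F v) = v" for v using c by (simp add: F_def F'_def iM scaleC_scaleC mult.commute)
  have nF: "(norm (F v))\<^sup>2 = hsq v / 3" for v
    by (simp add: F_def norm_scaleC norm_divide power_mult_distrib power_divide M(3))
  have cF: "clinear_on UNIV F" unfolding F_def by (rule clinear_scaleC_compose[OF M(1)])
  have cF': "clinear_on UNIV F'" unfolding F'_def by (rule clinear_scaleC_compose[OF clinear_inv[OF M(1,2)]])
  have bF: "bounded_linear F" by (rule clinear_imp_bounded_linear[OF cF])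
  have bF': "bounded_linear F'"
  proof (rule bounded_linear_intro)
    show "F' (x + y) = F' x + F' y" for x y using cF' by (simp add: clinear_on_def)
    show "F' (r *\<^sub>R x) = r *\<^sub>R F' x" for r x by (rule clinear_on_scaleR[OF cF'])
    fix y
    have "(norm (F' y))\<^sup>2 \<le> (norm y * sqrt 3)\<^sup>2"
      using norm_le_hsq[of "F' y"] nF[of "F' y"] by (simp add: FF' power_mult_distrib)
    then show "norm (F' y) \<le> norm y * sqrt 3" by (rule power2_le_imp_le) simp
  qed
  obtain q where q: "p = alb_mat q" "q \<in> alb_dom" using p by (auto simp: D27_eq)
  obtain \<phi> \<psi> where auto: "alb_auto \<phi> \<psi>" "\<phi> q = 0" by (rule alb_dom_homogeneous[OF q(2)])
  have h: "holomorphic_map_on \<phi> alb_dom" "holomorphic_map_on \<psi> alb_dom"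
    and \<phi>: "\<And>v. v \<in> alb_dom \<Longrightarrow> \<phi> v \<in> alb_dom \<and> \<psi> v \<in> alb_dom \<and> \<psi> (\<phi> v) = v \<and> \<phi> (\<psi> v) = v"
    using auto(1) unfolding alb_auto_def by blast+
  define f where "f z = F (\<phi> (alb_of z))" for z
  have fm: "f (alb_mat v) = F (\<phi> v)" for v by (simp add: f_def)
  have img: "f ` D27 = F ` alb_dom"
  proof -
    have "\<phi> ` alb_dom = alb_dom" using \<phi> by (metis (no_types, lifting) image_subsetI imageI subsetI subset_antisym)
    then show ?thesis unfolding D27_eq image_image fm by (simp flip: image_image)
  qed
  have img': "F ` alb_dom = F' -` alb_dom" using FF' F'F by (auto simp: image_iff) metis
  have "f \<in> hol_embeddings D27"
    unfolding hol_embeddings_def mem_Collect_eq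
  proof (intro conjI)
    have of_D: "alb_of ` D27 \<subseteq> alb_dom" by (auto simp: D27_eq)
    have "holomorphic_map_on (\<lambda>z. \<phi> (alb_of z)) D27"
      by (rule holomorphic_map_on_compose[OF holomorphic_alb_of h(1) of_D])
    from holomorphic_map_on_compose[OF this holomorphic_map_on_clinear[OF cF bF, of UNIV] subset_UNIV]
    show "holomorphic_map_on f D27" by (simp add: f_def[abs_def])
    show inj: "inj_on f D27"
    proof (rule inj_onI)
      fix x y assume xy: "x \<in> D27" "y \<in> D27" "f x = f y"
      then obtain u v where uv: "u \<in> alb_dom" "v \<in> alb_dom" "x = alb_mat u" "y = alb_mat v" by (auto simp: D27_eq)
      then have "\<phi> u = \<phi> v" using xy(3) F'F by (metis fm)
      then show "x = y" using \<phi> uv by metis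
    qed
    show "f ` D27 \<subseteq> ball 0 1"
    proof -
      have "norm (F v) < 1" if "v \<in> alb_dom" for v
      proof -
        have "(norm (F v))\<^sup>2 < 1\<^sup>2" using nF[of v] alb_dom_hsq_less[OF that] by simp
        then show ?thesis by (rule power2_less_imp_less) simp
      qed
      then show ?thesis unfolding img by auto
    qed
    show "open (f ` D27)"
      unfolding img img' by (rule open_vimage[OF open_alb_dom linear_continuous_on[OF bF']])
    show "connected (f ` D27)"
      unfolding img by (rule connected_continuous_image[OF linear_continuous_on[OF bF] connected_alb_dom])
    have "holomorphic_map_on (\<lambda>y. \<psi> (F' y)) (f ` D27)"
      by (rule holomorphic_map_on_compose[OF holomorphic_map_on_clinear[OF cF' bF'] h(2)]) (auto simp: img img')
    from holomorphic_map_on_compose[OF this holomorphic_alb_mat[of UNIV] subset_UNIV]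
    have "holomorphic_map_on (\<lambda>y. alb_mat (\<psi> (F' y))) (f ` D27)" .
    then show "holomorphic_map_on (inv_into D27 f) (f ` D27)"
    proof (rule holomorphic_map_on_cong)
      fix y assume "y \<in> f ` D27"
      then have y: "F' y \<in> alb_dom" by (simp add: img img')
      then have "alb_mat (\<psi> (F' y)) \<in> D27" "f (alb_mat (\<psi> (F' y))) = y"
        using \<phi>[OF y] by (simp_all add: D27_eq fm FF')
      then show "inv_into D27 f y = alb_mat (\<psi> (F' y))" using inv_into_f_f[OF inj] by metis
    qed
  qed
  moreover have "f p = 0"
    using cF auto(2) q(1) clinear_on_scaleR[OF cF, of 0 0] by (simp add: fm)
  moreover have "ball 0 (1 / sqrt 3) \<subseteq> f ` D27"
  proof
    fix y :: 'h assume "y \<in> ball 0 (1 / sqrt 3)"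
    then have "(norm y)\<^sup>2 < (1 / sqrt 3)\<^sup>2" by (intro power_strict_mono) auto
    then have "hsq (F' y) < 1" using nF[of "F' y"] by (simp add: FF' power_divide)
    then show "y \<in> f ` D27" unfolding img img' by (simp add: hsq_less_1_alb_dom)
  qed
  ultimately show ?thesis by (rule that)
qed

section \<open>The upper bound\<close>

lemma holomorphic_map_on_complex:
  fixes f :: "complex \<Rightarrow> complex"
  assumes "holomorphic_map_on f S" shows "f holomorphic_on S"
  unfolding holomorphic_on_def field_differentiable_def
proof
  fix x assume "x \<in> S"
  then obtain f' where f': "clinear_on UNIV f'" "(f has_derivative f') (at x within S)"
    using assms unfolding holomorphic_map_on_def by blast
  have "f' h = f' 1 * h" for h
    using f'(1) unfolding clinear_on_def scaleC_complex_def by (metis UNIV_I mult.commute mult.right_neutral)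
  then have "f' = (*) (f' 1)" by blast
  then show "\<exists>f'. (f has_field_derivative f') (at x within S)"
    using f'(2) unfolding has_field_derivative_def by metis
qed

text \<open>
  The one-variable Schwarz lemma on the disc \<open>t \<mapsto> t *\<^sub>C u\<close>.
\<close>
lemma schwarz_directional:
  fixes G :: "'a::complex_normed_vector \<Rightarrow> complex"
  assumes G: "holomorphic_map_on G S" "G 0 = 0" "\<And>x. x \<in> S \<Longrightarrow> cmod (G x) < 1"
    and u: "\<And>t. cmod t < 1 \<Longrightarrow> t *\<^sub>C u \<in> S"
    and G1: "(G has_derivative G1) (at 0)" "clinear_on UNIV G1"
  shows "cmod (G1 u) \<le> 1"
proof -
  have lin: "bounded_linear (\<lambda>t. t *\<^sub>C u)"
    by (rule bounded_bilinear.bounded_linear_left[OF bounded_bilinear_scaleC])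
  have clin: "clinear_on UNIV (\<lambda>t. t *\<^sub>C u)"
    by (simp add: clinear_on_def scaleC_add_left scaleC_scaleC scaleC_complex_def)
  have "holomorphic_map_on (\<lambda>t. G (t *\<^sub>C u)) (ball 0 1)"
    by (rule holomorphic_map_on_compose[OF holomorphic_map_on_clinear[OF clin lin] G(1)]) (auto simp: u)
  then have hol: "(\<lambda>t. G (t *\<^sub>C u)) holomorphic_on ball 0 1" by (rule holomorphic_map_on_complex)
  have "((\<lambda>t. G (t *\<^sub>C u)) has_derivative (\<lambda>t. G1 (t *\<^sub>C u))) (at 0)"
    by (rule has_derivative_compose[OF bounded_linear_imp_has_derivative[OF lin]]) (simp add: G1(1))
  moreover have "(\<lambda>t. G1 (t *\<^sub>C u)) = (*) (G1 u)"
    using G1(2) by (auto simp: clinear_on_def scaleC_complex_def mult.commute)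
  ultimately have "((\<lambda>t. G (t *\<^sub>C u)) has_field_derivative G1 u) (at 0)"
    by (simp add: has_field_derivative_def)
  then have "deriv (\<lambda>t. G (t *\<^sub>C u)) 0 = G1 u" by (rule DERIV_imp_deriv)
  moreover have "cmod (deriv (\<lambda>t. G (t *\<^sub>C u)) 0) \<le> 1"
    by (rule Schwarz_Lemma(2)[OF hol, where \<xi> = 0]) (simp_all add: G u)
  ultimately show ?thesis by simp
qed

lemma herm_form_cinner: "herm_form (cinner :: 'h::complex_hilbert_space \<Rightarrow> 'h \<Rightarrow> complex)"
proof -
  have "0 < Re (cinner x x)" if "x \<noteq> 0" for x :: 'h
    using that norm_eq_sqrt_cinner[of x] by (metis not_less real_sqrt_le_0_iff norm_le_zero_iff)
  then show ?thesis
    unfolding herm_form_def using cinner_add_left cinner_scaleC_left cinner_commute by blast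
qed

lemma cinner_self: "cinner x x = of_real ((norm (x::'h::complex_hilbert_space))\<^sup>2)"
proof -
  have "0 \<le> Re (cinner x x)" using norm_ge_zero[of x] unfolding norm_eq_sqrt_cinner[of x] by (simp only: real_sqrt_ge_0_iff)
  then show ?thesis using hf_self_real[OF herm_form_cinner, of x] by (simp add: norm_eq_sqrt_cinner)
qed

lemmas cinner_left = hf_left[OF herm_form_cinner] and cinner_right = hf_right[OF herm_form_cinner]

lemma cinner_Cauchy_Schwarz: "cmod (cinner x y) \<le> norm x * norm (y::'h::complex_hilbert_space)"
proof (cases "y = 0")
  case True
  then show ?thesis using hf_zero[OF herm_form_cinner] by simp
next
  case False
  define c where "c = cinner x y / of_real ((norm y)\<^sup>2)"
  have ny: "complex_of_real ((norm y)\<^sup>2) \<noteq> 0" using False by simp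
  define z where "z = x - c *\<^sub>C y"
  have x: "x = z + c *\<^sub>C y" by (simp add: z_def)
  have "cinner x y = cinner z y + c * of_real ((norm y)\<^sup>2)"
    by (subst x) (simp add: cinner_left cinner_self)
  then have zy: "cinner z y = 0" using ny by (simp add: c_def)
  then have yz: "cinner y z = 0" using cinner_commute[of y z] by simp
  have "cinner x x = cinner z z + c * cnj c * cinner y y"
    by (subst (1 2) x) (simp add: cinner_left cinner_right zy yz)
  then have "complex_of_real ((norm x)\<^sup>2) = of_real ((norm z)\<^sup>2 + (cmod c)\<^sup>2 * (norm y)\<^sup>2)"
    unfolding cinner_self of_real_add of_real_mult complex_norm_square .
  then have "(norm x)\<^sup>2 = (norm z)\<^sup>2 + (cmod c)\<^sup>2 * (norm y)\<^sup>2" by (simp only: of_real_eq_iff)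
  then have "(cmod c * norm y)\<^sup>2 \<le> (norm x)\<^sup>2" by (simp add: power_mult_distrib)
  then have "cmod c * norm y \<le> norm x" by (rule power2_le_imp_le) simp
  then have "cmod c * norm y * norm y \<le> norm x * norm y" by (rule mult_right_mono) simp
  moreover have "cmod (cinner x y) = cmod c * norm y * norm y"
    using False by (simp add: c_def norm_divide norm_mult power2_eq_square)
  ultimately show ?thesis by simp
qed

lemma parallelogram: "(norm (x + y))\<^sup>2 + (norm (x - y))\<^sup>2 = 2 * (norm x)\<^sup>2 + 2 * (norm (y::'h::complex_hilbert_space))\<^sup>2"
proof -
  have m: "cinner (- y) z = - cinner y z" "cinner z (- y) = - cinner z y" for z
    using cinner_left(2)[of "-1" y z] cinner_right(2)[of z "-1" y] by simp_all
  have "complex_of_real ((norm (x + y))\<^sup>2 + (norm (x + - y))\<^sup>2) = of_real (2 * (norm x)\<^sup>2 + 2 * (norm y)\<^sup>2)"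
    unfolding of_real_add of_real_mult cinner_self[symmetric] cinner_left(1) cinner_right(1) m by simp
  then show ?thesis by (simp only: of_real_eq_iff diff_conv_add_uminus)
qed

text \<open>
  With \<open>F1\<close> and \<open>G1\<close> the derivatives at 0 of \<open>f\<close> and of its inverse, in coordinates: \<open>Ple\<close> bounds \<open>F1\<close>
  from above on directions whose open disc lies in the domain, and \<open>Pge\<close> bounds it from below on the
  diagonal units, because the diagonal entries of the inverse stay below 1.
\<close>
lemma D27_upper_bound:
  fixes f :: "coct_mat \<Rightarrow> 'h::complex_hilbert_space"
  assumes f: "f \<in> hol_embeddings D27" "f 0 = 0" and r: "0 < r" "ball 0 r \<subseteq> f ` D27"
  shows "r \<le> 1 / sqrt 3"
proof -
  have hf: "holomorphic_map_on f D27" "inj_on f D27" "f ` D27 \<subseteq> ball 0 1" "open (f ` D27)"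
    "holomorphic_map_on (inv_into D27 f) (f ` D27)"
    using f(1) by (simp_all add: hol_embeddings_def)
  define F where "F v = f (alb_mat v)" for v
  define G where "G y = alb_of (inv_into D27 f y)" for y
  have GF: "G (F v) = v" if "v \<in> alb_dom" for v
    using inv_into_f_f[OF hf(2), of "alb_mat v"] that by (simp add: G_def F_def D27_eq)
  have Gdom: "G y \<in> alb_dom" if "y \<in> f ` D27" for y
    using inv_into_into[OF that] by (auto simp: G_def D27_eq)
  have F0: "F 0 = 0" using f(2) by (simp add: F_def)
  have G0: "G 0 = 0" using GF[OF zero_alb_dom] F0 by simp
  have holF: "holomorphic_map_on F alb_dom"
    unfolding F_def by (rule holomorphic_map_on_compose[OF holomorphic_alb_mat hf(1)]) (simp add: D27_eq)
  have holG: "holomorphic_map_on G (f ` D27)"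
    unfolding G_def by (rule holomorphic_map_on_compose[OF hf(5) holomorphic_alb_of[of UNIV] subset_UNIV])
  obtain F1 where F1: "clinear_on UNIV F1" "(F has_derivative F1) (at 0)"
    using holF zero_alb_dom at_within_open[OF zero_alb_dom open_alb_dom] unfolding holomorphic_map_on_def by metis
  have zero: "0 \<in> f ` D27" using r by auto
  obtain G1 where G1: "clinear_on UNIV G1" "(G has_derivative G1) (at 0)"
    using holG zero at_within_open[OF zero hf(4)] unfolding holomorphic_map_on_def by metis
  have "((\<lambda>v. G (F v)) has_derivative (\<lambda>h. G1 (F1 h))) (at 0)"
    using has_derivative_compose[OF F1(2), of G G1] G1(2) F0 by simp
  then have "((\<lambda>v. v) has_derivative (\<lambda>h. G1 (F1 h))) (at 0)"
    by (rule has_derivative_transform_within_open[OF _ open_alb_dom zero_alb_dom GF])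
  from has_derivative_unique[OF this has_derivative_ident] have GF1: "G1 (F1 h) = h" for h
    by (rule fun_cong)
  have Ple: "norm (F1 u) \<le> 1" if u: "\<And>t. cmod t < 1 \<Longrightarrow> t *\<^sub>C u \<in> alb_dom" for u
  proof (cases "F1 u = 0")
    case False
    \<comment> \<open>pairing with the normalized image detects its norm\<close>
    define w where "w = (1 / norm (F1 u)) *\<^sub>R F1 u"
    have nw: "norm w = 1" using False by (simp add: w_def)
    have cw: "clinear_on UNIV (\<lambda>y. cinner y w)" by (simp add: clinear_on_def cinner_left scaleC_complex_def)
    have bw: "bounded_linear (\<lambda>y. cinner y w)"
    proof (rule bounded_linear_intro)
      show "cinner (x + y) w = cinner x w + cinner y w" for x y by (rule cinner_left)
      show "cinner (r *\<^sub>R x) w = r *\<^sub>R cinner x w" for r x by (rule clinear_on_scaleR[OF cw])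
      show "norm (cinner x w) \<le> norm x * 1" for x using cinner_Cauchy_Schwarz[of x w] nw by simp
    qed
    have "cmod (cinner (F1 u) w) \<le> 1"
    proof (rule schwarz_directional[where S = alb_dom and G = "\<lambda>v. cinner (F v) w" and ?G1.0 = "\<lambda>v. cinner (F1 v) w"])
      show "holomorphic_map_on (\<lambda>v. cinner (F v) w) alb_dom"
        by (rule holomorphic_map_on_compose[OF holF holomorphic_map_on_clinear[OF cw bw, of UNIV] subset_UNIV])
      show "cinner (F 0) w = 0" using hf_zero[OF herm_form_cinner] by (simp add: F0)
      show "cmod (cinner (F v) w) < 1" if "v \<in> alb_dom" for v
      proof -
        have "F v \<in> ball 0 1" using hf(3) that unfolding F_def D27_eq by blast
        then have "norm (F v) < 1" by simp
        then show ?thesis using cinner_Cauchy_Schwarz[of "F v" w] nw by simp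
      qed
      show "((\<lambda>v. cinner (F v) w) has_derivative (\<lambda>v. cinner (F1 v) w)) (at 0)"
        by (rule bounded_linear.has_derivative[OF bw F1(2)])
      show "clinear_on UNIV (\<lambda>v. cinner (F1 v) w)"
        using F1(1) cw unfolding clinear_on_def by (simp del: split_paired_All)
    qed (rule u)
    moreover have "cinner (F1 u) w = of_real (norm (F1 u))"
      using False by (simp add: w_def cinner_right cinner_self power2_eq_square flip: scaleC_of_real)
    ultimately show ?thesis by simp
  qed simp
  have Pge: "r \<le> norm (F1 (alb_unit i))" for i
  proof -
    define e where "e = F1 (alb_unit i)"
    have "e \<noteq> 0"
    proof
      assume "e = 0"
      then have "alb_unit i = 0" using GF1[of "alb_unit i"] clinear_on_scaleR[OF G1(1), of 0 0] by (simp add: e_def)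
      then have "dg (alb_unit i) i = 0" by simp
      then show False by simp
    qed
    \<comment> \<open>\<open>h\<close> lies on the sphere of radius \<open>r\<close>, and \<open>G1\<close> maps it to a multiple of the diagonal unit\<close>
    define h where "h = (r / norm e) *\<^sub>R e"
    have nh: "norm h = r" using \<open>e \<noteq> 0\<close> r(1) by (simp add: h_def)
    have cd: "clinear_on UNIV (\<lambda>v. dg v i)" by (simp add: clinear_on_def scaleC_complex_def)
    have sub: "G ` ball 0 r \<subseteq> alb_dom" using Gdom r(2) by blast
    have holGr: "holomorphic_map_on G (ball 0 r)"
      using holG r(2) unfolding holomorphic_map_on_def by (meson has_derivative_subset subsetD)
    have "cmod (dg (G1 h) i) \<le> 1"
    proof (rule schwarz_directional[where S = "ball 0 r" and G = "\<lambda>y. dg (G y) i" and ?G1.0 = "\<lambda>y. dg (G1 y) i"])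
      show "holomorphic_map_on (\<lambda>y. dg (G y) i) (ball 0 r)"
        by (rule holomorphic_map_on_compose[OF holGr holomorphic_map_on_clinear[OF cd bounded_linear_dg, of UNIV] subset_UNIV])
      show "dg (G 0) i = 0" by (simp add: G0)
      show "cmod (dg (G y) i) < 1" if "y \<in> ball 0 r" for y
        using that sub by (intro alb_dom_dg_less_1) blast
      show "t *\<^sub>C h \<in> ball 0 r" if "cmod t < 1" for t
        using that r(1) by (simp add: norm_scaleC nh)
      show "((\<lambda>y. dg (G y) i) has_derivative (\<lambda>y. dg (G1 y) i)) (at 0)"
        by (rule bounded_linear.has_derivative[OF bounded_linear_dg G1(2)])
      show "clinear_on UNIV (\<lambda>y. dg (G1 y) i)"
        using G1(1) by (simp add: clinear_on_def scaleC_complex_def)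
    qed
    moreover have "G1 h = (r / norm e) *\<^sub>R alb_unit i"
      by (simp add: h_def clinear_on_scaleR[OF G1(1)] e_def GF1)
    ultimately have "r / norm e \<le> 1" using r(1) by (simp add: norm_divide)
    then show ?thesis using \<open>e \<noteq> 0\<close> by (simp add: e_def[symmetric] divide_le_eq_1)
  qed
  have sgn: "norm (F1 (alb_unit 1) + a *\<^sub>R F1 (alb_unit 2) + b *\<^sub>R F1 (alb_unit 3)) \<le> 1"
    if ab: "\<bar>a\<bar> = 1" "\<bar>b\<bar> = 1" for a b :: real
  proof -
    define u where "u = alb_unit 1 + a *\<^sub>R alb_unit 2 + b *\<^sub>R alb_unit 3"
    have "t *\<^sub>C u \<in> alb_dom" if "cmod t < 1" for t
    proof -
      have e: "t *\<^sub>C u = alb_diag (\<lambda>i. if i = 1 then t else if i = 2 then t * of_real a else t * of_real b)"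
        unfolding u_def by (rule alb_eqI3) simp_all
      show ?thesis using that ab by (subst alb_dom_diag[OF alb_group_id e]) (simp add: norm_mult)
    qed
    then have "norm (F1 u) \<le> 1" by (rule Ple)
    then show ?thesis
      using F1(1) clinear_on_scaleR[OF F1(1)] by (simp add: u_def clinear_on_def del: split_paired_All)
  qed
  define x y z where xyz: "x = F1 (alb_unit 1)" "y = F1 (alb_unit 2)" "z = F1 (alb_unit 3)"
  have n: "norm (x + y + z) \<le> 1" "norm (x + y - z) \<le> 1" "norm (x - y + z) \<le> 1" "norm (x - y - z) \<le> 1"
    using sgn[of 1 1] sgn[of 1 "-1"] sgn[of "-1" 1] sgn[of "-1" "-1"] by (simp_all add: xyz)
  have "(norm (x + y + z))\<^sup>2 + (norm (x + y - z))\<^sup>2 + (norm (x - y + z))\<^sup>2 + (norm (x - y - z))\<^sup>2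
      = 4 * ((norm x)\<^sup>2 + (norm y)\<^sup>2 + (norm z)\<^sup>2)"
    using parallelogram[of "x + y" z] parallelogram[of "x - y" z] parallelogram[of x y] by simp
  moreover have "(norm (x + y + z))\<^sup>2 \<le> 1" "(norm (x + y - z))\<^sup>2 \<le> 1" "(norm (x - y + z))\<^sup>2 \<le> 1" "(norm (x - y - z))\<^sup>2 \<le> 1"
    using n by (simp_all add: abs_square_le_1)
  moreover have "r\<^sup>2 \<le> (norm x)\<^sup>2" "r\<^sup>2 \<le> (norm y)\<^sup>2" "r\<^sup>2 \<le> (norm z)\<^sup>2"
    using Pge r(1) by (simp_all add: xyz power_mono)
  ultimately have "r\<^sup>2 \<le> (1 / sqrt 3)\<^sup>2" by (simp add: power_divide)
  then show ?thesis by (rule power2_le_imp_le) simp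
qed

section \<open>The squeezing constant\<close>

theorem proposition4p2:
  assumes "linearly_homeomorphic H3O (UNIV :: 'h::complex_hilbert_space set)"
  shows "squeezing_constant TYPE('h) D27 = 1 / sqrt 3"
proof -
  obtain L :: "coct_mat \<Rightarrow> 'h" and L' where L: "clinear_on H3O L" "homeomorphism H3O UNIV L L'"
    using assms unfolding linearly_homeomorphic_def by blast
  have "clinear_on UNIV (\<lambda>v. L (alb_mat v))"
    using L(1) unfolding clinear_on_def by (simp add: alb_mat_add alb_mat_scaleC del: split_paired_All)
  moreover have "bij (\<lambda>v. L (alb_mat v))"
  proof (rule bijI)
    show "inj (\<lambda>v. L (alb_mat v))"
      using L(2) unfolding homeomorphism_def by (metis (no_types, lifting) alb_mat_H3O alb_mat_inject injI)
    show "surj (\<lambda>v. L (alb_mat v))"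
      using L(2) unfolding homeomorphism_def H3O_eq by (simp add: image_image)
  qed
  ultimately obtain M :: "alb \<Rightarrow> 'h" where M: "clinear_on UNIV M" "bij M" "\<And>v. (norm (M v))\<^sup>2 = hsq v"
    by (rule unitary_exists) (rule that)
  define R where "R p = {r. r > 0 \<and> (\<exists>f :: coct_mat \<Rightarrow> 'h. f \<in> hol_embeddings D27 \<and> f p = 0 \<and> ball 0 r \<subseteq> f ` D27)}" for p
  have sq: "squeezing_function TYPE('h) D27 p = Sup (R p)" for p
    by (simp add: squeezing_function_def R_def)
  have mem: "1 / sqrt 3 \<in> R p" if p: "p \<in> D27" for p
  proof -
    obtain f :: "coct_mat \<Rightarrow> 'h" where "f \<in> hol_embeddings D27" "f p = 0" "ball 0 (1 / sqrt 3) \<subseteq> f ` D27"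
      by (rule D27_embedding[OF M p])
    then show ?thesis unfolding R_def by auto
  qed
  have le1: "r \<le> 1" if "r \<in> R p" for r p
  proof (rule ccontr)
    assume "\<not> r \<le> 1"
    \<comment> \<open>a unit vector of the Hilbert space lies in no image contained in the open unit ball\<close>
    have "complex_of_real (hsq (alb_unit 1)) = of_real 1" unfolding herm_self[symmetric] by simp
    then have "(norm (M (alb_unit 1)))\<^sup>2 = 1" unfolding M(3) by (simp only: of_real_eq_iff)
    then have n: "norm (M (alb_unit 1)) = 1" by (simp add: power2_eq_1_iff) (metis norm_ge_zero neg_0_le_iff_le not_one_le_zero)
    obtain f :: "coct_mat \<Rightarrow> 'h" where "f ` D27 \<subseteq> ball 0 1" "ball 0 r \<subseteq> f ` D27"
      using \<open>r \<in> R p\<close> by (auto simp: R_def hol_embeddings_def)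
    moreover have "M (alb_unit 1) \<in> ball 0 r" using n \<open>\<not> r \<le> 1\<close> by simp
    ultimately have "M (alb_unit 1) \<in> ball 0 1" by blast
    then show False using n by simp
  qed
  have ge: "1 / sqrt 3 \<le> squeezing_function TYPE('h) D27 p" if "p \<in> D27" for p
    unfolding sq by (rule cSup_upper[OF mem[OF that]]) (rule bdd_aboveI[where M = 1], rule le1)
  have zero: "0 \<in> D27" unfolding D27_eq using zero_alb_dom alb_mat_zero by (metis imageI)
  have "squeezing_function TYPE('h) D27 0 \<le> 1 / sqrt 3"
    unfolding sq
  proof (rule cSup_least)
    show "R 0 \<noteq> {}" using mem[OF zero] by blast
    show "r \<le> 1 / sqrt 3" if "r \<in> R 0" for r
      using that D27_upper_bound[of _ r] by (auto simp: R_def)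
  qed
  moreover have "squeezing_constant TYPE('h) D27 \<le> squeezing_function TYPE('h) D27 0"
    unfolding squeezing_constant_def 
    by (rule cINF_lower[OF bdd_belowI2 zero]) (rule ge)
  moreover have "1 / sqrt 3 \<le> squeezing_constant TYPE('h) D27"
    unfolding squeezing_constant_def using zero by (intro cINF_greatest ge) auto
  ultimately show ?thesis by simp
qed

end
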